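(* Let $\Sigma$ be a compact Riemann surface possibly with boundary $\partial\Sigma$, and let $D\subset\Sigma$ be a finite subset not meeting $\partial\Sigma$. Let $\alpha\in\mathcal A^1(\Sigma,\star D)$. Then $$\operatorname{Reg}\!\int_\Sigma d\alpha=-2\pi i\,\operatorname{Res}_\Sigma(\alpha)+\int_{\partial\Sigma}\alpha.$$
   Context: $\mathcal A^{p,q}(\Sigma,\star D)$ is the space of complex-valued $(p,q)$-forms which are smooth on $\Sigma\setminus D$ and which near each $p\in D$ have the form $\alpha_0/z^N$, where $z$ is a local holomorphic coordinate with $z(p)=0$, $N\ge0$ is an integer and $\alpha_0$ is a smooth form near $p$; $\mathcal A^k(\Sigma,\star D)=\bigoplus_{p+q=k}\mathcal A^{p,q}(\Sigma,\star D)$. $\mathcal A^2(\Sigma,\log D)$ is the space of $2$-forms, smooth on $\Sigma\setminus D$, which near each $p\in D$ have the form $\frac{dz}z\wedge\beta_0$ with $\beta_0$ a smooth $(0,1)$-form. $d=\partial+\bar\partial$ is the de Rham differential. Every $\omega\in\mathcal A^2(\Sigma,\star D)$ can be written $\omega=\alpha'+\partial\beta'$ with $\alpha'\in\mathcal A^2(\Sigma,\log D)$, $\beta'\in\mathcal A^{0,1}(\Sigma,\star D)$, and the regularized integral is $\operatorname{Reg}\!\int_\Sigma\omega:=\int_\Sigma\alpha'+\int_{\partial\Sigma}\beta'$, which is well defined and independent of the choice. For $\alpha\in\mathcal A^1(\Sigma,\star D)$ and $p\in D$, $\operatorname{Res}_p\alpha:=\frac1{2\pi i}\lim_{\epsilon\to0}\int_{|z|=\epsilon}\alpha$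 (counterclockwise circle; $z$ a local holomorphic coordinate with $z(p)=0$); the limit exists and is independent of $z$. $\operatorname{Res}_\Sigma(\alpha):=\sum_{p\in D}\operatorname{Res}_p\alpha$. *)

theory Defs
  imports "HOL-Analysis.Analysis"
begin

section \<open>Smooth functions on subsets of the plane\<close>

text \<open>On an open set, \<open>f\<close> is $C^{k+1}$ if it is real-differentiable there with partial
  derivatives of class $C^k$.\<close>

fun ck_on :: "nat \<Rightarrow> (complex \<Rightarrow> complex) \<Rightarrow> complex set \<Rightarrow> bool" where
  "ck_on 0 f T \<longleftrightarrow> continuous_on T f"
| "ck_on (Suc k) f T \<longleftrightarrow>
     (\<exists>fx fy. (\<forall>z\<in>T. (f has_derivative (\<lambda>h. of_real (Re h) * fx z + of_real (Im h) * fy z)) (at z))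
        \<and> ck_on k fx T \<and> ck_on k fy T)"

text \<open>On an arbitrary set (in practice relatively open in the closed upper half plane), smooth means
  locally the restriction of a smooth function on an open subset of the plane.\<close>

definition smooth_on :: "(complex \<Rightarrow> complex) \<Rightarrow> complex set \<Rightarrow> bool" where
  "smooth_on f S \<longleftrightarrow>
     (\<forall>z\<in>S. \<exists>T g. open T \<and> z \<in> T \<and> (\<forall>k. ck_on k g T) \<and> (\<forall>w\<in>T \<inter> S. f w = g w))"

text \<open>The derivatives are taken within \<open>S\<close>, so that they make sense at boundary points of a
  relatively open subset of the closed upper half plane.\<close>

definition wirtinger_z :: "complex set \<Rightarrow> (complex \<Rightarrow> complex) \<Rightarrow> complex \<Rightarrow> complex" where
  "wirtinger_z S f z =
     (let f' = frechet_derivative f (at z within S) in (f' 1 - \<i> * f' \<i>) / 2)"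

definition wirtinger_zbar :: "complex set \<Rightarrow> (complex \<Rightarrow> complex) \<Rightarrow> complex \<Rightarrow> complex" where
  "wirtinger_zbar S f z =
     (let f' = frechet_derivative f (at z within S) in (f' 1 + \<i> * f' \<i>) / 2)"


section \<open>Riemann surfaces with boundary\<close>

definition half_plane :: "complex set" where
  "half_plane = {z. 0 \<le> Im z}"

text \<open>A chart \<open>(U, \<phi>)\<close>; values of \<open>\<phi>\<close> outside \<open>U\<close> are irrelevant.\<close>

type_synonym 'a chart = "'a set \<times> ('a \<Rightarrow> complex)"

definition chart_image :: "'a chart \<Rightarrow> complex set" where
  "chart_image c = snd c ` fst c"

definition chart_inv :: "'a chart \<Rightarrow> complex \<Rightarrow> 'a" where
  "chart_inv c = inv_into (fst c) (snd c)"

definition is_chart :: "'a topology \<Rightarrow> 'a chart \<Rightarrow> bool" where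
  "is_chart X c \<longleftrightarrow> openin X (fst c)
     \<and> (open (chart_image c) \<or> openin (top_of_set half_plane) (chart_image c))
     \<and> homeomorphic_map (subtopology X (fst c)) (top_of_set (chart_image c)) (snd c)"

definition transition :: "'a chart \<Rightarrow> 'a chart \<Rightarrow> complex \<Rightarrow> complex" where
  "transition c c' = snd c' \<circ> chart_inv c"

definition transition_dom :: "'a chart \<Rightarrow> 'a chart \<Rightarrow> complex set" where
  "transition_dom c c' = snd c ` (fst c \<inter> fst c')"

text \<open>At boundary points, a transition map is holomorphic if it extends holomorphically to a
  neighbourhood in the plane.\<close>

definition holomorphic_transition :: "'a chart \<Rightarrow> 'a chart \<Rightarrow> bool" where
  "holomorphic_transition c c' \<longleftrightarrow>
     (\<exists>g. g analytic_on transition_dom c c' \<and> (\<forall>z\<in>transition_dom c c'. g z = transition c c' z))"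

text \<open>The atlas is maximal, so that its members are exactly the local holomorphic coordinates.
  Connectedness is not required.\<close>

definition riemann_surface :: "'a topology \<Rightarrow> 'a chart set \<Rightarrow> bool" where
  "riemann_surface X A \<longleftrightarrow> Hausdorff_space X \<and> second_countable X
     \<and> (\<forall>c\<in>A. is_chart X c)
     \<and> (\<Union>c\<in>A. fst c) = topspace X
     \<and> (\<forall>c\<in>A. \<forall>c'\<in>A. holomorphic_transition c c')
     \<and> (\<forall>c. is_chart X c
            \<and> (\<forall>c'\<in>A. holomorphic_transition c c' \<and> holomorphic_transition c' c) \<longrightarrow> c \<in> A)"

definition surface_boundary :: "'a chart set \<Rightarrow> 'a set" where
  "surface_boundary A =
     {x. \<exists>c\<in>A. x \<in> fst c \<and> openin (top_of_set half_plane) (chart_image c) \<and> Im (snd c x) = 0}"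

text \<open>Local holomorphic coordinates vanishing at an interior point \<open>p\<close>.\<close>

definition centred_chart :: "'a chart set \<Rightarrow> 'a \<Rightarrow> 'a chart \<Rightarrow> bool" where
  "centred_chart A p c \<longleftrightarrow> c \<in> A \<and> p \<in> fst c \<and> snd c p = 0 \<and> open (chart_image c)"


section \<open>Differential forms\<close>

text \<open>A \<open>(p,q)\<close>-form with $p, q \le 1$ is given by its coefficient $f_c$ in every chart $c$ with
  coordinate $z$, the form being $f_c\,dz^p \wedge d\bar z^q$; in particular a \<open>(1,1)\<close>-form is
  $f_c\,dz \wedge d\bar z$. Coefficients are functions of the coordinate, and only their values on
  the chart image with the singular points removed matter.\<close>

type_synonym 'a form = "'a chart \<Rightarrow> complex \<Rightarrow> complex"

definition is_form :: "nat \<Rightarrow> nat \<Rightarrow> 'a chart set \<Rightarrow> 'a set \<Rightarrow> 'a form \<Rightarrow> bool" where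
  "is_form p q A D \<omega> \<longleftrightarrow>
     (\<forall>c\<in>A. \<forall>c'\<in>A. \<forall>x\<in>(fst c \<inter> fst c') - D. \<forall>t.
        (transition c c' has_field_derivative t) (at (snd c x) within transition_dom c c') \<longrightarrow>
        \<omega> c (snd c x) = \<omega> c' (snd c' x) * t ^ p * cnj t ^ q)"

definition smooth_form_off :: "nat \<Rightarrow> nat \<Rightarrow> 'a chart set \<Rightarrow> 'a set \<Rightarrow> 'a form \<Rightarrow> bool" where
  "smooth_form_off p q A D \<omega> \<longleftrightarrow>
     is_form p q A D \<omega> \<and> (\<forall>c\<in>A. smooth_on (\<omega> c) (snd c ` (fst c - D)))"

text \<open>Near \<open>x\<close>, in some local coordinate $z$ with $z(x) = 0$, the form is a smooth form divided
  by $z^N$.\<close>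

definition pole_at :: "'a chart set \<Rightarrow> 'a \<Rightarrow> nat \<Rightarrow> 'a form \<Rightarrow> bool" where
  "pole_at A x N \<omega> \<longleftrightarrow>
     (\<exists>c g r. centred_chart A x c \<and> 0 < r \<and> ball 0 r \<subseteq> chart_image c \<and> smooth_on g (ball 0 r)
        \<and> (\<forall>z\<in>ball 0 r - {0}. \<omega> c z = g z / z ^ N))"

definition polar_forms :: "nat \<Rightarrow> nat \<Rightarrow> 'a chart set \<Rightarrow> 'a set \<Rightarrow> 'a form set" where
  "polar_forms p q A D = {\<omega>. smooth_form_off p q A D \<omega> \<and> (\<forall>x\<in>D. \<exists>N. pole_at A x N \<omega>)}"

text \<open>$\mathcal A^1 = \mathcal A^{1,0} \oplus \mathcal A^{0,1}$: a pair \<open>(a, b)\<close> stands for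
  $a\,dz + b\,d\bar z$.\<close>

type_synonym 'a form1 = "'a form \<times> 'a form"

definition polar_1forms :: "'a chart set \<Rightarrow> 'a set \<Rightarrow> 'a form1 set" where
  "polar_1forms A D = polar_forms 1 0 A D \<times> polar_forms 0 1 A D"

text \<open>Near a point of \<open>D\<close> the form is $\frac{dz}{z} \wedge \beta_0$ with
  $\beta_0 = g\,d\bar z$ smooth, that is, it has coefficient $g/z$.\<close>

definition log_2forms :: "'a chart set \<Rightarrow> 'a set \<Rightarrow> 'a form set" where
  "log_2forms A D = {\<omega>. smooth_form_off 1 1 A D \<omega> \<and> (\<forall>x\<in>D. pole_at A x 1 \<omega>)}"

text \<open>$\partial(b\,d\bar z) = b_z\,dz \wedge d\bar z$ and
  $\bar\partial(a\,dz) = a_{\bar z}\,d\bar z \wedge dz = -a_{\bar z}\,dz \wedge d\bar z$; the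
  components $\partial(a\,dz)$ and $\bar\partial(b\,d\bar z)$ vanish in complex dimension one.\<close>

definition del_01 :: "'a form \<Rightarrow> 'a form" where
  "del_01 \<beta> = (\<lambda>c. wirtinger_z (chart_image c) (\<beta> c))"

definition delbar_10 :: "'a form \<Rightarrow> 'a form" where
  "delbar_10 \<alpha> = (\<lambda>c z. - wirtinger_zbar (chart_image c) (\<alpha> c) z)"

definition ext_d :: "'a form1 \<Rightarrow> 'a form" where
  "ext_d \<alpha> = (\<lambda>c z. delbar_10 (fst \<alpha>) c z + del_01 (snd \<alpha>) c z)"


section \<open>Integration\<close>

definition partition_of_unity ::
  "'a topology \<Rightarrow> 'a chart set \<Rightarrow> 'a chart set \<Rightarrow> ('a chart \<Rightarrow> 'a \<Rightarrow> real) \<Rightarrow> bool" where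
  "partition_of_unity X A C \<rho> \<longleftrightarrow> finite C \<and> C \<subseteq> A
     \<and> (\<forall>c\<in>C. \<forall>x\<in>topspace X. 0 \<le> \<rho> c x)
     \<and> (\<forall>c\<in>C. \<forall>c'\<in>A. smooth_on (\<lambda>z. of_real (\<rho> c (chart_inv c' z))) (chart_image c'))
     \<and> (\<forall>c\<in>C. X closure_of {x\<in>topspace X. \<rho> c x \<noteq> 0} \<subseteq> fst c)
     \<and> (\<forall>x\<in>topspace X. (\<Sum>c\<in>C. \<rho> c x) = 1)"

text \<open>Absolutely convergent integral of a 2-form, using $dz \wedge d\bar z = -2i\,dx \wedge dy$.\<close>

definition has_surface_integral ::
  "'a topology \<Rightarrow> 'a chart set \<Rightarrow> 'a form \<Rightarrow> complex \<Rightarrow> bool" where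
  "has_surface_integral X A \<omega> I \<longleftrightarrow>
     (\<exists>C \<rho>. partition_of_unity X A C \<rho>
        \<and> (\<forall>c\<in>C. set_integrable lborel (chart_image c)
                    (\<lambda>z. of_real (\<rho> c (chart_inv c z)) * \<omega> c z * (- 2 * \<i>)))
        \<and> I = (\<Sum>c\<in>C. LINT z:chart_image c|lborel.
                    of_real (\<rho> c (chart_inv c z)) * \<omega> c z * (- 2 * \<i>)))"

definition surface_integral :: "'a topology \<Rightarrow> 'a chart set \<Rightarrow> 'a form \<Rightarrow> complex" where
  "surface_integral X A \<omega> = (THE I. has_surface_integral X A \<omega> I)"

text \<open>The part of the real line in the image of a chart that corresponds to boundary points. The
  induced boundary orientation is the direction of increasing real part, since surfaces are modelled
  on the upper half plane. On the real line $dz$ and $d\bar z$ both restrict to $dx$.\<close>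

definition boundary_trace :: "'a chart set \<Rightarrow> 'a chart \<Rightarrow> real set" where
  "boundary_trace A c = {x. complex_of_real x \<in> snd c ` (fst c \<inter> surface_boundary A)}"

definition has_boundary_integral ::
  "'a topology \<Rightarrow> 'a chart set \<Rightarrow> 'a form1 \<Rightarrow> complex \<Rightarrow> bool" where
  "has_boundary_integral X A \<alpha> I \<longleftrightarrow>
     (\<exists>C \<rho>. partition_of_unity X A C \<rho>
        \<and> (\<forall>c\<in>C. set_integrable lborel (boundary_trace A c)
                    (\<lambda>x. of_real (\<rho> c (chart_inv c (of_real x)))
                           * (fst \<alpha> c (of_real x) + snd \<alpha> c (of_real x))))
        \<and> I = (\<Sum>c\<in>C. LINT x:boundary_trace A c|lborel.
                    of_real (\<rho> c (chart_inv c (of_real x)))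
                      * (fst \<alpha> c (of_real x) + snd \<alpha> c (of_real x))))"

definition boundary_integral :: "'a topology \<Rightarrow> 'a chart set \<Rightarrow> 'a form1 \<Rightarrow> complex" where
  "boundary_integral X A \<alpha> = (THE I. has_boundary_integral X A \<alpha> I)"

text \<open>The form $\omega = \alpha' + \partial\beta'$ with $\alpha'$ logarithmic and
  $\beta' \in \mathcal A^{0,1}(\Sigma, \star D)$.\<close>

definition has_reg_integral ::
  "'a topology \<Rightarrow> 'a chart set \<Rightarrow> 'a set \<Rightarrow> 'a form \<Rightarrow> complex \<Rightarrow> bool" where
  "has_reg_integral X A D \<omega> I \<longleftrightarrow>
     (\<exists>\<alpha>' \<beta>'. \<alpha>' \<in> log_2forms A D \<and> \<beta>' \<in> polar_forms 0 1 A D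
        \<and> (\<forall>c\<in>A. \<forall>x\<in>fst c - D. \<omega> c (snd c x) = \<alpha>' c (snd c x) + del_01 \<beta>' c (snd c x))
        \<and> I = surface_integral X A \<alpha>' + boundary_integral X A (\<lambda>c z. 0, \<beta>'))"

definition reg_integral :: "'a topology \<Rightarrow> 'a chart set \<Rightarrow> 'a set \<Rightarrow> 'a form \<Rightarrow> complex" where
  "reg_integral X A D \<omega> = (THE I. has_reg_integral X A D \<omega> I)"


section \<open>Residues\<close>

text \<open>The integral of $a\,dz + b\,d\bar z$ over $|z| = \epsilon$, counterclockwise, in the
  coordinate of the chart.\<close>

definition circle_integral :: "'a form1 \<Rightarrow> 'a chart \<Rightarrow> real \<Rightarrow> complex" where
  "circle_integral \<alpha> c \<epsilon> = integral {0..2 * pi} (\<lambda>t.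
     let z = of_real \<epsilon> * cis t; dz = \<i> * z
     in fst \<alpha> c z * dz + snd \<alpha> c z * cnj dz)"

definition has_residue :: "'a chart set \<Rightarrow> 'a form1 \<Rightarrow> 'a \<Rightarrow> complex \<Rightarrow> bool" where
  "has_residue A \<alpha> p L \<longleftrightarrow>
     (\<exists>c. centred_chart A p c
        \<and> ((\<lambda>\<epsilon>. 1 / (2 * of_real pi * \<i>) * circle_integral \<alpha> c \<epsilon>) \<longlongrightarrow> L) (at_right 0))"

definition residue_at :: "'a chart set \<Rightarrow> 'a form1 \<Rightarrow> 'a \<Rightarrow> complex" where
  "residue_at A \<alpha> p = (THE L. has_residue A \<alpha> p L)"

definition total_residue :: "'a chart set \<Rightarrow> 'a set \<Rightarrow> 'a form1 \<Rightarrow> complex" where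
  "total_residue A D \<alpha> = (\<Sum>p\<in>D. residue_at A \<alpha> p)"

end

theory Submission
  imports Defs "HOL-Complex_Analysis.Complex_Analysis"
begin

text \<open>
  Write $\alpha = a\,dz + b\,d\bar z$ and suppose that $d\alpha = \alpha' + \partial\beta'$ with
  $\alpha'$ logarithmic and $\beta'$ of type $(0,1)$. In complex dimension one
  $\partial\beta' = d\beta'$, so $\alpha' = d(\alpha - \beta')$ away from $D$. Remove small discs
  around the points of $D$ and apply Stokes' formula: the integral of $\alpha'$ over the rest is the
  integral of $\alpha - \beta'$ over $\partial\Sigma$ minus its integrals over the small circles. As
  $\alpha'$ is absolutely integrable, the circle integrals converge when the discs shrink
  (\<open>surface_integral_exact\<close>). Moreover $\beta'$ does not contribute to the limits: the integral of
  $g\,d\bar z/z^N$ over a circle is essentially a Fourier coefficient of the smooth function $g$ of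
  frequency $N + 1$, and it decays fast enough (\<open>circle_fourier_decay\<close>). Therefore
  \[ \int_\Sigma \alpha' + \int_{\partial\Sigma} \beta' = \int_{\partial\Sigma} \alpha - \sum_{p \in D} L_p, \]
  where $L_p$ is the limit of the integrals of $\alpha$ over small circles around $p$
  (\<open>decomposition_value\<close>).

  This one formula also settles that the quantities involved are well defined. The right-hand side
  does not depend on the decomposition, so neither does the regularized integral. The left-hand side
  does not depend on the coordinates in which the circles are drawn, so neither does the sum of the
  $L_p$, and then neither does each single $L_p = 2\pi i \operatorname{Res}_p\alpha$
  (\<open>residue_at_eqI\<close>). In the same way the integrals over $\Sigma$ and $\partial\Sigma$ are
  seen to be independent of the partition of unity.

  There are two more ingredients. A decomposition exists (\<open>log_decomposition_exists\<close>), since up to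
  $z$-derivatives the order of a pole can be lowered to one. And Stokes' formula itself is reduced by
  a partition of unity and by cutoff functions around $D$ to forms that live in a single chart: to
  Green's formula for a rectangle (\<open>stokes_compact_support\<close>), or for an annulus that the exponential
  map pulls back to a rectangle (\<open>annulus_stokes\<close>). That a form supported in one chart may be
  integrated in this chart is the change of variables formula for holomorphic transition maps
  (\<open>single_chart_integral\<close>).
\<close>

section \<open>Wirtinger derivatives and functions of class $C^k$\<close>

text \<open>Both Wirtinger derivatives are carried by one real-linear derivative
  $h \mapsto A h + B \bar h$, so that the product rule, the chain rule and uniqueness come from
  \<open>has_derivative\<close>, also within a half plane.\<close>

definition has_wirtinger :: "(complex \<Rightarrow> complex) \<Rightarrow> complex \<Rightarrow> complex \<Rightarrow> complex filter \<Rightarrow> bool" where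
  "has_wirtinger f A B F \<longleftrightarrow> (f has_derivative (\<lambda>h. A * h + B * cnj h)) F"

lemma wirtinger_linear_map':
  "A * h + B * cnj h = of_real (Re h) * (A + B) + of_real (Im h) * (\<i> * (A - B))"
proof -
  have "h = of_real (Re h) + \<i> * of_real (Im h)" "cnj h = of_real (Re h) - \<i> * of_real (Im h)"
    by (simp_all add: complex_eq_iff)
  then have "A * h + B * cnj h = A * (of_real (Re h) + \<i> * of_real (Im h)) + B * (of_real (Re h) - \<i> * of_real (Im h))"
    by simp
  then show ?thesis by (simp add: algebra_simps)
qed

lemma wirtinger_linear_map:
  "of_real (Re h) * u + of_real (Im h) * v = (u - \<i> * v) / 2 * h + (u + \<i> * v) / 2 * cnj h"
proof -
  have "(u - \<i> * v) / 2 + (u + \<i> * v) / 2 = u" "\<i> * ((u - \<i> * v) / 2 - (u + \<i> * v) / 2) = v"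
    by (simp_all add: field_simps)
  then show ?thesis by (simp only: wirtinger_linear_map')
qed

lemma has_wirtinger_iff_partials:
  "(f has_derivative (\<lambda>h. of_real (Re h) * u + of_real (Im h) * v)) F
     \<longleftrightarrow> has_wirtinger f ((u - \<i> * v) / 2) ((u + \<i> * v) / 2) F"
  by (simp only: has_wirtinger_def wirtinger_linear_map)

lemma has_wirtinger_imp_partials:
  "has_wirtinger f A B F
     \<Longrightarrow> (f has_derivative (\<lambda>h. of_real (Re h) * (A + B) + of_real (Im h) * (\<i> * (A - B)))) F"
  by (simp only: has_wirtinger_def wirtinger_linear_map')

lemma has_wirtinger_const: "has_wirtinger (\<lambda>z. c) 0 0 F"
  by (simp add: has_wirtinger_def)

lemma has_wirtinger_add:
  "has_wirtinger f A B F \<Longrightarrow> has_wirtinger g A' B' F \<Longrightarrow> has_wirtinger (\<lambda>z. f z + g z) (A + A') (B + B') F"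
  unfolding has_wirtinger_def by (drule (1) has_derivative_add) (simp add: algebra_simps)

lemma has_wirtinger_diff:
  "has_wirtinger f A B F \<Longrightarrow> has_wirtinger g A' B' F \<Longrightarrow> has_wirtinger (\<lambda>z. f z - g z) (A - A') (B - B') F"
  unfolding has_wirtinger_def by (drule (1) has_derivative_diff) (simp add: algebra_simps)

lemma has_wirtinger_sum:
  assumes "\<And>i. i \<in> I \<Longrightarrow> has_wirtinger (f i) (A i) (B i) F"
  shows "has_wirtinger (\<lambda>z. \<Sum>i\<in>I. f i z) (\<Sum>i\<in>I. A i) (\<Sum>i\<in>I. B i) F"
  using assms
  by (induction I rule: infinite_finite_induct) (auto intro: has_wirtinger_add has_wirtinger_const)

lemma has_wirtinger_mult:
  "has_wirtinger f A B (at z within S) \<Longrightarrow> has_wirtinger g A' B' (at z within S)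
     \<Longrightarrow> has_wirtinger (\<lambda>z. f z * g z) (A * g z + f z * A') (B * g z + f z * B') (at z within S)"
  unfolding has_wirtinger_def by (drule (1) has_derivative_mult) (simp add: algebra_simps)

lemma has_wirtinger_cnj:
  "has_wirtinger f A B F \<Longrightarrow> has_wirtinger (\<lambda>z. cnj (f z)) (cnj B) (cnj A) F"
  unfolding has_wirtinger_def by (drule has_derivative_cnj) (simp add: algebra_simps)

lemma has_wirtinger_field_derivative:
  "(f has_field_derivative A) F \<Longrightarrow> has_wirtinger f A 0 F"
  by (simp add: has_wirtinger_def has_field_derivative_def)

lemma has_wirtinger_compose_inner:
  assumes "has_wirtinger f A B (at (h z) within T)" and "(h has_field_derivative h') (at z within S)"
    and "h ` S \<subseteq> T"
  shows "has_wirtinger (\<lambda>z. f (h z)) (A * h') (B * cnj h') (at z within S)"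
proof -
  have "((\<lambda>z. f (h z)) has_derivative (\<lambda>v. A * (h' * v) + B * cnj (h' * v))) (at z within S)"
    using has_derivative_in_compose2[of T f "\<lambda>x v. A * v + B * cnj v" h S z "\<lambda>v. h' * v"]
      has_derivative_in_compose[of h "\<lambda>v. h' * v" z S f "\<lambda>v. A * v + B * cnj v"] assms
    unfolding has_wirtinger_def has_field_derivative_def
    by (auto intro: has_derivative_subset)
  then show ?thesis by (simp add: has_wirtinger_def algebra_simps)
qed

lemma has_wirtinger_compose_outer:
  assumes "has_wirtinger f A B (at z within S)" and "(h has_field_derivative h') (at (f z))"
  shows "has_wirtinger (\<lambda>z. h (f z)) (h' * A) (h' * B) (at z within S)"
proof -
  have "((\<lambda>z. h (f z)) has_derivative (\<lambda>v. h' * (A * v + B * cnj v))) (at z within S)"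
    using has_derivative_compose[of f "\<lambda>v. A * v + B * cnj v" z S h "\<lambda>v. h' * v"] assms
    unfolding has_wirtinger_def has_field_derivative_def by auto
  then show ?thesis by (simp add: has_wirtinger_def algebra_simps)
qed

lemma has_wirtinger_transform:
  assumes "has_wirtinger f A B (at z within S)" "open T" "z \<in> T" "z \<in> S" "\<And>w. w \<in> T \<inter> S \<Longrightarrow> f w = g w"
  shows "has_wirtinger g A B (at z within S)"
proof -
  have "(f has_derivative (\<lambda>h. A * h + B * cnj h)) (at z within (S \<inter> T))"
    using assms(1) unfolding has_wirtinger_def by (rule has_derivative_subset) auto
  then have "(g has_derivative (\<lambda>h. A * h + B * cnj h)) (at z within (S \<inter> T))"
    by (rule has_derivative_transform[rotated 2]) (use assms in auto)
  moreover have "at z within (S \<inter> T) = at z within S"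
    by (rule at_within_nhd[where S = T]) (use assms in auto)
  ultimately show ?thesis by (simp add: has_wirtinger_def)
qed

lemma ck_on_cong:
  assumes "open T" "\<And>z. z \<in> T \<Longrightarrow> f z = g z" "ck_on k f T"
  shows "ck_on k g T"
proof (cases k)
  case 0
  then show ?thesis using assms(2,3) continuous_on_cong[of T T f g] by simp
next
  case (Suc j)
  then obtain fx fy where *: "\<forall>z\<in>T. (f has_derivative (\<lambda>h. of_real (Re h) * fx z + of_real (Im h) * fy z)) (at z)"
    "ck_on j fx T" "ck_on j fy T" using assms(3) by auto
  have "\<forall>z\<in>T. (g has_derivative (\<lambda>h. of_real (Re h) * fx z + of_real (Im h) * fy z)) (at z)"
    using * assms(1,2) has_derivative_transform_within_open by blast
  then show ?thesis using * Suc by auto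
qed

lemma ck_on_partialsI:
  "(\<forall>z\<in>T. (f has_derivative (\<lambda>h. of_real (Re h) * fx z + of_real (Im h) * fy z)) (at z))
     \<Longrightarrow> ck_on k fx T \<Longrightarrow> ck_on k fy T \<Longrightarrow> ck_on (Suc k) f T"
  by auto

lemma ck_on_subset: "ck_on k f T \<Longrightarrow> T' \<subseteq> T \<Longrightarrow> ck_on k f T'"
proof (induction k arbitrary: f)
  case 0 then show ?case by (auto intro: continuous_on_subset)
next
  case (Suc k)
  then show ?case by simp blast
qed

lemma ck_on_Suc_D: "ck_on (Suc k) f T \<Longrightarrow> ck_on k f T"
proof (induction k arbitrary: f)
  case 0
  then show ?case
    by (auto intro!: continuous_at_imp_continuous_on intro: has_derivative_continuous)
next
  case (Suc k)
  from Suc.prems obtain fx fy where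
    "\<forall>z\<in>T. (f has_derivative (\<lambda>h. of_real (Re h) * fx z + of_real (Im h) * fy z)) (at z)"
    "ck_on (Suc k) fx T" "ck_on (Suc k) fy T" by (subst (asm) ck_on.simps(2)) blast
  then show ?case by (intro ck_on_partialsI[of T f fx fy] Suc.IH)
qed

lemma ck_on_continuous: "ck_on k f T \<Longrightarrow> continuous_on T f"
proof (induction k)
  case 0 then show ?case by simp
next
  case (Suc k)
  show ?case by (rule Suc.IH[OF ck_on_Suc_D[OF Suc.prems]])
qed

lemma ck_on_add: "ck_on k f T \<Longrightarrow> ck_on k g T \<Longrightarrow> ck_on k (\<lambda>z. f z + g z) T"
proof (induction k arbitrary: f g)
  case 0 then show ?case by (auto intro: continuous_on_add)
next
  case (Suc k)
  from Suc.prems obtain fx fy gx gy where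
    "\<forall>z\<in>T. (f has_derivative (\<lambda>h. of_real (Re h) * fx z + of_real (Im h) * fy z)) (at z)"
    "\<forall>z\<in>T. (g has_derivative (\<lambda>h. of_real (Re h) * gx z + of_real (Im h) * gy z)) (at z)"
    and *: "ck_on k fx T" "ck_on k fy T" "ck_on k gx T" "ck_on k gy T" by auto
  then have "\<forall>z\<in>T. ((\<lambda>z. f z + g z) has_derivative
      (\<lambda>h. of_real (Re h) * (fx z + gx z) + of_real (Im h) * (fy z + gy z))) (at z)"
    by (auto intro!: derivative_eq_intros simp: algebra_simps)
  then show ?case by (rule ck_on_partialsI) (auto intro!: Suc.IH *)
qed

lemma ck_on_const: "ck_on k (\<lambda>z. c) T"
  by (induction k arbitrary: c) (auto intro!: exI[of _ "\<lambda>z. 0"])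

lemma ck_on_mult: "ck_on k f T \<Longrightarrow> ck_on k g T \<Longrightarrow> ck_on k (\<lambda>z. f z * g z) T"
proof (induction k arbitrary: f g)
  case 0 then show ?case by (auto intro: continuous_on_mult)
next
  case (Suc k)
  from Suc.prems obtain fx fy gx gy where
    **: "\<forall>z\<in>T. (f has_derivative (\<lambda>h. of_real (Re h) * fx z + of_real (Im h) * fy z)) (at z)"
    "\<forall>z\<in>T. (g has_derivative (\<lambda>h. of_real (Re h) * gx z + of_real (Im h) * gy z)) (at z)"
    and *: "ck_on k fx T" "ck_on k fy T" "ck_on k gx T" "ck_on k gy T" by auto
  have fg: "ck_on k f T" "ck_on k g T" by (fact ck_on_Suc_D[OF Suc.prems(1)], fact ck_on_Suc_D[OF Suc.prems(2)])
  have "\<forall>z\<in>T. ((\<lambda>z. f z * g z) has_derivative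
      (\<lambda>h. of_real (Re h) * (f z * gx z + fx z * g z) + of_real (Im h) * (f z * gy z + fy z * g z))) (at z)"
    using ** by (auto intro!: derivative_eq_intros simp: algebra_simps)
  then show ?case by (rule ck_on_partialsI) (intro ck_on_add Suc.IH fg *)+
qed

lemma ck_on_cnj: "ck_on k f T \<Longrightarrow> ck_on k (\<lambda>z. cnj (f z)) T"
proof (induction k arbitrary: f)
  case 0 then show ?case by (auto intro: continuous_on_cnj)
next
  case (Suc k)
  from Suc.prems obtain fx fy where
    "\<forall>z\<in>T. (f has_derivative (\<lambda>h. of_real (Re h) * fx z + of_real (Im h) * fy z)) (at z)"
    and *: "ck_on k fx T" "ck_on k fy T" by auto
  then have "\<forall>z\<in>T. ((\<lambda>z. cnj (f z)) has_derivative
      (\<lambda>h. of_real (Re h) * (cnj (fx z)) + of_real (Im h) * (cnj (fy z)))) (at z)"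
  proof (intro ballI)
    fix z assume "z \<in> T"
    with \<open>\<forall>z\<in>T. _\<close> have "(f has_derivative (\<lambda>h. of_real (Re h) * fx z + of_real (Im h) * fy z)) (at z)" by blast
    from has_derivative_cnj[OF this]
    show "((\<lambda>z. cnj (f z)) has_derivative
      (\<lambda>h. of_real (Re h) * (cnj (fx z)) + of_real (Im h) * (cnj (fy z)))) (at z)" by simp
  qed
  then show ?case by (rule ck_on_partialsI) (auto intro!: Suc.IH *)
qed

lemma ck_on_SucI:
  assumes "\<And>z. z \<in> T \<Longrightarrow> has_wirtinger f (A z) (B z) (at z)" "ck_on k A T" "ck_on k B T"
  shows "ck_on (Suc k) f T"
proof -
  have "ck_on k (\<lambda>z. A z + B z) T" "ck_on k (\<lambda>z. \<i> * (A z + (-1) * B z)) T"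
    by (intro ck_on_add ck_on_mult ck_on_const assms(2,3))+
  then show ?thesis
    using has_wirtinger_imp_partials[OF assms(1)]
    by (intro ck_on_partialsI[of T f "\<lambda>z. A z + B z" "\<lambda>z. \<i> * (A z - B z)"]) auto
qed

lemma ck_on_SucE:
  assumes "ck_on (Suc k) f T"
  obtains A B where "\<forall>z\<in>T. has_wirtinger f (A z) (B z) (at z)" "ck_on k A T" "ck_on k B T"
proof -
  from assms obtain fx fy where
    *: "\<forall>z\<in>T. (f has_derivative (\<lambda>h. of_real (Re h) * fx z + of_real (Im h) * fy z)) (at z)"
    "ck_on k fx T" "ck_on k fy T" by auto
  have 1: "ck_on k (\<lambda>z. (1/2) * (fx z + (-\<i>) * fy z)) T" "ck_on k (\<lambda>z. (1/2) * (fx z + \<i> * fy z)) T"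
    by (intro ck_on_add ck_on_mult ck_on_const *)+
  have 2: "\<forall>z\<in>T. has_wirtinger f ((1/2) * (fx z + (-\<i>) * fy z)) ((1/2) * (fx z + \<i> * fy z)) (at z)"
    using * by (simp add: has_wirtinger_iff_partials)
  show ?thesis by (rule that[OF 2 1])
qed

lemma ck_on_holomorphic: "open T \<Longrightarrow> f holomorphic_on T \<Longrightarrow> ck_on k f T"
proof (induction k arbitrary: f)
  case 0 then show ?case by (auto intro: holomorphic_on_imp_continuous_on)
next
  case (Suc k)
  show ?case
    by (rule ck_on_SucI[where A = "deriv f" and B = "\<lambda>z. 0"])
      (use Suc in \<open>auto intro: has_wirtinger_field_derivative holomorphic_derivI ck_on_const holomorphic_deriv\<close>)
qed

text \<open>The derivatives of $f \circ h$ are $(f_z \circ h)\,h'$ and $(f_{\bar z} \circ h)\,\overline{h'}$,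
  and $h'$ is again holomorphic, so that the induction on $k$ closes up.\<close>

lemma ck_on_compose_inner:
  assumes "ck_on k f T'" "open T" "h holomorphic_on T" "h ` T \<subseteq> T'"
  shows "ck_on k (\<lambda>z. f (h z)) T"
  using assms(1)
proof (induction k arbitrary: f)
  case 0
  have "continuous_on T h" using assms(3) by (intro holomorphic_on_imp_continuous_on)
  moreover have "continuous_on T' f" using 0 by simp
  ultimately show ?case using assms(4) by (simp add: continuous_on_compose2[of T' f T h])
next
  case (Suc k)
  obtain A B where AB: "\<forall>z\<in>T'. has_wirtinger f (A z) (B z) (at z)" "ck_on k A T'" "ck_on k B T'"
    using ck_on_SucE[OF Suc.prems(1)] .
  have d: "ck_on k (deriv h) T" using assms by (intro ck_on_holomorphic holomorphic_deriv)
  show ?case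
  proof (rule ck_on_SucI[where A = "\<lambda>z. A (h z) * deriv h z" and B = "\<lambda>z. B (h z) * cnj (deriv h z)"])
    fix z assume z: "z \<in> T"
    then have "has_wirtinger f (A (h z)) (B (h z)) (at (h z))"
      using assms(4) by (intro bspec[OF AB(1)]) blast
    then show "has_wirtinger (\<lambda>z. f (h z)) (A (h z) * deriv h z) (B (h z) * cnj (deriv h z)) (at z)"
      by (rule has_wirtinger_compose_inner[where T = UNIV]) (use z assms(2,3) in \<open>auto intro: holomorphic_derivI\<close>)
  qed (intro ck_on_mult ck_on_cnj d Suc.IH AB(2) AB(3))+
qed

lemma ck_on_compose_outer:
  assumes "ck_on k f T" "open T'" "h holomorphic_on T'" "f ` T \<subseteq> T'"
  shows "ck_on k (\<lambda>z. h (f z)) T"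
  using assms(1,3)
proof (induction k arbitrary: h)
  case 0
  have "continuous_on T' h" using 0 by (intro holomorphic_on_imp_continuous_on)
  moreover have "continuous_on T f" using 0 by simp
  ultimately show ?case using assms(4) by (simp add: continuous_on_compose2[of T' h T f])
next
  case (Suc k)
  obtain A B where AB: "\<forall>z\<in>T. has_wirtinger f (A z) (B z) (at z)" "ck_on k A T" "ck_on k B T"
    using ck_on_SucE[OF Suc.prems(1)] .
  have d: "ck_on k (\<lambda>z. deriv h (f z)) T"
    by (rule Suc.IH[OF ck_on_Suc_D[OF Suc.prems(1)] holomorphic_deriv[OF Suc.prems(2) assms(2)]])
  show ?case
  proof (rule ck_on_SucI[where A = "\<lambda>z. deriv h (f z) * A z" and B = "\<lambda>z. deriv h (f z) * B z"])
    fix z assume z: "z \<in> T"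
    have "(h has_field_derivative deriv h (f z)) (at (f z))"
      using z assms(4) by (intro holomorphic_derivI[OF Suc.prems(2) assms(2)]) blast
    then show "has_wirtinger (\<lambda>z. h (f z)) (deriv h (f z) * A z) (deriv h (f z) * B z) (at z)"
      by (rule has_wirtinger_compose_outer[OF bspec[OF AB(1) z]])
  qed (intro ck_on_mult d AB(2) AB(3))+
qed

section \<open>Smooth cutoff functions\<close>

text \<open>The derivative of such a function is a linear combination of functions of the same kind. Hence
  they are all infinitely differentiable, in particular $e^{-1/x}$ extended by zero.\<close>

definition flat_fun :: "nat \<Rightarrow> real \<Rightarrow> real" where
  "flat_fun n x = (if x \<le> 0 then 0 else (1 / x) ^ n * exp (- (1 / x)))"

lemma flat_fun_tendsto_0: "(flat_fun n \<longlongrightarrow> 0) (at_right 0)"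
proof -
  have "((\<lambda>x::real. (1 / x) ^ n * exp (- (1 / x))) \<longlongrightarrow> 0) (at_right 0)"
    using filterlim_compose[OF tendsto_power_div_exp_0[of n] filterlim_inverse_at_top_right]
    by (simp add: exp_minus divide_simps)
  then show ?thesis
    by (rule Lim_transform_eventually) (auto simp: flat_fun_def eventually_at_right_less eventually_at_filter)
qed

lemma flat_fun_deriv:
  "(flat_fun n has_field_derivative (flat_fun (n + 2) x - of_nat n * flat_fun (n + 1) x)) (at x)"
proof -
  consider "x < 0" | "x = 0" | "x > 0" by linarith
  then show ?thesis
  proof cases
    case 1
    have "((\<lambda>x. 0) has_field_derivative 0) (at x)" by simp
    then have "(flat_fun n has_field_derivative 0) (at x)"
      by (rule has_field_derivative_transform_within_open[where S = "{..<0}"])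
        (use 1 in \<open>auto simp: flat_fun_def\<close>)
    then show ?thesis using 1 by (simp add: flat_fun_def)
  next
    case 2
    have "((\<lambda>y. (flat_fun n y - flat_fun n 0) / (y - 0)) \<longlongrightarrow> 0) (at_right 0)"
      by (rule Lim_transform_eventually[OF flat_fun_tendsto_0[of "Suc n"]])
        (auto simp: flat_fun_def eventually_at_filter)
    moreover have "((\<lambda>y. (flat_fun n y - flat_fun n 0) / (y - 0)) \<longlongrightarrow> 0) (at_left 0)"
      by (rule Lim_transform_eventually[OF tendsto_const])
        (auto simp: flat_fun_def eventually_at_filter)
    ultimately have "((\<lambda>y. (flat_fun n y - flat_fun n 0) / (y - 0)) \<longlongrightarrow> 0) (at 0)"
      by (simp add: filterlim_split_at)
    then show ?thesis using 2 by (simp add: has_field_derivative_iff flat_fun_def)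
  next
    case 3
    have "((\<lambda>x. 1 / x) has_field_derivative - ((1 / x) ^ 2)) (at x)"
      using 3 by (auto intro!: derivative_eq_intros simp: field_simps power2_eq_square)
    from DERIV_power[OF this, of n] DERIV_chain2[OF DERIV_exp DERIV_minus[OF this]]
    have "((\<lambda>x. (1 / x) ^ n * exp (- (1 / x))) has_field_derivative
       of_nat n * (- ((1 / x) ^ 2) * (1 / x) ^ (n - Suc 0)) * exp (- (1 / x))
         + exp (- (1 / x)) * (- (- ((1 / x) ^ 2))) * (1 / x) ^ n) (at x)"
      by (rule DERIV_mult)
    moreover have "of_nat n * (- ((1 / x) ^ 2) * (1 / x) ^ (n - Suc 0)) * exp (- (1 / x))
         + exp (- (1 / x)) * (- (- ((1 / x) ^ 2))) * (1 / x) ^ n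
       = flat_fun (n + 2) x - of_nat n * flat_fun (n + 1) x"
      using 3 by (cases n) (simp_all add: flat_fun_def power2_eq_square algebra_simps)
    ultimately have "((\<lambda>x. (1 / x) ^ n * exp (- (1 / x))) has_field_derivative
       (flat_fun (n + 2) x - of_nat n * flat_fun (n + 1) x)) (at x)"
      by (rule DERIV_cong)
    then show ?thesis
      by (rule has_field_derivative_transform_within_open[where S = "{0<..}"])
        (use 3 in \<open>auto simp: flat_fun_def\<close>)
  qed
qed

lemma ck_on_flat_fun:
  assumes "\<And>k. ck_on k (\<lambda>z. of_real (q z)) T"
  shows "ck_on k (\<lambda>z. of_real (flat_fun n (q z))) T"
proof (induction k arbitrary: n)
  case 0
  have "continuous_on UNIV (flat_fun n)"
    using flat_fun_deriv DERIV_isCont continuous_at_imp_continuous_on by blast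
  moreover have "continuous_on T (\<lambda>z. Re (of_real (q z)))"
    using assms[of 0] by (intro continuous_on_Re) auto
  ultimately have "continuous_on T (\<lambda>z. flat_fun n (q z))"
    using continuous_on_compose2[of UNIV "flat_fun n" T q] by auto
  then show ?case by (simp only: ck_on.simps(1)) (rule continuous_on_of_real)
next
  case (Suc k)
  from assms[of "Suc k"] obtain qx qy where
    q: "\<forall>z\<in>T. ((\<lambda>z. of_real (q z)) has_derivative (\<lambda>h. of_real (Re h) * qx z + of_real (Im h) * qy z)) (at z)"
    "ck_on k qx T" "ck_on k qy T" by auto
  let ?d = "\<lambda>z. of_real (flat_fun (n + 2) (q z)) + (- of_nat n) * (of_real (flat_fun (n + 1) (q z)) :: complex)"
  have d: "ck_on k ?d T"
    by (rule ck_on_add[OF Suc.IH ck_on_mult[OF ck_on_const Suc.IH]])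
  have "((\<lambda>z. of_real (flat_fun n (q z))) has_derivative
     (\<lambda>h. of_real (Re h) * (?d z * qx z) + of_real (Im h) * (?d z * qy z))) (at z)" if "z \<in> T" for z
  proof -
    let ?D = "\<lambda>h. Re (of_real (Re h) * qx z + of_real (Im h) * qy z)"
    have 0: "((\<lambda>z. of_real (q z) :: complex) has_derivative (\<lambda>h. of_real (Re h) * qx z + of_real (Im h) * qy z)) (at z)"
      using q that by auto
    have 1: "(q has_derivative ?D) (at z)"
      using has_derivative_Re[OF 0] by simp
    have 2: "((\<lambda>z. of_real (q z) :: complex) has_derivative (\<lambda>h. of_real (?D h))) (at z)"
      by (rule has_derivative_of_real[OF 1])
    have 3: "(\<lambda>h. of_real (?D h)) = (\<lambda>h. of_real (Re h) * qx z + of_real (Im h) * qy z)"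
      using has_derivative_unique[OF 2 0] .
    have "((\<lambda>z. flat_fun n (q z)) has_derivative
        (\<lambda>h. (flat_fun (n + 2) (q z) - of_nat n * flat_fun (n + 1) (q z)) * ?D h)) (at z)"
      using has_derivative_compose[OF 1 flat_fun_deriv[unfolded has_field_derivative_def]] .
    then have "((\<lambda>z. of_real (flat_fun n (q z)) :: complex) has_derivative
        (\<lambda>h. of_real ((flat_fun (n + 2) (q z) - of_nat n * flat_fun (n + 1) (q z)) * ?D h))) (at z)"
      by (rule has_derivative_of_real)
    moreover have "of_real ((flat_fun (n + 2) (q z) - of_nat n * flat_fun (n + 1) (q z)) * ?D h) =
        of_real (Re h) * (?d z * qx z) + of_real (Im h) * (?d z * qy z)" for h
    proof -
      have "complex_of_real (flat_fun (n + 2) (q z) - of_nat n * flat_fun (n + 1) (q z)) = ?d z"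
        by simp
      then show ?thesis
        unfolding of_real_mult fun_cong[OF 3, of h] by (simp only: distrib_left mult.left_commute mult.assoc)
    qed
    ultimately show ?thesis by simp
  qed
  then have "\<forall>z\<in>T. ((\<lambda>z. of_real (flat_fun n (q z))) has_derivative
     (\<lambda>h. of_real (Re h) * (?d z * qx z) + of_real (Im h) * (?d z * qy z))) (at z)" by (rule ballI)
  moreover have "ck_on k (\<lambda>z. ?d z * qx z) T" "ck_on k (\<lambda>z. ?d z * qy z) T"
    by (rule ck_on_mult[OF d q(2)], rule ck_on_mult[OF d q(3)])
  ultimately show ?case by (rule ck_on_partialsI[where fx = "\<lambda>z. ?d z * qx z" and fy = "\<lambda>z. ?d z * qy z"])
qed

section \<open>Smooth functions on open subsets of the plane and the half plane\<close>

definition model_set :: "complex set \<Rightarrow> bool" where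
  "model_set S \<longleftrightarrow> open S \<or> openin (top_of_set half_plane) S"

lemma model_set_Int: "model_set S \<Longrightarrow> open T \<Longrightarrow> model_set (S \<inter> T)"
  by (auto simp: model_set_def openin_Int_open)

text \<open>A derivative within the set is determined by its values in the directions $1$ and $i$, also at
  boundary points.\<close>

lemma model_set_corner:
  assumes "model_set S" "z \<in> S"
  shows "\<exists>e>0. \<forall>d. 0 < d \<and> d < e \<longrightarrow> z + of_real d \<in> S \<and> z + of_real d * \<i> \<in> S"
proof -
  obtain e where e: "e > 0" "ball z e \<inter> half_plane \<subseteq> S \<and> z \<in> half_plane \<or> ball z e \<subseteq> S"
  proof (cases "open S")
    case True
    then show ?thesis using assms that by (auto simp: open_contains_ball)
  next
    case False
    then have "openin (top_of_set half_plane) S" using assms by (simp add: model_set_def)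
    then have "S \<subseteq> half_plane \<and> (\<exists>e>0. ball z e \<inter> half_plane \<subseteq> S)"
      using assms by (auto simp: openin_contains_ball)
    then show ?thesis using assms that by blast
  qed
  show ?thesis
  proof (intro exI[of _ e] conjI allI impI)
    fix d :: real assume d: "0 < d \<and> d < e"
    then have b: "z + of_real d \<in> ball z e" "z + of_real d * \<i> \<in> ball z e"
      by (auto simp: dist_norm norm_mult)
    show "z + of_real d \<in> S" using b d e(2) by (auto simp: half_plane_def)
    show "z + of_real d * \<i> \<in> S" using b d e(2) by (auto simp: half_plane_def)
  qed (use e in auto)
qed

lemma derivative_unique_model_set:
  fixes f :: "complex \<Rightarrow> complex"
  assumes "model_set S" "z \<in> S"
    and "(f has_derivative f') (at z within S)" "(f has_derivative f'') (at z within S)"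
  shows "f' = f''"
proof (rule frechet_derivative_unique_within[OF assms(3,4)])
  fix i :: complex and e :: real assume i: "i \<in> Basis" "0 < e"
  obtain e' where e': "e' > 0" "\<And>d. 0 < d \<and> d < e' \<Longrightarrow> z + of_real d \<in> S \<and> z + of_real d * \<i> \<in> S"
    using model_set_corner[OF assms(1,2)] by blast
  let ?d = "min e e' / 2"
  have "0 < \<bar>?d\<bar>" "\<bar>?d\<bar> < e" using i e' by auto
  moreover have "z + ?d *\<^sub>R i \<in> S"
    using e'(2)[of ?d] i e'(1) by (auto simp: Basis_complex_def scaleR_conv_of_real)
  ultimately show "\<exists>d. 0 < \<bar>d\<bar> \<and> \<bar>d\<bar> < e \<and> z + d *\<^sub>R i \<in> S" by blast
qed

lemma has_wirtinger_unique:
  assumes "model_set S" "z \<in> S" "has_wirtinger f A B (at z within S)" "has_wirtinger f A' B' (at z within S)"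
  shows "A = A'" "B = B'"
proof -
  have *: "(\<lambda>h. A * h + B * cnj h) = (\<lambda>h. A' * h + B' * cnj h)"
    using derivative_unique_model_set assms by (simp add: has_wirtinger_def)
  have 1: "A + B = A' + B'" using fun_cong[OF *, of 1] by simp
  have "\<i> * (A - B) = \<i> * (A' - B')" using fun_cong[OF *, of \<i>] by (simp add: algebra_simps)
  then have 2: "A - B = A' - B'" by simp
  have "2 * A = 2 * A'" using 1 2 by (metis add_diff_cancel_left add_diff_eq diff_add_cancel mult_2)
  then show "A = A'" by simp
  with 1 show "B = B'" by simp
qed

lemma has_wirtinger_imp_eq:
  assumes "model_set S" "z \<in> S" "has_wirtinger f A B (at z within S)"
  shows "wirtinger_z S f z = A" "wirtinger_zbar S f z = B"
proof -
  have "(f has_derivative frechet_derivative f (at z within S)) (at z within S)"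
    using assms(3) unfolding has_wirtinger_def frechet_derivative_works[symmetric] by (rule differentiableI)
  then have *: "frechet_derivative f (at z within S) = (\<lambda>h. A * h + B * cnj h)"
    using derivative_unique_model_set assms by (simp add: has_wirtinger_def)
  show "wirtinger_z S f z = A" "wirtinger_zbar S f z = B"
    by (simp_all add: wirtinger_z_def wirtinger_zbar_def * Let_def algebra_simps)
qed

lemma has_wirtinger_subset:
  "has_wirtinger f A B (at z within S) \<Longrightarrow> T \<subseteq> S \<Longrightarrow> has_wirtinger f A B (at z within T)"
  unfolding has_wirtinger_def by (rule has_derivative_subset)

text \<open>The definition of $C^k$ provides derivatives for each $k$ separately; they agree because
  derivatives are unique.\<close>

lemma ck_on_wirtinger:
  assumes "open T" "\<forall>k. ck_on k g T"
  obtains A B where "\<forall>z\<in>T. has_wirtinger g (A z) (B z) (at z)"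
    "\<forall>k. ck_on k A T" "\<forall>k. ck_on k B T"
proof -
  have m: "model_set UNIV" by (simp add: model_set_def)
  let ?A = "wirtinger_z UNIV g" and ?B = "wirtinger_zbar UNIV g"
  have "(\<forall>z\<in>T. has_wirtinger g (?A z) (?B z) (at z)) \<and> ck_on k ?A T \<and> ck_on k ?B T" for k
  proof -
    have "ck_on (Suc k) g T" using assms(2) by blast
    from ck_on_SucE[OF this]
    obtain A B where AB: "\<forall>z\<in>T. has_wirtinger g (A z) (B z) (at z)" "ck_on k A T" "ck_on k B T" .
    have e: "?A z = A z" "?B z = B z" if "z \<in> T" for z
      using has_wirtinger_imp_eq[OF m _ bspec[OF AB(1) that]] by simp_all
    have "ck_on k ?A T" by (rule ck_on_cong[OF assms(1) _ AB(2)]) (simp add: e)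
    moreover have "ck_on k ?B T" by (rule ck_on_cong[OF assms(1) _ AB(3)]) (simp add: e)
    ultimately show ?thesis using AB(1) e by simp
  qed
  then have "\<forall>z\<in>T. has_wirtinger g (?A z) (?B z) (at z)" "\<forall>k. ck_on k ?A T" "\<forall>k. ck_on k ?B T"
    by simp_all
  then show ?thesis by (rule that)
qed

lemma smooth_onE:
  assumes "smooth_on f S" "z \<in> S"
  obtains T g where "open T" "z \<in> T" "\<forall>k. ck_on k g T" "\<forall>w\<in>T \<inter> S. f w = g w"
proof -
  from assms have "\<exists>T g. open T \<and> z \<in> T \<and> (\<forall>k. ck_on k g T) \<and> (\<forall>w\<in>T \<inter> S. f w = g w)"
    unfolding smooth_on_def by (rule bspec)
  then show ?thesis using that by (elim exE conjE)
qed

lemma smooth_onI: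
  assumes "\<And>z. z \<in> S \<Longrightarrow> \<exists>T g. open T \<and> z \<in> T \<and> (\<forall>k. ck_on k g T) \<and> (\<forall>w\<in>T \<inter> S. f w = g w)"
  shows "smooth_on f S"
  unfolding smooth_on_def by (rule ballI) (rule assms)

lemma smooth_on_subset:
  assumes "smooth_on f S" "S' \<subseteq> S" shows "smooth_on f S'"
proof (rule smooth_onI)
  fix z assume "z \<in> S'"
  then have "z \<in> S" using assms(2) by blast
  from smooth_onE[OF assms(1) this]
  obtain T g where "open T" "z \<in> T" "\<forall>k. ck_on k g T" "\<forall>w\<in>T \<inter> S. f w = g w" .
  with assms(2) show "\<exists>T g. open T \<and> z \<in> T \<and> (\<forall>k. ck_on k g T) \<and> (\<forall>w\<in>T \<inter> S'. f w = g w)"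
    by (intro exI[of _ T] exI[of _ g]) auto
qed

lemma smooth_on_cong:
  assumes "smooth_on f S" "\<And>z. z \<in> S \<Longrightarrow> f z = g z" shows "smooth_on g S"
  by (rule smooth_onI) (use assms in \<open>simp add: smooth_on_def\<close>)

lemma smooth_on_local:
  assumes "\<And>z. z \<in> S \<Longrightarrow> \<exists>T. open T \<and> z \<in> T \<and> smooth_on f (S \<inter> T)"
  shows "smooth_on f S"
proof (rule smooth_onI)
  fix z assume z: "z \<in> S"
  obtain T where T: "open T" "z \<in> T" "smooth_on f (S \<inter> T)" using assms[OF z] by (elim exE conjE)
  then have "z \<in> S \<inter> T" using z by blast
  from smooth_onE[OF T(3) this]
  obtain T' g where "open T'" "z \<in> T'" "\<forall>k. ck_on k g T'" "\<forall>w\<in>T' \<inter> (S \<inter> T). f w = g w" .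
  then show "\<exists>T g. open T \<and> z \<in> T \<and> (\<forall>k. ck_on k g T) \<and> (\<forall>w\<in>T \<inter> S. f w = g w)"
    using T by (intro exI[of _ "T \<inter> T'"] exI[of _ g]) (auto intro: ck_on_subset)
qed

lemma smooth_on_ck: "(\<And>k. ck_on k f T) \<Longrightarrow> open T \<Longrightarrow> smooth_on f T"
  by (rule smooth_onI) (auto intro!: exI[of _ T] exI[of _ f])

lemma smooth_on_const: "smooth_on (\<lambda>z. c) S"
  by (rule smooth_onI) (auto intro!: exI[of _ UNIV] exI[of _ "\<lambda>z. c"] ck_on_const)

lemma smooth_on_binary:
  assumes "smooth_on f S" "smooth_on g S"
    and op: "\<And>k T u v. ck_on k u T \<Longrightarrow> ck_on k v T \<Longrightarrow> ck_on k (\<lambda>z. op (u z) (v z)) T"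
  shows "smooth_on (\<lambda>z. op (f z) (g z)) S"
proof (rule smooth_onI)
  fix z assume z: "z \<in> S"
  obtain T u where T: "open T" "z \<in> T" "\<forall>k. ck_on k u T" "\<forall>w\<in>T \<inter> S. f w = u w"
    using smooth_onE[OF assms(1) z] .
  obtain T' v where T': "open T'" "z \<in> T'" "\<forall>k. ck_on k v T'" "\<forall>w\<in>T' \<inter> S. g w = v w"
    using smooth_onE[OF assms(2) z] .
  have "\<forall>k. ck_on k (\<lambda>z. op (u z) (v z)) (T \<inter> T')"
    using T(3) T'(3) by (intro allI op) (auto intro: ck_on_subset)
  then show "\<exists>T h. open T \<and> z \<in> T \<and> (\<forall>k. ck_on k h T) \<and> (\<forall>w\<in>T \<inter> S. op (f w) (g w) = h w)"
    using T T' by (intro exI[of _ "T \<inter> T'"] exI[of _ "\<lambda>z. op (u z) (v z)"]) auto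
qed

lemma smooth_on_add: "smooth_on f S \<Longrightarrow> smooth_on g S \<Longrightarrow> smooth_on (\<lambda>z. f z + g z) S"
  by (rule smooth_on_binary[where op = "(+)"]) (auto intro: ck_on_add)

lemma smooth_on_mult: "smooth_on f S \<Longrightarrow> smooth_on g S \<Longrightarrow> smooth_on (\<lambda>z. f z * g z) S"
  by (rule smooth_on_binary[where op = "(*)"]) (auto intro: ck_on_mult)

lemma smooth_on_minus: "smooth_on f S \<Longrightarrow> smooth_on (\<lambda>z. - f z) S"
  using smooth_on_mult[OF smooth_on_const[of "-1"], of f S] by simp

lemma smooth_on_diff: "smooth_on f S \<Longrightarrow> smooth_on g S \<Longrightarrow> smooth_on (\<lambda>z. f z - g z) S"
  using smooth_on_add[of f S "\<lambda>z. - g z"] smooth_on_minus[of g S] by simp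

lemma smooth_on_sum: "(\<And>i. i \<in> I \<Longrightarrow> smooth_on (f i) S) \<Longrightarrow> smooth_on (\<lambda>z. \<Sum>i\<in>I. f i z) S"
  by (induction I rule: infinite_finite_induct) (auto intro: smooth_on_add smooth_on_const)

lemma smooth_on_cnj: "smooth_on f S \<Longrightarrow> smooth_on (\<lambda>z. cnj (f z)) S"
  by (rule smooth_on_binary[of f S f "\<lambda>u v. cnj u"]) (auto intro: ck_on_cnj)

lemma smooth_on_power: "smooth_on f S \<Longrightarrow> smooth_on (\<lambda>z. f z ^ n) S"
  by (induction n) (auto intro: smooth_on_const smooth_on_mult)

lemma smooth_on_holomorphic: "open T \<Longrightarrow> f holomorphic_on T \<Longrightarrow> smooth_on f T"
  by (intro smooth_on_ck ck_on_holomorphic)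

lemma smooth_on_continuous: "smooth_on f S \<Longrightarrow> continuous_on S f"
proof (subst continuous_on_eq_continuous_within, rule ballI)
  fix z assume f: "smooth_on f S" and z: "z \<in> S"
  then obtain T g where T: "open T" "z \<in> T" "\<forall>k. ck_on k g T" "\<forall>w\<in>T \<inter> S. f w = g w"
    using smooth_onE by blast
  have "continuous_on T g" using T(3) ck_on_continuous by blast
  then have "continuous_on (S \<inter> T) f"
    using continuous_on_cong[of "S \<inter> T" "S \<inter> T" f g] T(4) continuous_on_subset[of T g "S \<inter> T"] by simp
  then have "continuous (at z within S \<inter> T) f" using z T by (simp add: continuous_on_eq_continuous_within)
  moreover have "at z within S \<inter> T = at z within S"
    by (rule at_within_nhd[where S = T]) (use T z in auto)
  ultimately show "continuous (at z within S) f" by simp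
qed

lemma smooth_on_compose_inner:
  assumes "smooth_on f S'" "open W" "h holomorphic_on W" "S \<subseteq> W" "h ` S \<subseteq> S'"
  shows "smooth_on (\<lambda>z. f (h z)) S"
proof (rule smooth_onI)
  fix z assume z: "z \<in> S"
  then have "h z \<in> S'" using assms(5) by blast
  from smooth_onE[OF assms(1) this]
  obtain T g where T: "open T" "h z \<in> T" "\<forall>k. ck_on k g T" "\<forall>w\<in>T \<inter> S'. f w = g w" .
  have "open (W \<inter> h -` T)"
    using assms(2,3) T(1) by (simp add: continuous_open_preimage holomorphic_on_imp_continuous_on)
  moreover have "ck_on k (\<lambda>z. g (h z)) (W \<inter> h -` T)" for k
    by (rule ck_on_compose_inner[of k g T]) (use T assms calculation in \<open>auto intro: holomorphic_on_subset\<close>)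
  ultimately show "\<exists>T g. open T \<and> z \<in> T \<and> (\<forall>k. ck_on k g T) \<and> (\<forall>w\<in>T \<inter> S. f (h w) = g w)"
    using T assms z by (intro exI[of _ "W \<inter> h -` T"] exI[of _ "\<lambda>z. g (h z)"]) auto
qed

lemma smooth_on_compose_outer:
  assumes "smooth_on f S" "open W" "h holomorphic_on W" "f ` S \<subseteq> W"
  shows "smooth_on (\<lambda>z. h (f z)) S"
proof (rule smooth_onI)
  fix z assume z: "z \<in> S"
  from smooth_onE[OF assms(1) z]
  obtain T g where T: "open T" "z \<in> T" "\<forall>k. ck_on k g T" "\<forall>w\<in>T \<inter> S. f w = g w" .
  have "continuous_on T g" using T(3) ck_on_continuous by blast
  then have o: "open (T \<inter> g -` W)"
    using assms(2) T(1) by (simp add: continuous_open_preimage)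
  moreover have "ck_on k (\<lambda>z. h (g z)) (T \<inter> g -` W)" for k
    by (rule ck_on_compose_outer[of k g _ W]) (use T assms in \<open>auto intro: ck_on_subset\<close>)
  moreover have "g z \<in> W" using T z assms(4) by force
  ultimately show "\<exists>T g. open T \<and> z \<in> T \<and> (\<forall>k. ck_on k g T) \<and> (\<forall>w\<in>T \<inter> S. h (f w) = g w)"
    using T assms z by (intro exI[of _ "T \<inter> g -` W"] exI[of _ "\<lambda>z. h (g z)"]) auto
qed

lemma smooth_on_inverse:
  assumes "smooth_on f S" "\<And>z. z \<in> S \<Longrightarrow> f z \<noteq> 0"
  shows "smooth_on (\<lambda>z. inverse (f z)) S"
  by (rule smooth_on_compose_outer[OF assms(1), of "- {0}"])
    (use assms(2) in \<open>auto intro!: holomorphic_intros\<close>)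

lemma smooth_on_divide:
  assumes "smooth_on f S" "smooth_on g S" "\<And>z. z \<in> S \<Longrightarrow> g z \<noteq> 0"
  shows "smooth_on (\<lambda>z. f z / g z) S"
  using smooth_on_mult[OF assms(1) smooth_on_inverse[OF assms(2,3)]] by (simp add: field_simps)

text \<open>The set \<open>W\<close> serves to remove poles: the derivatives are taken within \<open>S\<close>, whereas \<open>f\<close> is smooth
  only on the part of \<open>S\<close> in \<open>W\<close>.\<close>

lemma
  assumes "smooth_on f (S \<inter> W)" "open W" "model_set S"
  shows has_wirtinger_smooth_on: "\<And>z. z \<in> S \<inter> W \<Longrightarrow> has_wirtinger f (wirtinger_z S f z) (wirtinger_zbar S f z) (at z within S)"
    and smooth_on_wirtinger_z: "smooth_on (wirtinger_z S f) (S \<inter> W)"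
    and smooth_on_wirtinger_zbar: "smooth_on (wirtinger_zbar S f) (S \<inter> W)"
proof -
  have *: "\<exists>T A B. open T \<and> z \<in> T \<and> (\<forall>k. ck_on k A T) \<and> (\<forall>k. ck_on k B T) \<and>
    (\<forall>w\<in>T \<inter> (S \<inter> W). has_wirtinger f (A w) (B w) (at w within S))" if z: "z \<in> S \<inter> W" for z
  proof -
    obtain T g where T: "open T" "z \<in> T" "\<forall>k. ck_on k g T" "\<forall>w\<in>T \<inter> (S \<inter> W). f w = g w"
      using smooth_onE[OF assms(1) z] .
    obtain A B where AB: "\<forall>z\<in>T. has_wirtinger g (A z) (B z) (at z)"
      "\<forall>k. ck_on k A T" "\<forall>k. ck_on k B T" using ck_on_wirtinger[OF T(1,3)] .
    have "has_wirtinger f (A w) (B w) (at w within S)" if w: "w \<in> T \<inter> (S \<inter> W)" for w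
    proof -
      have "has_wirtinger g (A w) (B w) (at w within S)"
        using AB(1) w by (auto intro: has_wirtinger_subset)
      then show ?thesis
        by (rule has_wirtinger_transform[where T = "T \<inter> W"]) (use w T assms(2) in auto)
    qed
    then show ?thesis using T AB by (intro exI[of _ T] exI[of _ A] exI[of _ B]) simp
  qed
  have **: "\<exists>T A B. open T \<and> z \<in> T \<and> (\<forall>k. ck_on k A T) \<and> (\<forall>k. ck_on k B T) \<and>
    (\<forall>w\<in>T \<inter> (S \<inter> W). has_wirtinger f (A w) (B w) (at w within S)
       \<and> wirtinger_z S f w = A w \<and> wirtinger_zbar S f w = B w)" if z: "z \<in> S \<inter> W" for z
  proof -
    obtain T A B where T: "open T" "z \<in> T" "\<forall>k. ck_on k A T" "\<forall>k. ck_on k B T"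
      "\<forall>w\<in>T \<inter> (S \<inter> W). has_wirtinger f (A w) (B w) (at w within S)" using *[OF z] by (elim exE conjE)
    have "wirtinger_z S f w = A w \<and> wirtinger_zbar S f w = B w" if "w\<in>T \<inter> (S \<inter> W)" for w
      using has_wirtinger_imp_eq[OF assms(3) _ bspec[OF T(5) that]] that by simp
    with T show ?thesis by (intro exI[of _ T] exI[of _ A] exI[of _ B]) simp
  qed
  show "has_wirtinger f (wirtinger_z S f z) (wirtinger_zbar S f z) (at z within S)" if z: "z \<in> S \<inter> W" for z
  proof -
    obtain T A B where "z \<in> T" "\<forall>w\<in>T \<inter> (S \<inter> W). has_wirtinger f (A w) (B w) (at w within S)
       \<and> wirtinger_z S f w = A w \<and> wirtinger_zbar S f w = B w" using **[OF z] by (elim exE conjE)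
    then show ?thesis using z by simp
  qed
  show "smooth_on (wirtinger_z S f) (S \<inter> W)"
  proof (rule smooth_onI)
    fix z assume "z \<in> S \<inter> W"
    from **[OF this] obtain T A B where "open T" "z \<in> T" "\<forall>k. ck_on k A T" "\<forall>w\<in>T \<inter> (S \<inter> W). has_wirtinger f (A w) (B w) (at w within S)
       \<and> wirtinger_z S f w = A w \<and> wirtinger_zbar S f w = B w" by (elim exE conjE)
    then show "\<exists>T g. open T \<and> z \<in> T \<and> (\<forall>k. ck_on k g T) \<and> (\<forall>w\<in>T \<inter> (S \<inter> W). wirtinger_z S f w = g w)"
      by (intro exI[of _ T] exI[of _ A]) simp
  qed
  show "smooth_on (wirtinger_zbar S f) (S \<inter> W)"
  proof (rule smooth_onI)
    fix z assume "z \<in> S \<inter> W"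
    from **[OF this] obtain T A B where "open T" "z \<in> T" "\<forall>k. ck_on k B T" "\<forall>w\<in>T \<inter> (S \<inter> W). has_wirtinger f (A w) (B w) (at w within S)
       \<and> wirtinger_z S f w = A w \<and> wirtinger_zbar S f w = B w" by (elim exE conjE)
    then show "\<exists>T g. open T \<and> z \<in> T \<and> (\<forall>k. ck_on k g T) \<and> (\<forall>w\<in>T \<inter> (S \<inter> W). wirtinger_zbar S f w = g w)"
      by (intro exI[of _ T] exI[of _ B]) simp
  qed
qed

text \<open>Equal to $1$ for $|z| \le r/2$ and to $0$ for $|z| \ge r$. Written in terms of $|z|^2$ since
  $|z|$ is not differentiable at zero.\<close>

definition cutoff :: "real \<Rightarrow> complex \<Rightarrow> real" where
  "cutoff r z = flat_fun 0 (r\<^sup>2 - (cmod z)\<^sup>2)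
     / (flat_fun 0 (r\<^sup>2 - (cmod z)\<^sup>2) + flat_fun 0 ((cmod z)\<^sup>2 - (r / 2)\<^sup>2))"

lemma flat_fun_0_pos: "x > 0 \<Longrightarrow> flat_fun 0 x > 0"
  and flat_fun_0_zero: "x \<le> 0 \<Longrightarrow> flat_fun 0 x = 0"
  and flat_fun_0_nonneg: "flat_fun 0 x \<ge> 0"
  by (auto simp: flat_fun_def)

lemma cutoff_denominator_pos:
  assumes "r > 0"
  shows "flat_fun 0 (r\<^sup>2 - (cmod z)\<^sup>2) + flat_fun 0 ((cmod z)\<^sup>2 - (r / 2)\<^sup>2) > 0"
proof (cases "cmod z < r")
  case True
  then have "r\<^sup>2 - (cmod z)\<^sup>2 > 0" using power_strict_mono[of "cmod z" r 2] by simp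
  then show ?thesis using flat_fun_0_pos flat_fun_0_nonneg by (meson add_pos_nonneg)
next
  case False
  then have "(r / 2)\<^sup>2 < (cmod z)\<^sup>2" using assms by (intro power_strict_mono) auto
  then show ?thesis using flat_fun_0_pos flat_fun_0_nonneg by (meson add_nonneg_pos diff_gt_0_iff_gt)
qed

lemma cutoff_nonneg: "0 \<le> cutoff r z"
  by (simp add: cutoff_def flat_fun_0_nonneg)

lemma cutoff_eq_1: "r > 0 \<Longrightarrow> cmod z \<le> r / 2 \<Longrightarrow> cutoff r z = 1"
proof -
  assume r: "r > 0" "cmod z \<le> r / 2"
  then have "(cmod z)\<^sup>2 \<le> (r / 2)\<^sup>2" by (intro power_mono) auto
  then show "cutoff r z = 1" using cutoff_denominator_pos[OF r(1), of z]
    by (simp add: cutoff_def flat_fun_0_zero)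
qed

lemma cutoff_eq_0: "r > 0 \<Longrightarrow> r \<le> cmod z \<Longrightarrow> cutoff r z = 0"
  using power_mono[of r "cmod z" 2] by (simp add: cutoff_def flat_fun_0_zero)

lemma cutoff_pos: "cmod z < r \<Longrightarrow> 0 < cutoff r z"
proof -
  assume r: "cmod z < r"
  then have "r\<^sup>2 - (cmod z)\<^sup>2 > 0" using power_strict_mono[of "cmod z" r 2] by simp
  then show "0 < cutoff r z" unfolding cutoff_def
    using flat_fun_0_pos flat_fun_0_nonneg by (intro divide_pos_pos add_pos_nonneg) auto
qed

lemma smooth_on_cutoff:
  assumes "r > 0"
  shows "smooth_on (\<lambda>z. of_real (cutoff r z)) S"
proof -
  have n: "(of_real ((cmod z)\<^sup>2) :: complex) = z * cnj z" for z
    by (metis complex_norm_square of_real_power)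
  have i: "ck_on k (\<lambda>z. z) UNIV" for k by (rule ck_on_holomorphic) auto
  have q: "ck_on k (\<lambda>z. z * cnj z) UNIV" for k by (intro ck_on_mult ck_on_cnj i)
  have "ck_on k (\<lambda>z. of_real (r\<^sup>2) + (-1) * (z * cnj z)) UNIV"
    "ck_on k (\<lambda>z. z * cnj z + of_real (- (r / 2)\<^sup>2)) UNIV" for k
    by (rule ck_on_add[OF ck_on_const ck_on_mult[OF ck_on_const q]], rule ck_on_add[OF q ck_on_const])
  then have "ck_on k (\<lambda>z. of_real (r\<^sup>2 - (cmod z)\<^sup>2)) UNIV" "ck_on k (\<lambda>z. of_real ((cmod z)\<^sup>2 - (r / 2)\<^sup>2)) UNIV" for k
    unfolding n[symmetric] by simp_all
  from this[THEN ck_on_flat_fun]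
  have "smooth_on (\<lambda>z. of_real (flat_fun 0 (r\<^sup>2 - (cmod z)\<^sup>2))) UNIV"
    "smooth_on (\<lambda>z. of_real (flat_fun 0 ((cmod z)\<^sup>2 - (r / 2)\<^sup>2))) UNIV"
    by (auto intro: smooth_on_ck)
  then have "smooth_on (\<lambda>z. of_real (flat_fun 0 (r\<^sup>2 - (cmod z)\<^sup>2)) /
       (of_real (flat_fun 0 (r\<^sup>2 - (cmod z)\<^sup>2)) + of_real (flat_fun 0 ((cmod z)\<^sup>2 - (r / 2)\<^sup>2)))) UNIV"
    using cutoff_denominator_pos[OF assms]
    by (intro smooth_on_divide smooth_on_add) (auto simp flip: of_real_add simp: less_imp_neq[symmetric])
  then show ?thesis by (rule smooth_on_subset[rotated, OF subset_UNIV, THEN smooth_on_cong]) (simp add: cutoff_def)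
qed

section \<open>Integration in the complex plane\<close>

text \<open>The change of variables formula lives on \<open>real ^ 2\<close> and Fubini's theorem on \<open>real \<times> real\<close>. Both
  carry over to the complex plane because the following isomorphisms preserve Lebesgue measure.\<close>

definition complex_of_pair :: "real \<times> real \<Rightarrow> complex" where
  "complex_of_pair p = Complex (fst p) (snd p)"

definition complex_of_vec :: "real ^ 2 \<Rightarrow> complex" where
  "complex_of_vec v = Complex (v $ 1) (v $ 2)"

definition vec_of_complex :: "complex \<Rightarrow> real ^ 2" where
  "vec_of_complex z = vector [Re z, Im z]"

lemma complex_of_vec_inverse [simp]:
  "complex_of_vec (vec_of_complex z) = z" "vec_of_complex (complex_of_vec v) = v"
  by (simp_all add: complex_of_vec_def vec_of_complex_def vec_eq_iff forall_2)

lemma linear_complex_of_pair: "linear complex_of_pair"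
  by (rule linearI) (simp_all add: complex_of_pair_def complex_eq_iff)

lemma linear_complex_of_vec: "linear complex_of_vec"
  by (rule linearI) (simp_all add: complex_of_vec_def complex_eq_iff)

lemma linear_vec_of_complex: "linear vec_of_complex"
  by (rule linearI) (simp_all add: vec_of_complex_def vec_eq_iff forall_2)

lemmas bounded_linear_complex_of_pair = linear_complex_of_pair[THEN linear_conv_bounded_linear[THEN iffD1]]
lemmas bounded_linear_complex_of_vec = linear_complex_of_vec[THEN linear_conv_bounded_linear[THEN iffD1]]
lemmas bounded_linear_vec_of_complex = linear_vec_of_complex[THEN linear_conv_bounded_linear[THEN iffD1]]

lemma continuous_on_complex_of_pair: "continuous_on S complex_of_pair"
  by (rule linear_continuous_on[OF bounded_linear_complex_of_pair])
lemma continuous_on_complex_of_vec: "continuous_on S complex_of_vec"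
  by (rule linear_continuous_on[OF bounded_linear_complex_of_vec])
lemma continuous_on_vec_of_complex: "continuous_on S vec_of_complex"
  by (rule linear_continuous_on[OF bounded_linear_vec_of_complex])

lemma measurable_complex_of_pair [measurable]: "complex_of_pair \<in> borel_measurable borel"
  by (rule borel_measurable_continuous_onI[OF continuous_on_complex_of_pair])
lemma measurable_complex_of_vec [measurable]: "complex_of_vec \<in> borel_measurable borel"
  by (rule borel_measurable_continuous_onI[OF continuous_on_complex_of_vec])
lemma measurable_vec_of_complex [measurable]: "vec_of_complex \<in> borel_measurable borel"
  by (rule borel_measurable_continuous_onI[OF continuous_on_vec_of_complex])

lemma prod_Basis_complex: "(\<Prod>b\<in>Basis. f b) = f 1 * f \<i>"
  by (simp add: Basis_complex_def)

lemma in_box_complex: "z \<in> box l u \<longleftrightarrow> Re l < Re z \<and> Re z < Re u \<and> Im l < Im z \<and> Im z < Im u"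
  by (auto simp: box_def Basis_complex_def)

lemma in_cbox_complex: "z \<in> cbox l u \<longleftrightarrow> Re l \<le> Re z \<and> Re z \<le> Re u \<and> Im l \<le> Im z \<and> Im z \<le> Im u"
  by (auto simp: cbox_def Basis_complex_def)

lemma lborel_complex_pair: "(lborel :: complex measure) = distr lborel borel complex_of_pair"
proof (rule lborel_eqI)
  fix l u :: complex assume le: "\<And>b. b \<in> Basis \<Longrightarrow> l \<bullet> b \<le> u \<bullet> b"
  have le': "Re l \<le> Re u" "Im l \<le> Im u" using le[of 1] le[of \<i>] by (auto simp: Basis_complex_def)
  have "complex_of_pair -` box l u = box (Re l, Im l) (Re u, Im u)"
    by (auto simp: in_box_complex complex_of_pair_def mem_box Basis_prod_def)
  then show "emeasure (distr lborel borel complex_of_pair) (box l u) = ennreal (\<Prod>b\<in>Basis. (u - l) \<bullet> b)"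
    using le' by (subst emeasure_distr) (auto simp: emeasure_lborel_box_eq Basis_prod_def prod_Basis_complex
        inner_diff_left ennreal_mult prod.union_disjoint prod.reindex inj_on_def mult.commute)
qed simp

lemma lborel_complex_vec: "(lborel :: complex measure) = distr lborel borel complex_of_vec"
proof (rule lborel_eqI)
  fix l u :: complex assume le: "\<And>b. b \<in> Basis \<Longrightarrow> l \<bullet> b \<le> u \<bullet> b"
  have le': "Re l \<le> Re u" "Im l \<le> Im u" using le[of 1] le[of \<i>] by (auto simp: Basis_complex_def)
  have B: "(Basis :: (real^2) set) = {axis 1 1, axis 2 1}"
    by (auto simp: Basis_vec_def UNIV_2)
  have ne: "axis 1 1 \<noteq> (axis 2 1 :: real^2)" by (simp add: axis_eq_axis)
  have "complex_of_vec -` box l u = box (vec_of_complex l) (vec_of_complex u)"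
    by (auto simp: in_box_complex complex_of_vec_def mem_box B vec_of_complex_def inner_axis)
  then show "emeasure (distr lborel borel complex_of_vec) (box l u) = ennreal (\<Prod>b\<in>Basis. (u - l) \<bullet> b)"
    using le' ne by (subst emeasure_distr) (auto simp: emeasure_lborel_box_eq B prod_Basis_complex
        inner_diff_left inner_axis vec_of_complex_def)
qed simp

lemma lborel_complex_pair_transfer:
  fixes f :: "complex \<Rightarrow> complex"
  assumes [measurable]: "f \<in> borel_measurable borel"
  shows "integrable lborel f \<longleftrightarrow> integrable lborel (\<lambda>p. f (complex_of_pair p))"
    and "integral\<^sup>L lborel f = (LINT p|lborel. f (complex_of_pair p))"
  by (subst lborel_complex_pair, rule integrable_distr_eq; simp)
    (subst lborel_complex_pair, rule integral_distr; simp)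

lemma lborel_complex_vec_transfer:
  fixes f :: "complex \<Rightarrow> complex"
  assumes [measurable]: "f \<in> borel_measurable borel"
  shows "integrable lborel f \<longleftrightarrow> integrable lborel (\<lambda>v. f (complex_of_vec v))"
    and "integral\<^sup>L lborel f = (LINT v|lborel. f (complex_of_vec v))"
  by (subst lborel_complex_vec, rule integrable_distr_eq; simp)
    (subst lborel_complex_vec, rule integral_distr; simp)

lemma absolutely_integrable_vec_iff:
  fixes f :: "complex \<Rightarrow> complex"
  assumes f: "(\<lambda>z. indicator B z *\<^sub>R f z) \<in> borel_measurable borel"
  shows "(\<lambda>v. vec_of_complex (f (complex_of_vec v))) absolutely_integrable_on (complex_of_vec -` B)
      \<longleftrightarrow> set_integrable lborel B f" (is "?L \<longleftrightarrow> ?R")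
    and "set_integrable lborel B f \<Longrightarrow>
      integral (complex_of_vec -` B) (\<lambda>v. vec_of_complex (f (complex_of_vec v)))
        = vec_of_complex (LINT z:B|lborel. f z)"
proof -
  let ?F = "\<lambda>z. indicator B z *\<^sub>R f z"
  let ?G = "\<lambda>v. vec_of_complex (?F (complex_of_vec v))"
  have G: "(\<lambda>v. indicator (complex_of_vec -` B) v *\<^sub>R vec_of_complex (f (complex_of_vec v))) = ?G"
    by (auto simp: fun_eq_iff indicator_def linear_scale[OF linear_vec_of_complex] linear_0[OF linear_vec_of_complex])
  have m: "(\<lambda>v. ?F (complex_of_vec v)) \<in> borel_measurable borel"
    using measurable_compose[OF measurable_complex_of_vec f] .
  have mG: "?G \<in> borel_measurable lborel"
    using measurable_compose[OF m measurable_vec_of_complex] by simp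
  have "?L \<longleftrightarrow> integrable lebesgue ?G" unfolding set_integrable_def G ..
  also have "\<dots> \<longleftrightarrow> integrable lborel ?G" using mG by (rule integrable_completion)
  also have "\<dots> \<longleftrightarrow> integrable lborel (\<lambda>v. ?F (complex_of_vec v))"
    using integrable_bounded_linear[OF bounded_linear_vec_of_complex, of lborel "\<lambda>v. ?F (complex_of_vec v)"]
      integrable_bounded_linear[OF bounded_linear_complex_of_vec, of lborel ?G] by auto
  also have "\<dots> \<longleftrightarrow> integrable lborel ?F"
    by (rule lborel_complex_vec_transfer(1)[OF f, symmetric])
  finally show iff: "?L \<longleftrightarrow> ?R" by (simp add: set_integrable_def)
  assume R: ?R
  then have i: "integrable lborel (\<lambda>v. ?F (complex_of_vec v))"
    using lborel_complex_vec_transfer(1)[OF f] by (simp add: set_integrable_def)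
  have "integral (complex_of_vec -` B) (\<lambda>v. vec_of_complex (f (complex_of_vec v))) = integral\<^sup>L lebesgue ?G"
    using set_lebesgue_integral_eq_integral(2)[OF iffD2[OF iff R]] by (simp add: set_lebesgue_integral_def G)
  also have "\<dots> = integral\<^sup>L lborel ?G" using mG by (rule integral_completion)
  also have "\<dots> = vec_of_complex (integral\<^sup>L lborel (\<lambda>v. ?F (complex_of_vec v)))"
    using integral_bounded_linear[OF bounded_linear_vec_of_complex i] .
  also have "integral\<^sup>L lborel (\<lambda>v. ?F (complex_of_vec v)) = integral\<^sup>L lborel ?F"
    by (rule lborel_complex_vec_transfer(2)[OF f, symmetric])
  finally show "integral (complex_of_vec -` B) (\<lambda>v. vec_of_complex (f (complex_of_vec v)))
        = vec_of_complex (LINT z:B|lborel. f z)" by (simp add: set_lebesgue_integral_def)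
qed

lemma det_matrix_complex_mult:
  "det (matrix (\<lambda>v. vec_of_complex (d * complex_of_vec v))) = (cmod d)\<^sup>2"
  by (simp add: det_2 matrix_def vec_of_complex_def complex_of_vec_def axis_def)
    (simp add: cmod_power2 flip: power2_eq_square)

text \<open>The Jacobian determinant of a holomorphic map is $|h'|^2$.\<close>

lemma holomorphic_change_of_variables:
  fixes f :: "complex \<Rightarrow> complex"
  assumes S: "open S" and h: "h holomorphic_on S" "inj_on h S"
    and f: "(\<lambda>z. indicator (h ` S) z *\<^sub>R f z) \<in> borel_measurable borel"
  shows "set_integrable lborel S (\<lambda>z. of_real ((cmod (deriv h z))\<^sup>2) * f (h z)) \<longleftrightarrow> set_integrable lborel (h ` S) f"
    and "(LINT z:S|lborel. of_real ((cmod (deriv h z))\<^sup>2) * f (h z)) = (LINT z:h ` S|lborel. f z)"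
proof -
  let ?k = "\<lambda>z. of_real ((cmod (deriv h z))\<^sup>2) * f (h z)"
  let ?h0 = "\<lambda>z. if z \<in> S then h z else 0"
  have [measurable]: "S \<in> sets borel" using S by simp
  have hm: "?h0 \<in> borel_measurable borel"
    by (rule borel_measurable_continuous_on_if) (use S h holomorphic_on_imp_continuous_on in auto)
  have dm: "(\<lambda>z. if z \<in> S then deriv h z else 0) \<in> borel_measurable borel"
    by (rule borel_measurable_continuous_on_if)
      (use S h in \<open>auto intro!: holomorphic_on_imp_continuous_on holomorphic_deriv\<close>)
  have "(\<lambda>z. of_real ((cmod (if z \<in> S then deriv h z else 0))\<^sup>2)
        * (indicator (h ` S) (?h0 z) *\<^sub>R f (?h0 z))) \<in> borel_measurable borel"
    using measurable_compose[OF hm f] dm by measurable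
  moreover have "(\<lambda>z. of_real ((cmod (if z \<in> S then deriv h z else 0))\<^sup>2)
        * (indicator (h ` S) (?h0 z) *\<^sub>R f (?h0 z))) = (\<lambda>z. indicator S z *\<^sub>R ?k z)"
    by (auto simp: fun_eq_iff indicator_def)
  ultimately have k: "(\<lambda>z. indicator S z *\<^sub>R ?k z) \<in> borel_measurable borel" by simp
  let ?S = "complex_of_vec -` S"
  let ?g = "\<lambda>v. vec_of_complex (h (complex_of_vec v))"
  let ?g' = "\<lambda>v w. vec_of_complex (deriv h (complex_of_vec v) * complex_of_vec w)"
  let ?f = "\<lambda>v. vec_of_complex (f (complex_of_vec v))"
  have "open ?S" using S continuous_on_complex_of_vec by (metis open_vimage)
  then have Sl: "?S \<in> sets lebesgue" by (simp add: borel_open)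
  have der: "(?g has_derivative ?g' v) (at v within ?S)" if "v \<in> ?S" for v
  proof -
    have 1: "(complex_of_vec has_derivative complex_of_vec) (at v within ?S)"
      by (rule bounded_linear_imp_has_derivative[OF bounded_linear_complex_of_vec])
    have "(h has_field_derivative deriv h (complex_of_vec v)) (at (complex_of_vec v))"
      using that S h by (auto intro: holomorphic_derivI)
    then have 2: "(h has_derivative (\<lambda>w. deriv h (complex_of_vec v) * w)) (at (complex_of_vec v))"
      by (simp add: has_field_derivative_def)
    have "((\<lambda>v. h (complex_of_vec v)) has_derivative (\<lambda>w. deriv h (complex_of_vec v) * complex_of_vec w)) (at v within ?S)"
      by (rule has_derivative_compose[OF 1 2])
    then show ?thesis
      by (rule bounded_linear.has_derivative[OF bounded_linear_vec_of_complex])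
  qed
  have inj: "inj_on ?g ?S"
    using h(2) by (auto simp: inj_on_def) (metis complex_of_vec_inverse)
  have img: "?g ` ?S = complex_of_vec -` (h ` S)"
  proof (intro equalityI subsetI)
    fix w assume "w \<in> complex_of_vec -` (h ` S)"
    then obtain z where z: "z \<in> S" "complex_of_vec w = h z" by auto
    then have "w = ?g (vec_of_complex z)" by (metis complex_of_vec_inverse)
    with z show "w \<in> ?g ` ?S" by (intro image_eqI[of _ _ "vec_of_complex z"]) simp_all
  qed auto
  have eq: "\<bar>det (matrix (?g' v))\<bar> *\<^sub>R ?f (?g v) = vec_of_complex (?k (complex_of_vec v))" for v
  proof -
    let ?c = "(cmod (deriv h (complex_of_vec v)))\<^sup>2"
    have "vec_of_complex (?k (complex_of_vec v)) = vec_of_complex (?c *\<^sub>R f (h (complex_of_vec v)))"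
      by (simp only: scaleR_conv_of_real)
    also have "\<dots> = ?c *\<^sub>R vec_of_complex (f (h (complex_of_vec v)))"
      by (rule linear_scale[OF linear_vec_of_complex])
    finally show ?thesis unfolding det_matrix_complex_mult complex_of_vec_inverse by simp
  qed
  have main: "(\<lambda>v. vec_of_complex (?k (complex_of_vec v))) absolutely_integrable_on ?S
       \<and> integral ?S (\<lambda>v. vec_of_complex (?k (complex_of_vec v))) = b
     \<longleftrightarrow> ?f absolutely_integrable_on (complex_of_vec -` (h ` S)) \<and> integral (complex_of_vec -` (h ` S)) ?f = b" for b
    using has_absolute_integral_change_of_variables[OF Sl der inj, of ?f b] unfolding eq img .
  show iff: "set_integrable lborel S ?k \<longleftrightarrow> set_integrable lborel (h ` S) f"
    using main[of "integral ?S (\<lambda>v. vec_of_complex (?k (complex_of_vec v)))"]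
      main[of "integral (complex_of_vec -` (h ` S)) ?f"]
    unfolding absolutely_integrable_vec_iff(1)[OF k] absolutely_integrable_vec_iff(1)[OF f] by auto
  show "(LINT z:S|lborel. ?k z) = (LINT z:h ` S|lborel. f z)"
  proof (cases "set_integrable lborel S ?k")
    case True
    then have "integral ?S (\<lambda>v. vec_of_complex (?k (complex_of_vec v))) = integral (complex_of_vec -` (h ` S)) ?f"
      using main[of "integral ?S (\<lambda>v. vec_of_complex (?k (complex_of_vec v)))"]
      unfolding absolutely_integrable_vec_iff(1)[OF k] by simp
    then have "vec_of_complex (LINT z:S|lborel. ?k z) = vec_of_complex (LINT z:h ` S|lborel. f z)"
      unfolding absolutely_integrable_vec_iff(2)[OF k True]
        absolutely_integrable_vec_iff(2)[OF f iffD1[OF iff True]] .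
    from arg_cong[OF this, of complex_of_vec] show ?thesis unfolding complex_of_vec_inverse .
  next
    case False
    then show ?thesis using iff
      by (simp add: set_integrable_def set_lebesgue_integral_def not_integrable_integral_eq)
  qed
qed

lemma complex_cbox_integral:
  fixes F :: "complex \<Rightarrow> complex"
  assumes F: "continuous_on (cbox l u) F"
  shows "set_integrable lborel (cbox l u) F"
    and "(LINT z:cbox l u|lborel. F z)
      = integral {Re l..Re u} (\<lambda>x. integral {Im l..Im u} (\<lambda>y. F (Complex x y)))"
proof -
  let ?P = "cbox (Re l, Im l) (Re u, Im u)"
  have P: "indicator (cbox l u) (complex_of_pair p) = (indicator ?P p :: real)" for p
    by (cases p) (auto simp: indicator_def in_cbox_complex complex_of_pair_def cbox_Pair_eq)
  show i: "set_integrable lborel (cbox l u) F"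
    using borel_integrable_compact[OF compact_cbox F] by (simp add: set_integrable_def)
  have "complex_of_pair ` ?P \<subseteq> cbox l u"
    by (auto simp: in_cbox_complex complex_of_pair_def cbox_Pair_eq)
  then have c: "continuous_on ?P (\<lambda>p. F (complex_of_pair p))"
    using continuous_on_compose2[OF F continuous_on_complex_of_pair] by blast
  have i2: "set_integrable lborel ?P (\<lambda>p. F (complex_of_pair p))"
    using borel_integrable_compact[OF compact_cbox c] by (simp add: set_integrable_def)
  have "(LINT z:cbox l u|lborel. F z) = (LINT p:?P|lborel. F (complex_of_pair p))"
  proof -
    have "(\<lambda>z. indicator (cbox l u) z *\<^sub>R F z) \<in> borel_measurable borel"
      using borel_measurable_integrable[OF i[unfolded set_integrable_def]] by simp
    from lborel_complex_pair_transfer(2)[OF this] show ?thesis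
      unfolding set_lebesgue_integral_def P .
  qed
  also have "\<dots> = integral ?P (\<lambda>p. F (complex_of_pair p))"
    by (rule set_borel_integral_eq_integral(2)[OF i2])
  also have "\<dots> = integral (cbox (Re l) (Re u)) (\<lambda>x. integral (cbox (Im l) (Im u)) (\<lambda>y. F (complex_of_pair (x, y))))"
    by (rule integral_prod_continuous[OF c])
  finally show "(LINT z:cbox l u|lborel. F z)
      = integral {Re l..Re u} (\<lambda>x. integral {Im l..Im u} (\<lambda>y. F (Complex x y)))"
    by (simp add: complex_of_pair_def cbox_interval)
qed

lemma complex_cbox_integral':
  fixes F :: "complex \<Rightarrow> complex"
  assumes F: "continuous_on (cbox l u) F"
  shows "(LINT z:cbox l u|lborel. F z)
      = integral {Im l..Im u} (\<lambda>y. integral {Re l..Re u} (\<lambda>x. F (Complex x y)))"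
proof -
  have "complex_of_pair ` cbox (Re l, Im l) (Re u, Im u) \<subseteq> cbox l u"
    by (auto simp: in_cbox_complex complex_of_pair_def cbox_Pair_eq)
  then have c: "continuous_on (cbox (Re l, Im l) (Re u, Im u)) (\<lambda>p. F (complex_of_pair p))"
    using continuous_on_compose2[OF F continuous_on_complex_of_pair] by blast
  then have c: "continuous_on (cbox (Re l, Im l) (Re u, Im u)) (\<lambda>(x, y). F (Complex x y))"
    by (simp add: complex_of_pair_def case_prod_unfold)
  show ?thesis
    using complex_cbox_integral(2)[OF F] integral_swap_continuous[OF c] by (simp add: cbox_interval)
qed

lemma has_wirtinger_horizontal:
  assumes "has_wirtinger F A B (at (Complex x y) within R)"
    and "\<And>s. s \<in> X \<Longrightarrow> Complex s y \<in> R"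
  shows "((\<lambda>s. F (Complex s y)) has_vector_derivative (A + B)) (at x within X)"
proof -
  have 1: "((\<lambda>s. Complex s y) has_derivative (\<lambda>d. of_real d)) (at x within X)"
    unfolding Complex_eq by (auto intro!: derivative_eq_intros)
  have "(F has_derivative (\<lambda>h. A * h + B * cnj h)) (at (Complex x y) within (\<lambda>s. Complex s y) ` X)"
    using assms by (auto simp: has_wirtinger_def intro: has_derivative_subset)
  from has_derivative_in_compose[OF 1 this]
  show ?thesis by (simp add: has_vector_derivative_def scaleR_conv_of_real algebra_simps)
qed

lemma has_wirtinger_vertical:
  assumes "has_wirtinger F A B (at (Complex x y) within R)"
    and "\<And>s. s \<in> Y \<Longrightarrow> Complex x s \<in> R"
  shows "((\<lambda>s. F (Complex x s)) has_vector_derivative (\<i> * (A - B))) (at y within Y)"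
proof -
  have 1: "((\<lambda>s. Complex x s) has_derivative (\<lambda>d. \<i> * of_real d)) (at y within Y)"
    unfolding Complex_eq by (auto intro!: derivative_eq_intros)
  have "(F has_derivative (\<lambda>h. A * h + B * cnj h)) (at (Complex x y) within (\<lambda>s. Complex x s) ` Y)"
    using assms by (auto simp: has_wirtinger_def intro: has_derivative_subset)
  from has_derivative_in_compose[OF 1 this]
  show ?thesis by (simp add: has_vector_derivative_def scaleR_conv_of_real algebra_simps)
qed

text \<open>Put $P = u + v$ and $Q = i(u - v)$. Then $u\,dz + v\,d\bar z = P\,dx + Q\,dy$ and
  $-2i\,(v_z - u_{\bar z}) = Q_x - P_y$, and the two terms are integrated by Fubini's theorem and
  the fundamental theorem of calculus in $x$ and in $y$.\<close>

lemma green_rectangle: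
  fixes u v :: "complex \<Rightarrow> complex"
  assumes le: "a \<le> b" "c \<le> d"
    and R: "R = cbox (Complex a c) (Complex b d)"
    and u: "\<And>z. z \<in> R \<Longrightarrow> has_wirtinger u (Au z) (Bu z) (at z within R)"
    and v: "\<And>z. z \<in> R \<Longrightarrow> has_wirtinger v (Av z) (Bv z) (at z within R)"
    and cont: "continuous_on R Au" "continuous_on R Bu" "continuous_on R Av" "continuous_on R Bv"
  shows "(LINT z:R|lborel. (Av z - Bu z) * (- 2 * \<i>))
    = integral {c..d} (\<lambda>y. \<i> * (u (Complex b y) - v (Complex b y)) - \<i> * (u (Complex a y) - v (Complex a y)))
      - integral {a..b} (\<lambda>x. (u (Complex x d) + v (Complex x d)) - (u (Complex x c) + v (Complex x c)))"
proof -
  let ?P = "\<lambda>z. u z + v z" and ?Q = "\<lambda>z. \<i> * (u z - v z)"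
  let ?Qx = "\<lambda>z. \<i> * (Au z - Av z) + \<i> * (Bu z - Bv z)"
  let ?Py = "\<lambda>z. \<i> * ((Au z + Av z) - (Bu z + Bv z))"
  have Q: "has_wirtinger ?Q (\<i> * (Au z - Av z)) (\<i> * (Bu z - Bv z)) (at z within R)" if "z \<in> R" for z
    using has_wirtinger_mult[OF has_wirtinger_const[of \<i>] has_wirtinger_diff[OF u[OF that] v[OF that]]] by simp
  have P: "has_wirtinger ?P (Au z + Av z) (Bu z + Bv z) (at z within R)" if "z \<in> R" for z
    by (rule has_wirtinger_add[OF u[OF that] v[OF that]])
  have cQ: "continuous_on R ?Qx" and cP: "continuous_on R ?Py"
    by (intro continuous_intros cont)+
  have mem: "Complex x y \<in> R \<longleftrightarrow> x \<in> {a..b} \<and> y \<in> {c..d}" for x y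
    by (auto simp: R in_cbox_complex)
  have "(LINT z:R|lborel. ?Qx z) = integral {c..d} (\<lambda>y. integral {a..b} (\<lambda>x. ?Qx (Complex x y)))"
    using complex_cbox_integral'[OF cQ[unfolded R]] by (simp add: R)
  also have "\<dots> = integral {c..d} (\<lambda>y. ?Q (Complex b y) - ?Q (Complex a y))"
  proof (rule integral_cong)
    fix y assume y: "y \<in> {c..d}"
    have "((\<lambda>x. ?Qx (Complex x y)) has_integral (?Q (Complex b y) - ?Q (Complex a y))) {a..b}"
      by (rule fundamental_theorem_of_calculus[OF le(1)], rule has_wirtinger_horizontal[OF Q])
        (use y mem in auto)
    then show "integral {a..b} (\<lambda>x. ?Qx (Complex x y)) = ?Q (Complex b y) - ?Q (Complex a y)"
      by (rule integral_unique)
  qed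
  finally have 1: "(LINT z:R|lborel. ?Qx z) = integral {c..d} (\<lambda>y. ?Q (Complex b y) - ?Q (Complex a y))" .
  have "(LINT z:R|lborel. ?Py z) = integral {a..b} (\<lambda>x. integral {c..d} (\<lambda>y. ?Py (Complex x y)))"
    using complex_cbox_integral(2)[OF cP[unfolded R]] by (simp add: R)
  also have "\<dots> = integral {a..b} (\<lambda>x. ?P (Complex x d) - ?P (Complex x c))"
  proof (rule integral_cong)
    fix x assume x: "x \<in> {a..b}"
    have "((\<lambda>y. ?Py (Complex x y)) has_integral (?P (Complex x d) - ?P (Complex x c))) {c..d}"
      by (rule fundamental_theorem_of_calculus[OF le(2)], rule has_wirtinger_vertical[OF P])
        (use x mem in auto)
    then show "integral {c..d} (\<lambda>y. ?Py (Complex x y)) = ?P (Complex x d) - ?P (Complex x c)"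
      by (rule integral_unique)
  qed
  finally have 2: "(LINT z:R|lborel. ?Py z) = integral {a..b} (\<lambda>x. ?P (Complex x d) - ?P (Complex x c))" .
  have "(LINT z:R|lborel. (Av z - Bu z) * (- 2 * \<i>)) = (LINT z:R|lborel. ?Qx z - ?Py z)"
    by (rule arg_cong[where f = "\<lambda>f. set_lebesgue_integral lborel R f"]) (simp add: fun_eq_iff algebra_simps)
  also have "\<dots> = (LINT z:R|lborel. ?Qx z) - (LINT z:R|lborel. ?Py z)"
    using complex_cbox_integral(1)[OF cQ[unfolded R]] complex_cbox_integral(1)[OF cP[unfolded R]]
    by (intro set_integral_diff) (simp_all add: R)
  finally show ?thesis unfolding 1 2 .
qed

section \<open>Stokes' formula in the plane\<close>

lemma AE_lborel_Im_nonzero: "AE z in (lborel :: complex measure). Im z \<noteq> 0"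
proof -
  have "negligible {z. \<i> \<bullet> z = 0}" by (rule negligible_hyperplane) simp
  then have "{z. Im z = 0} \<in> null_sets lebesgue" by (simp add: negligible_iff_null_sets)
  moreover have "{z. Im z = 0} \<in> sets lborel"
    by (simp add: borel_closed closed_halfspace_Im_eq)
  ultimately have "{z. Im z = 0} \<in> null_sets lborel" by (simp add: null_sets_completion_iff)
  from AE_not_in[OF this] show ?thesis by simp
qed

lemma borel_measurable_indicator_continuous:
  fixes f :: "complex \<Rightarrow> complex"
  assumes "continuous_on S f" "S \<in> sets borel"
  shows "(\<lambda>z. indicator S z *\<^sub>R f z) \<in> borel_measurable borel"
  using borel_measurable_continuous_on_indicator[OF assms(2,1)] by simp

text \<open>Lets a function with compact support in a chart be integrated over a rectangle that does not fit
  into the chart.\<close>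

lemma zero_extension:
  fixes f :: "complex \<Rightarrow> complex"
  assumes H: "H = UNIV \<or> H = half_plane" and S: "openin (top_of_set H) S"
    and f: "smooth_on f S" and K: "compact K" "K \<subseteq> S" "\<And>z. z \<in> S - K \<Longrightarrow> f z = 0"
  defines "f0 \<equiv> \<lambda>z. if z \<in> S then f z else 0"
  shows "smooth_on f0 H"
    and "\<And>z. z \<in> S \<Longrightarrow> wirtinger_z S f z = wirtinger_z H f0 z"
    and "\<And>z. z \<in> S \<Longrightarrow> wirtinger_zbar S f z = wirtinger_zbar H f0 z"
    and "\<And>z. z \<in> H - K \<Longrightarrow> wirtinger_z H f0 z = 0"
    and "\<And>z. z \<in> H - K \<Longrightarrow> wirtinger_zbar H f0 z = 0"
proof -
  obtain T where T: "open T" "S = H \<inter> T" using S by (auto simp: openin_open)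
  have oK: "open (- K)" using K(1) by (simp add: compact_imp_closed open_Compl)
  have mH: "model_set H" using H by (auto simp: model_set_def half_plane_def)
  have mS: "model_set S" using model_set_Int[OF mH T(1)] T(2) by simp
  have f0K: "f0 z = 0" if "z \<notin> K" for z using K(3) that by (auto simp: f0_def)
  show sm: "smooth_on f0 H"
  proof (rule smooth_on_local)
    fix z assume z: "z \<in> H"
    show "\<exists>T. open T \<and> z \<in> T \<and> smooth_on f0 (H \<inter> T)"
    proof (cases "z \<in> S")
      case True
      have "smooth_on f0 (H \<inter> T)"
        by (rule smooth_on_cong[of f]) (use f T in \<open>auto simp: f0_def\<close>)
      with True T show ?thesis by blast
    next
      case False
      have "smooth_on f0 (H \<inter> - K)"
        by (rule smooth_on_cong[OF smooth_on_const[of 0]]) (use f0K in auto)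
      moreover have "z \<in> - K" using False K(2) by blast
      ultimately show ?thesis using oK by blast
    qed
  qed
  have sm': "smooth_on f0 (H \<inter> UNIV)" using sm by simp
  have d: "has_wirtinger f0 (wirtinger_z H f0 z) (wirtinger_zbar H f0 z) (at z within H)" if "z \<in> H" for z
    using has_wirtinger_smooth_on[OF sm' open_UNIV mH] that by simp
  have dS: "has_wirtinger f (wirtinger_z H f0 z) (wirtinger_zbar H f0 z) (at z within S)" if "z \<in> S" for z
  proof (rule has_wirtinger_transform[where T = UNIV])
    show "has_wirtinger f0 (wirtinger_z H f0 z) (wirtinger_zbar H f0 z) (at z within S)"
      by (rule has_wirtinger_subset[OF d]) (use that T in auto)
  qed (use that in \<open>auto simp: f0_def\<close>)
  show "wirtinger_z S f z = wirtinger_z H f0 z" "wirtinger_zbar S f z = wirtinger_zbar H f0 z" if "z \<in> S" for z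
    using has_wirtinger_imp_eq[OF mS that dS[OF that]] .
  have "has_wirtinger f0 0 0 (at z within H)" if "z \<in> H - K" for z
    by (rule has_wirtinger_transform[OF has_wirtinger_const[of 0], where T = "- K"])
      (use that oK f0K in auto)
  then show "wirtinger_z H f0 z = 0" "wirtinger_zbar H f0 z = 0" if "z \<in> H - K" for z
    using has_wirtinger_imp_eq[OF mH] that by blast+
qed

text \<open>Green's formula for a rectangle around the support. In the half plane the rectangle stands on
  the real axis, and this edge is the only one that contributes.\<close>

lemma stokes_compact_support:
  fixes u v :: "complex \<Rightarrow> complex"
  assumes H: "H = UNIV \<or> H = half_plane" and S: "openin (top_of_set H) S"
    and u: "smooth_on u S" and v: "smooth_on v S"
    and K: "compact K" "K \<subseteq> S" "\<And>z. z \<in> S - K \<Longrightarrow> u z = 0" "\<And>z. z \<in> S - K \<Longrightarrow> v z = 0"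
  defines "B \<equiv> (if H = UNIV then {} else {x. complex_of_real x \<in> S})"
  shows "set_integrable lborel S (\<lambda>z. (wirtinger_z S v z - wirtinger_zbar S u z) * (- 2 * \<i>))"
    and "set_integrable lborel B (\<lambda>x. u (of_real x) + v (of_real x))"
    and "(LINT z:S|lborel. (wirtinger_z S v z - wirtinger_zbar S u z) * (- 2 * \<i>))
      = (LINT x:B|lborel. u (of_real x) + v (of_real x))"
proof -
  define u0 where "u0 = (\<lambda>z. if z \<in> S then u z else 0)"
  define v0 where "v0 = (\<lambda>z. if z \<in> S then v z else 0)"
  note ue = zero_extension[OF H S u K(1,2,3), folded u0_def]
  note ve = zero_extension[OF H S v K(1,2,4), folded v0_def]
  have SH: "S \<subseteq> H" using S by (rule openin_imp_subset)
  have mH: "model_set H" using H by (auto simp: model_set_def half_plane_def)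
  obtain M where M: "M > 0" "K \<subseteq> ball 0 M"
    using compact_imp_bounded[OF K(1)] bounded_subset_ballD[of K 0] by blast
  \<comment> \<open>The height of the lower edge of the rectangle.\<close>
  define m where "m = (if H = UNIV then - M else 0)"
  define R where "R = cbox (Complex (- M) m) (Complex M M)"
  have RH: "R \<subseteq> H" using H M(1) by (auto simp: R_def in_cbox_complex m_def half_plane_def)
  have KR: "K \<subseteq> R"
  proof
    fix z assume z: "z \<in> K"
    then have "cmod z < M" using M by auto
    then have "\<bar>Re z\<bar> < M" "\<bar>Im z\<bar> < M" using abs_Re_le_cmod abs_Im_le_cmod le_less_trans by blast+
    moreover have "z \<in> H" using z K SH by blast
    ultimately show "z \<in> R" using H by (auto simp: R_def in_cbox_complex m_def half_plane_def)
  qed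
  have z0: "u0 z = 0" "v0 z = 0" if "z \<notin> K" for z
    using that K by (auto simp: u0_def v0_def)
  let ?w = "\<lambda>z. (wirtinger_z S v z - wirtinger_zbar S u z) * (- 2 * \<i>)"
  let ?W = "\<lambda>z. (wirtinger_z H v0 z - wirtinger_zbar H u0 z) * (- 2 * \<i>)"
  have eq: "indicator S z *\<^sub>R ?w z = indicator R z *\<^sub>R ?W z" for z
  proof (cases "z \<in> K")
    case True
    then show ?thesis using K(2) KR ue ve by (auto simp: indicator_def)
  next
    case False
    have "?w z = 0" if "z \<in> S" using ue ve that False SH by auto
    moreover have "?W z = 0" if "z \<in> R" using ue ve that False RH by auto
    ultimately show ?thesis by (auto simp: indicator_def)
  qed
  have s: "smooth_on u0 (H \<inter> UNIV)" "smooth_on v0 (H \<inter> UNIV)" using ue(1) ve(1) by simp_all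
  have c: "continuous_on R (wirtinger_z H u0)" "continuous_on R (wirtinger_zbar H u0)"
    "continuous_on R (wirtinger_z H v0)" "continuous_on R (wirtinger_zbar H v0)"
    using smooth_on_continuous[OF smooth_on_wirtinger_z[OF s(1) open_UNIV mH]]
      smooth_on_continuous[OF smooth_on_wirtinger_zbar[OF s(1) open_UNIV mH]]
      smooth_on_continuous[OF smooth_on_wirtinger_z[OF s(2) open_UNIV mH]]
      smooth_on_continuous[OF smooth_on_wirtinger_zbar[OF s(2) open_UNIV mH]]
    by (auto intro: continuous_on_subset[OF _ RH])
  have "continuous_on R ?W" by (intro continuous_intros c)
  then have iR: "set_integrable lborel R ?W"
    unfolding R_def by (rule complex_cbox_integral(1))
  then show "set_integrable lborel S ?w" unfolding set_integrable_def eq .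
  have dR: "has_wirtinger u0 (wirtinger_z H u0 z) (wirtinger_zbar H u0 z) (at z within R)"
    "has_wirtinger v0 (wirtinger_z H v0 z) (wirtinger_zbar H v0 z) (at z within R)" if "z \<in> R" for z
    using has_wirtinger_smooth_on[OF s(1) open_UNIV mH] has_wirtinger_smooth_on[OF s(2) open_UNIV mH] that RH
    by (auto intro!: has_wirtinger_subset[OF _ RH])
  have le: "- M \<le> M" "m \<le> M" using M by (auto simp: m_def)
  have notK: "z \<notin> K" if "cmod z \<ge> M" for z using M that by auto
  have edge: "Complex M y \<notin> K" "Complex (- M) y \<notin> K" "Complex x M \<notin> K" "Complex x (- M) \<notin> K" for x y
    using M(1) abs_Re_le_cmod[of "Complex M y"] abs_Re_le_cmod[of "Complex (-M) y"]
       abs_Im_le_cmod[of "Complex x M"] abs_Im_le_cmod[of "Complex x (-M)"] by (auto intro!: notK)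
  let ?P = "\<lambda>x. u0 (Complex x m) + v0 (Complex x m)"
  have "(LINT z:S|lborel. ?w z) = (LINT z:R|lborel. ?W z)"
    unfolding set_lebesgue_integral_def eq ..
  also have "\<dots> = integral {m..M} (\<lambda>y. 0) - integral {- M..M} (\<lambda>x. 0 - ?P x)"
    by (subst green_rectangle[OF le R_def dR c]) (simp_all add: z0 edge)
  also have "\<dots> = integral {- M..M} ?P" by (simp only: diff_0 integral_neg integral_0 minus_minus)
  finally have main: "(LINT z:S|lborel. ?w z) = integral {- M..M} ?P" .
  have "continuous_on {- M..M} ?P"
  proof -
    have a: "continuous_on {- M..M} (\<lambda>x. Complex x m)" by (simp add: Complex_eq continuous_intros)
    have b: "(\<lambda>x. Complex x m) ` {- M..M} \<subseteq> H" using RH le by (auto simp: R_def in_cbox_complex)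
    show ?thesis
      by (intro continuous_intros continuous_on_compose2[OF smooth_on_continuous[OF ue(1)] a b]
          continuous_on_compose2[OF smooth_on_continuous[OF ve(1)] a b])
  qed
  then have i0: "set_integrable lborel {- M..M} ?P"
    using borel_integrable_compact[of "{- M..M}" ?P] by (simp add: set_integrable_def)
  have eqB: "indicator B x *\<^sub>R (u (of_real x) + v (of_real x)) = indicator {- M..M} x *\<^sub>R ?P x" for x
  proof (cases "H = UNIV")
    case True
    then show ?thesis using edge(4) z0 by (simp add: B_def m_def)
  next
    case False
    have "Complex x 0 = of_real x" by (simp add: complex_of_real_def)
    moreover have "u0 (of_real x) = 0 \<and> v0 (of_real x) = 0" if "x \<notin> {- M..M}"
      using that z0 notK[of "of_real x"] by auto
    ultimately show ?thesis using False by (auto simp: B_def m_def indicator_def u0_def v0_def)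
  qed
  show "set_integrable lborel B (\<lambda>x. u (of_real x) + v (of_real x))"
    using i0 unfolding set_integrable_def eqB .
  have "(LINT x:B|lborel. u (of_real x) + v (of_real x)) = (LINT x:{- M..M}|lborel. ?P x)"
    unfolding set_lebesgue_integral_def eqB ..
  also have "\<dots> = integral {- M..M} ?P" by (rule set_borel_integral_eq_integral(2)[OF i0])
  finally show "(LINT z:S|lborel. ?w z) = (LINT x:B|lborel. u (of_real x) + v (of_real x))"
    using main by simp
qed

text \<open>The substitution $z = w^2$ on a right half disc brings in the factor $|2w|^2$, which turns the
  bound $C/|z|$ into the constant $4C$. Its image is the disc slit along the negative real axis.\<close>

lemma set_integrable_inverse_norm_bound:
  fixes f :: "complex \<Rightarrow> complex"
  assumes f: "(\<lambda>z. indicator (ball 0 r) z *\<^sub>R f z) \<in> borel_measurable borel"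
    and r: "r > 0" and bound: "\<And>z. z \<in> ball 0 r - {0} \<Longrightarrow> cmod (f z) \<le> C / cmod z"
  shows "set_integrable lborel (ball 0 r) f"
proof -
  define S where "S = ball 0 (sqrt r) \<inter> {w. 0 < Re w}"
  let ?h = "\<lambda>w::complex. w ^ 2"
  have S: "open S" by (simp add: S_def open_Int open_halfspace_Re_gt)
  have h: "?h holomorphic_on S" by (intro holomorphic_intros)
  have inj: "inj_on ?h S"
    by (auto simp: inj_on_def S_def power2_eq_iff)
  have sq: "cmod (w ^ 2) < r" if "cmod w < sqrt r" for w
    using that r power_strict_mono[of "cmod w" "sqrt r" 2] by (simp add: norm_power)
  have img: "?h ` S \<subseteq> ball 0 r" using sq by (auto simp: S_def)
  have img': "z \<in> ?h ` S" if "z \<in> ball 0 r" "Im z \<noteq> 0" for z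
  proof (rule image_eqI[of _ _ "csqrt z"])
    have "Re (csqrt z) \<noteq> 0"
    proof
      assume "Re (csqrt z) = 0"
      then have "Im ((csqrt z) ^ 2) = 0" by (simp add: power2_eq_square)
      then show False using that by simp
    qed
    then have "Re (csqrt z) > 0" using csqrt_principal[of z] by auto
    moreover have "cmod (csqrt z) < sqrt r" using that by (simp add: norm_csqrt)
    ultimately show "csqrt z \<in> S" by (simp add: S_def)
  qed simp
  have o: "open (?h ` S)" by (rule open_mapping_thm3[OF h S inj])
  have fm: "(\<lambda>z. indicator (?h ` S) z *\<^sub>R f z) \<in> borel_measurable borel"
  proof -
    have "(\<lambda>z. indicator (?h ` S) z *\<^sub>R (indicator (ball 0 r) z *\<^sub>R f z)) \<in> borel_measurable borel"
      by (rule borel_measurable_scaleR[OF borel_measurable_indicator f]) (use o in simp)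
    moreover have "(\<lambda>z. indicator (?h ` S) z *\<^sub>R (indicator (ball 0 r) z *\<^sub>R f z)) = (\<lambda>z. indicator (?h ` S) z *\<^sub>R f z)"
      using img by (auto simp: fun_eq_iff indicator_def)
    ultimately show ?thesis by (simp only:)
  qed
  have d: "deriv ?h w = 2 * w" for w
    by (rule DERIV_imp_deriv) (auto intro!: derivative_eq_intros)
  let ?k = "\<lambda>w. of_real ((cmod (deriv ?h w))\<^sup>2) * f (?h w)"
  have km: "(\<lambda>w. indicator S w *\<^sub>R ?k w) \<in> borel_measurable borel"
  proof -
    have m: "?h \<in> borel_measurable borel" by (intro borel_measurable_continuous_onI continuous_intros)
    have "(\<lambda>w. indicator S w *\<^sub>R (of_real ((cmod (2 * w))\<^sup>2) * (indicator (?h ` S) (?h w) *\<^sub>R f (?h w)))) \<in> borel_measurable borel"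
      by (rule borel_measurable_scaleR[OF borel_measurable_indicator
            borel_measurable_times[OF _ measurable_compose[OF m fm]]]) (use S in auto)
    moreover have "(\<lambda>w. indicator S w *\<^sub>R (of_real ((cmod (2 * w))\<^sup>2) * (indicator (?h ` S) (?h w) *\<^sub>R f (?h w))))
       = (\<lambda>w. indicator S w *\<^sub>R ?k w)"
      by (auto simp: fun_eq_iff indicator_def d)
    ultimately show ?thesis by (simp only:)
  qed
  have "integrable lborel (\<lambda>w. indicator S w *\<^sub>R ?k w)"
  proof (rule integrableI_bounded_set[where A = S and B = "4 * C"])
    show "S \<in> sets lborel" using S by simp
    have "emeasure lborel S \<le> emeasure lborel (ball (0::complex) (sqrt r))"
      by (rule emeasure_mono) (auto simp: S_def)
    also have "\<dots> < \<infinity>" using emeasure_bounded_finite[OF bounded_ball] .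
    finally show "emeasure lborel S < \<infinity>" .
    show "AE w\<in>S in lborel. norm (indicator S w *\<^sub>R ?k w) \<le> 4 * C"
    proof (rule AE_I2, rule impI)
      fix w assume w: "w \<in> S"
      then have w0: "w \<noteq> 0" by (auto simp: S_def)
      then have "cmod (f (w ^ 2)) \<le> C / cmod (w ^ 2)" using w img by (intro bound) auto
      then have "4 * (cmod w)\<^sup>2 * cmod (f (w ^ 2)) \<le> 4 * (cmod w)\<^sup>2 * (C / cmod (w ^ 2))"
        by (intro mult_left_mono) auto
      also have "\<dots> = 4 * C" using w0 by (simp add: norm_power)
      finally show "norm (indicator S w *\<^sub>R ?k w) \<le> 4 * C"
        using w by (simp add: d norm_mult power_mult_distrib norm_power)
    qed
  qed (use km in auto)
  then have "set_integrable lborel (?h ` S) f"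
    using holomorphic_change_of_variables(1)[OF S h inj fm] by (simp add: set_integrable_def)
  then have "integrable lborel (\<lambda>z. indicator (?h ` S) z *\<^sub>R f z)" by (simp add: set_integrable_def)
  moreover have "AE z in lborel. indicator (?h ` S) z *\<^sub>R f z = indicator (ball 0 r) z *\<^sub>R f z"
    using AE_lborel_Im_nonzero by eventually_elim (use img img' in \<open>auto simp: indicator_def\<close>)
  ultimately show ?thesis unfolding set_integrable_def
    by (subst integrable_cong_AE[symmetric]) (use f fm in auto)
qed

lemma continuous_circle:
  assumes "continuous_on S g" "\<And>t. of_real e * cis t \<in> S"
  shows "continuous_on X (\<lambda>t. g (of_real e * cis t))"
  by (rule continuous_on_compose2[OF assms(1)]) (use assms(2) in \<open>auto intro!: continuous_intros continuous_on_cis\<close>)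

text \<open>The derivative of $t \mapsto g(\epsilon e^{it})$ is
  $i\epsilon\,(g_z e^{it} - g_{\bar z} e^{-it})$. Integration by parts therefore expresses the
  coefficient of frequency $m$ as $\epsilon/m$ times the difference of the coefficients of $g_z$ at
  $m - 1$ and of $g_{\bar z}$ at $m + 1$, and each such step gains one power of $\epsilon$.\<close>

lemma circle_fourier_decay:
  assumes "smooth_on g (ball 0 r)" "0 < \<rho>" "\<rho> < r"
  shows "\<forall>m\<ge>k. \<exists>C. \<forall>e\<in>{0<..\<rho>}. norm (integral {0..2 * pi}
    (\<lambda>t. g (of_real e * cis t) * cis (- (real m * t)))) \<le> C * e ^ k"
  using assms(1)
proof (induction k arbitrary: g)
  case 0
  have c: "continuous_on (cball 0 \<rho>) g"
    using smooth_on_continuous[OF 0] by (rule continuous_on_subset) (use assms in auto)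
  have "compact (g ` cball 0 \<rho>)" using c by (intro compact_continuous_image) auto
  then obtain C where C: "\<And>z. z \<in> cball 0 \<rho> \<Longrightarrow> norm (g z) \<le> C"
    using compact_imp_bounded[of "g ` cball 0 \<rho>"] unfolding bounded_iff by blast
  show ?case
  proof (intro allI impI exI[of _ "C * (2 * pi)"] ballI)
    fix m :: nat and e assume e: "e \<in> {0<..\<rho>}"
    then have mem: "of_real e * cis t \<in> cball 0 \<rho>" for t by (simp add: norm_mult)
    have "norm (integral {0..2 * pi} (\<lambda>t. g (of_real e * cis t) * cis (- (real m * t)))) \<le> C * (2 * pi - 0)"
    proof (rule integral_bound)
      show "continuous_on {0..2 * pi} (\<lambda>t. g (of_real e * cis t) * cis (- (real m * t)))"
        by (intro continuous_on_mult continuous_circle[OF c mem] continuous_on_cis continuous_intros)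
      show "norm (g (of_real e * cis t) * cis (- (real m * t))) \<le> C" for t
        using C[OF mem] by (simp add: norm_mult)
    qed simp
    then show "norm (integral {0..2 * pi} (\<lambda>t. g (of_real e * cis t) * cis (- (real m * t)))) \<le> C * (2 * pi) * e ^ 0"
      by simp
  qed
next
  case (Suc k)
  let ?S = "ball 0 r :: complex set"
  have m: "model_set ?S" by (simp add: model_set_def)
  have g: "smooth_on g (?S \<inter> UNIV)" using Suc.prems by simp
  let ?A = "wirtinger_z ?S g" and ?B = "wirtinger_zbar ?S g"
  have sA: "smooth_on ?A ?S" and sB: "smooth_on ?B ?S"
    using smooth_on_wirtinger_z[OF g open_UNIV m] smooth_on_wirtinger_zbar[OF g open_UNIV m] by simp_all
  show ?case
  proof (intro allI impI)
    fix n :: nat assume n: "Suc k \<le> n"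
    then have "k \<le> n - 1" "k \<le> n + 1" by auto
    then obtain C1 C2 where
      C1: "\<forall>e\<in>{0<..\<rho>}. norm (integral {0..2 * pi} (\<lambda>t. ?A (of_real e * cis t) * cis (- (real (n - 1) * t)))) \<le> C1 * e ^ k" and
      C2: "\<forall>e\<in>{0<..\<rho>}. norm (integral {0..2 * pi} (\<lambda>t. ?B (of_real e * cis t) * cis (- (real (n + 1) * t)))) \<le> C2 * e ^ k"
      using Suc.IH[OF sA] Suc.IH[OF sB] by presburger
    show "\<exists>C. \<forall>e\<in>{0<..\<rho>}. norm (integral {0..2 * pi} (\<lambda>t. g (of_real e * cis t) * cis (- (real n * t)))) \<le> C * e ^ Suc k"
    proof (intro exI[of _ "C1 + C2"] ballI)
      fix e assume e: "e \<in> {0<..\<rho>}"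
      then have mem: "of_real e * cis t \<in> ?S" for t using assms by (simp add: norm_mult)
      let ?I1 = "\<lambda>t. ?A (of_real e * cis t) * cis (- (real (n - 1) * t))"
      let ?I2 = "\<lambda>t. ?B (of_real e * cis t) * cis (- (real (n + 1) * t))"
      let ?I = "\<lambda>t. g (of_real e * cis t) * cis (- (real n * t))"
      have int: "?I1 integrable_on {0..2 * pi}" "?I2 integrable_on {0..2 * pi}" "?I integrable_on {0..2 * pi}"
        by (intro integrable_continuous_real continuous_on_mult continuous_circle[OF smooth_on_continuous mem]
            sA sB Suc.prems continuous_on_cis continuous_intros)+
      have der: "(?I has_vector_derivative
          \<i> * of_real e * ?I1 t - \<i> * of_real e * ?I2 t - \<i> * of_nat n * ?I t) (at t within {0..2 * pi})" for t
      proof -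
        have cisd: "((\<lambda>t. cis (c * t)) has_vector_derivative (\<i> * of_real c * cis (c * t))) (at t within X)" for c X
          unfolding cis_conv_exp by (auto intro!: derivative_eq_intros has_vector_derivative_real_field simp: algebra_simps)
        have z: "((\<lambda>t. of_real e * cis t) has_vector_derivative (of_real e * (\<i> * cis t))) (at t within {0..2 * pi})"
          using cisd[of 1] by (auto intro!: derivative_eq_intros)
        have "has_wirtinger g (?A (of_real e * cis t)) (?B (of_real e * cis t)) (at (of_real e * cis t))"
          using has_wirtinger_smooth_on[OF g open_UNIV m, of "of_real e * cis t"] mem[of t]
          by (simp add: at_within_open[of _ ?S])
        from has_derivative_compose[OF z[unfolded has_vector_derivative_def] this[unfolded has_wirtinger_def]]
        have gd: "((\<lambda>t. g (of_real e * cis t)) has_vector_derivative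
            (?A (of_real e * cis t) * (of_real e * (\<i> * cis t)) + ?B (of_real e * cis t) * cnj (of_real e * (\<i> * cis t)))) (at t within {0..2 * pi})"
          by (simp add: has_vector_derivative_def scaleR_conv_of_real algebra_simps)
        have c1: "cis (- (real (n - 1) * t)) = cis t * cis (- (real n * t))"
          using n by (simp add: cis_mult of_nat_diff algebra_simps)
        have c2: "cis (- (real (n + 1) * t)) = cnj (cis t) * cis (- (real n * t))"
          by (simp add: cis_mult cis_cnj algebra_simps)
        have "((\<lambda>t. cis (- (real n * t))) has_vector_derivative (- \<i> * of_nat n * cis (- (real n * t)))) (at t within {0..2 * pi})"
          using cisd[of "- real n"] by simp
        from has_vector_derivative_mult[OF gd this] show ?thesis
          unfolding c1 c2 by (rule has_vector_derivative_eq_rhs) (simp add: algebra_simps)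
      qed
      have 1: "((\<lambda>t. \<i> * of_real e * ?I1 t - \<i> * of_real e * ?I2 t - \<i> * of_nat n * ?I t) has_integral
          (?I (2 * pi) - ?I 0)) {0..2 * pi}"
        by (rule fundamental_theorem_of_calculus) (use der in auto)
      have 2: "((\<lambda>t. \<i> * of_real e * ?I1 t - \<i> * of_real e * ?I2 t - \<i> * of_nat n * ?I t) has_integral
         (\<i> * of_real e * integral {0..2 * pi} ?I1 - \<i> * of_real e * integral {0..2 * pi} ?I2
           - \<i> * of_nat n * integral {0..2 * pi} ?I)) {0..2 * pi}"
        by (intro has_integral_diff has_integral_mult_right integrable_integral int)
      have "cis (- (real n * (2 * pi))) = 1"
        using cis_multiple_2pi[of "- real n"] by (simp add: algebra_simps)
      then have 3: "?I (2 * pi) - ?I 0 = 0" by simp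
      have "\<i> * (of_real e * (integral {0..2 * pi} ?I1 - integral {0..2 * pi} ?I2)
           - of_nat n * integral {0..2 * pi} ?I) = 0"
        using trans[OF has_integral_unique[OF 2 1] 3] by (simp only: right_diff_distrib mult.assoc)
      then have "of_real e * (integral {0..2 * pi} ?I1 - integral {0..2 * pi} ?I2)
           - of_nat n * integral {0..2 * pi} ?I = 0" by (simp only: mult_eq_0_iff complex_i_not_zero simp_thms)
      then have "of_nat n * integral {0..2 * pi} ?I = of_real e * (integral {0..2 * pi} ?I1 - integral {0..2 * pi} ?I2)"
        by (simp only: right_minus_eq)
      from arg_cong[OF this, of norm] have "real n * norm (integral {0..2 * pi} ?I) = e * norm (integral {0..2 * pi} ?I1 - integral {0..2 * pi} ?I2)"
        using e by (simp only: norm_mult norm_of_nat norm_of_real greaterThanAtMost_iff abs_of_pos)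
      also have "\<dots> \<le> e * (C1 * e ^ k + C2 * e ^ k)"
        using e C1 C2 by (intro mult_left_mono norm_triangle_le_diff add_mono) auto
      finally have "real n * norm (integral {0..2 * pi} ?I) \<le> (C1 + C2) * e ^ Suc k"
        by (simp add: algebra_simps)
      moreover have "norm (integral {0..2 * pi} ?I) \<le> real n * norm (integral {0..2 * pi} ?I)"
        using n by (intro mult_right_mono[of 1 "real n", simplified]) auto
      ultimately show "norm (integral {0..2 * pi} ?I) \<le> (C1 + C2) * e ^ Suc k" by linarith
    qed
  qed
qed

text \<open>On the circle of radius $\epsilon$ the form $g\,d\bar z/z^N$ integrates to
  $-i\epsilon^{1-N}$ times the Fourier coefficient of $g$ of frequency $N + 1$, which is
  $O(\epsilon^{N+1})$.\<close>

lemma circle_integral_dzbar_tendsto_0: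
  assumes g: "smooth_on g (ball 0 r)" and r: "0 < r" and v: "\<And>z. z \<in> ball 0 r - {0} \<Longrightarrow> v z = g z / z ^ N"
  shows "((\<lambda>e. integral {0..2 * pi} (\<lambda>t. v (of_real e * cis t) * cnj (\<i> * (of_real e * cis t)))) \<longlongrightarrow> 0) (at_right 0)"
proof -
  obtain C where C: "\<forall>e\<in>{0<..r / 2}. norm (integral {0..2 * pi}
    (\<lambda>t. g (of_real e * cis t) * cis (- (real (N + 1) * t)))) \<le> C * e ^ (N + 1)"
    using circle_fourier_decay[OF g, of "r / 2" "N + 1"] r by auto
  have bound: "norm (integral {0..2 * pi} (\<lambda>t. v (of_real e * cis t) * cnj (\<i> * (of_real e * cis t)))) \<le> C * e\<^sup>2"
    if e: "e \<in> {0<..r / 2}" for e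
  proof -
    have e0: "0 < e" "e < r" using e r by auto
    have "v (of_real e * cis t) * cnj (\<i> * (of_real e * cis t))
       = (- \<i> * of_real e / of_real e ^ N) * (g (of_real e * cis t) * cis (- (real (N + 1) * t)))" for t
    proof -
      have 1: "of_real e * cis t \<in> ball 0 r - {0}" using e0 by (simp add: norm_mult)
      have 2: "cis (- (real (N + 1) * t)) = cnj (cis t) / cis t ^ N"
      proof -
        have "- (real (N + 1) * t) = - t - real N * t" by (simp add: algebra_simps)
        then show ?thesis by (simp only: cis_cnj Complex.DeMoivre cis_divide)
      qed
      show ?thesis unfolding v[OF 1] 2 by (simp add: power_mult_distrib)
    qed
    then have "integral {0..2 * pi} (\<lambda>t. v (of_real e * cis t) * cnj (\<i> * (of_real e * cis t)))
      = (- \<i> * of_real e / of_real e ^ N) * integral {0..2 * pi} (\<lambda>t. g (of_real e * cis t) * cis (- (real (N + 1) * t)))"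
      by (simp only: integral_mult_right)
    then have "norm (integral {0..2 * pi} (\<lambda>t. v (of_real e * cis t) * cnj (\<i> * (of_real e * cis t))))
      = (e / e ^ N) * norm (integral {0..2 * pi} (\<lambda>t. g (of_real e * cis t) * cis (- (real (N + 1) * t))))"
      using e0 by (simp add: norm_mult norm_divide norm_power)
    also have "\<dots> \<le> (e / e ^ N) * (C * e ^ (N + 1))"
      using C e e0 by (intro mult_left_mono) auto
    also have "\<dots> = C * e\<^sup>2" using e0 by (simp add: power2_eq_square)
    finally show ?thesis .
  qed
  have "((\<lambda>e. C * e\<^sup>2) \<longlongrightarrow> C * 0\<^sup>2) (at_right 0)" by (intro tendsto_intros)
  then have z: "((\<lambda>e. C * e\<^sup>2) \<longlongrightarrow> 0) (at_right 0)" by simp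
  show ?thesis
  proof (rule Lim_null_comparison[OF _ z])
    show "\<forall>\<^sub>F e in at_right 0. norm (integral {0..2 * pi} (\<lambda>t. v (of_real e * cis t) * cnj (\<i> * (of_real e * cis t)))) \<le> C * e\<^sup>2"
      by (rule eventually_mono[OF eventually_at_right_real[of 0 "r / 2"]], use r in simp) (rule bound, simp)
  qed
qed

text \<open>The exponential map pulls the annulus $\epsilon \le |z| \le q$ back to a rectangle of height
  $2\pi$, where Green's formula applies. The horizontal edges cancel by periodicity, the forms
  vanish on the edge that maps to $|z| = q$, and the edge that is left is the circle
  $|z| = \epsilon$.\<close>

lemma annulus_stokes:
  fixes u v :: "complex \<Rightarrow> complex"
  assumes S: "open S" "ball 0 r \<subseteq> S" and r: "r' < r"
    and u: "smooth_on u (S \<inter> - {0})" and v: "smooth_on v (S \<inter> - {0})"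
    and zero: "\<And>z. z \<in> S - cball 0 r' \<Longrightarrow> u z = 0" "\<And>z. z \<in> S - cball 0 r' \<Longrightarrow> v z = 0"
    and e: "0 < e" "e < r'"
  shows "(LINT z:{z\<in>S. e < cmod z}|lborel. (wirtinger_z S v z - wirtinger_zbar S u z) * (- 2 * \<i>))
    = - integral {0..2 * pi} (\<lambda>t. u (of_real e * cis t) * (\<i> * (of_real e * cis t))
        + v (of_real e * cis t) * cnj (\<i> * (of_real e * cis t)))"
proof -
  let ?w = "\<lambda>z. (wirtinger_z S v z - wirtinger_zbar S u z) * (- 2 * \<i>)"
  \<comment> \<open>A radius beyond the support, with the closed disc of this radius still inside \<open>S\<close>.\<close>
  define q where "q = (r' + r) / 2"
  have q: "r' < q" "q < r" using r by (auto simp: q_def)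
  have mS: "model_set S" using S by (simp add: model_set_def)
  have o0: "open (- {0::complex})" by (simp add: open_Compl)
  define E where "E = exp -` (S \<inter> - {0})"
  have E: "open E" unfolding E_def using S by (intro open_vimage continuous_intros) (auto simp: open_Int o0)
  have mE: "model_set E" using E by (simp add: model_set_def)
  have mem_E: "w \<in> E \<longleftrightarrow> exp w \<in> S" for w by (simp add: E_def)
  have expE: "exp ` E \<subseteq> S \<inter> - {0}" by (auto simp: mem_E)
  let ?U = "\<lambda>w. u (exp w) * exp w" and ?V = "\<lambda>w. v (exp w) * cnj (exp w)"
  have hE: "exp holomorphic_on E" by (intro holomorphic_intros)
  have sexp: "smooth_on exp E" by (rule smooth_on_holomorphic[OF E hE])
  have sU: "smooth_on ?U (E \<inter> UNIV)" and sV: "smooth_on ?V (E \<inter> UNIV)"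
    using smooth_on_mult[OF smooth_on_compose_inner[OF u E hE subset_refl expE] sexp]
      smooth_on_mult[OF smooth_on_compose_inner[OF v E hE subset_refl expE] smooth_on_cnj[OF sexp]] by simp_all
  have eqw: "wirtinger_z E ?V w = wirtinger_z S v (exp w) * exp w * cnj (exp w)"
    "wirtinger_zbar E ?U w = wirtinger_zbar S u (exp w) * cnj (exp w) * exp w" if w: "w \<in> E" for w
  proof -
    have z: "exp w \<in> S \<inter> - {0}" using w by (simp add: mem_E)
    have ew: "has_wirtinger exp (exp w) 0 (at w within E)"
      by (intro has_wirtinger_field_derivative DERIV_subset[OF DERIV_exp]) simp
    have sub: "exp ` E \<subseteq> S" by (auto simp: mem_E)
    have d: "(exp has_field_derivative exp w) (at w within E)"
      by (intro DERIV_subset[OF DERIV_exp]) simp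
    have "has_wirtinger v (wirtinger_z S v (exp w)) (wirtinger_zbar S v (exp w)) (at (exp w) within S)"
      by (rule has_wirtinger_smooth_on[OF v o0 mS z])
    from has_wirtinger_mult[OF has_wirtinger_compose_inner[OF this d sub] has_wirtinger_cnj[OF ew]]
    show "wirtinger_z E ?V w = wirtinger_z S v (exp w) * exp w * cnj (exp w)"
      using has_wirtinger_imp_eq(1)[OF mE w] by simp
    have "has_wirtinger u (wirtinger_z S u (exp w)) (wirtinger_zbar S u (exp w)) (at (exp w) within S)"
      by (rule has_wirtinger_smooth_on[OF u o0 mS z])
    from has_wirtinger_mult[OF has_wirtinger_compose_inner[OF this d sub] ew]
    show "wirtinger_zbar E ?U w = wirtinger_zbar S u (exp w) * cnj (exp w) * exp w"
      using has_wirtinger_imp_eq(2)[OF mE w] by simp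
  qed
  have e0: "0 < q" "ln e < ln q" using e q by auto
  define R where "R = cbox (Complex (ln e) 0) (Complex (ln q) (2 * pi))"
  define B where "B = box (Complex (ln e) 0) (Complex (ln q) (2 * pi))"
  have Rnorm: "e \<le> cmod (exp w) \<and> cmod (exp w) \<le> q" if "w \<in> R" for w
    using that e e0 by (auto simp: R_def in_cbox_complex norm_exp_eq_Re ln_le_cancel_iff ln_ge_iff[symmetric])
      (metis e0(1) exp_le_cancel_iff exp_ln)
  have RE: "R \<subseteq> E"
  proof
    fix w assume "w \<in> R"
    then have "cmod (exp w) < r" using Rnorm q by fastforce
    then have "exp w \<in> S" using S by auto
    then show "w \<in> E" by (simp add: mem_E)
  qed
  have dR: "has_wirtinger ?U (wirtinger_z E ?U w) (wirtinger_zbar E ?U w) (at w within R)"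
    "has_wirtinger ?V (wirtinger_z E ?V w) (wirtinger_zbar E ?V w) (at w within R)" if "w \<in> R" for w
    using that RE
    by (auto intro!: has_wirtinger_subset[OF has_wirtinger_smooth_on[OF sU open_UNIV mE] RE]
      has_wirtinger_subset[OF has_wirtinger_smooth_on[OF sV open_UNIV mE] RE])
  have cR: "continuous_on R (wirtinger_z E ?U)" "continuous_on R (wirtinger_zbar E ?U)"
    "continuous_on R (wirtinger_z E ?V)" "continuous_on R (wirtinger_zbar E ?V)"
    using smooth_on_continuous[OF smooth_on_wirtinger_z[OF sU open_UNIV mE]]
      smooth_on_continuous[OF smooth_on_wirtinger_zbar[OF sU open_UNIV mE]]
      smooth_on_continuous[OF smooth_on_wirtinger_z[OF sV open_UNIV mE]]
      smooth_on_continuous[OF smooth_on_wirtinger_zbar[OF sV open_UNIV mE]]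
    by (auto intro: continuous_on_subset[OF _ RE])
  let ?k = "\<lambda>w. (wirtinger_z E ?V w - wirtinger_zbar E ?U w) * (- 2 * \<i>)"
  have k: "?k w = of_real ((cmod (deriv exp w))\<^sup>2) * ?w (exp w)" if "w \<in> E" for w
  proof -
    have "deriv exp w = exp w" by (rule DERIV_imp_deriv) (rule DERIV_exp)
    then have "of_real ((cmod (deriv exp w))\<^sup>2) = exp w * cnj (exp w)"
      using complex_norm_square[of "exp w"] by simp
    then show ?thesis unfolding eqw[OF that] by (simp only: algebra_simps)
  qed
  have edge': "exp (Complex (ln q) t) \<in> S - cball 0 r'" for t
  proof -
    have n: "cmod (exp (Complex (ln q) t)) = q" using e0 by (simp add: norm_exp_eq_Re)
    then have "exp (Complex (ln q) t) \<in> S" using q S by auto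
    with n show ?thesis using q by auto
  qed
  have edge: "u (exp (Complex (ln q) t)) = 0" "v (exp (Complex (ln q) t)) = 0" for t
    using zero(1)[OF edge'] zero(2)[OF edge'] .
  have ex: "exp (Complex (ln e) t) = of_real e * cis t" for t
    using e by (simp add: exp_eq_polar exp_of_real)
  have per: "exp (Complex x (2 * pi)) = exp (Complex x 0)" for x by (simp add: exp_eq_polar)
  have "(LINT w:R|lborel. ?k w) = integral {0..2 * pi} (\<lambda>t. \<i> * (?U (Complex (ln q) t) - ?V (Complex (ln q) t))
        - \<i> * (?U (Complex (ln e) t) - ?V (Complex (ln e) t)))
      - integral {ln e..ln q} (\<lambda>x. (?U (Complex x (2 * pi)) + ?V (Complex x (2 * pi)))
         - (?U (Complex x 0) + ?V (Complex x 0)))"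
    by (rule green_rectangle[OF _ _ R_def dR cR]) (use e0 in auto)
  also have "\<dots> = integral {0..2 * pi} (\<lambda>t. - (\<i> * (?U (Complex (ln e) t) - ?V (Complex (ln e) t))))"
    unfolding edge per by simp
  also have "\<dots> = - integral {0..2 * pi} (\<lambda>t. \<i> * (?U (Complex (ln e) t) - ?V (Complex (ln e) t)))"
    by (rule integral_neg)
  also have "(\<lambda>t. \<i> * (?U (Complex (ln e) t) - ?V (Complex (ln e) t)))
     = (\<lambda>t. u (of_real e * cis t) * (\<i> * (of_real e * cis t))
        + v (of_real e * cis t) * cnj (\<i> * (of_real e * cis t)))"
    unfolding ex by (simp add: fun_eq_iff algebra_simps)
  finally have green: "(LINT w:R|lborel. ?k w) = - integral {0..2 * pi} (\<lambda>t. u (of_real e * cis t) * (\<i> * (of_real e * cis t))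
        + v (of_real e * cis t) * cnj (\<i> * (of_real e * cis t)))" .
  \<comment> \<open>The open rectangle \<open>B\<close> maps injectively onto the annulus slit along the positive real axis, and
    the slit is a null set.\<close>
  have BR: "B \<subseteq> R" unfolding B_def R_def by (rule box_subset_cbox)
  have oB: "open B" by (simp add: B_def open_box)
  have hB: "exp holomorphic_on B" by (intro holomorphic_intros)
  have injB: "inj_on exp B"
  proof (rule inj_onI)
    fix x y assume xy: "x \<in> B" "y \<in> B" "exp x = exp y"
    then obtain n :: int where n: "x = y + (of_int (2 * n) * pi) * \<i>" by (auto simp: exp_eq)
    then have "Im x = Im y + 2 * pi * n" by simp
    moreover have "\<bar>Im x - Im y\<bar> < 2 * pi" using xy by (auto simp: B_def in_box_complex)
    ultimately have "\<bar>of_int n\<bar> < (1::real)" by (simp add: abs_mult)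
    then have "n = 0" by linarith
    then show "x = y" using n by simp
  qed
  have oexp: "open (exp ` B)" by (rule open_mapping_thm3[OF hB oB injB])
  have expS: "exp ` B \<subseteq> S \<inter> - {0}" using BR RE by (auto simp: mem_E)
  have cw: "continuous_on (S \<inter> - {0}) ?w"
    by (intro continuous_intros smooth_on_continuous[OF smooth_on_wirtinger_z[OF v o0 mS]]
      smooth_on_continuous[OF smooth_on_wirtinger_zbar[OF u o0 mS]])
  have m1: "(\<lambda>z. indicator (exp ` B) z *\<^sub>R ?w z) \<in> borel_measurable borel"
    by (rule borel_measurable_indicator_continuous[OF continuous_on_subset[OF cw expS]]) (use oexp in simp)
  let ?A = "{z\<in>S. e < cmod z}"
  have "open (S \<inter> {z. e < cmod z})" using S by (intro open_Int open_Collect_less continuous_intros)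
  then have oA: "open ?A" by (simp add: Int_def)
  have m2: "(\<lambda>z. indicator ?A z *\<^sub>R ?w z) \<in> borel_measurable borel"
    by (rule borel_measurable_indicator_continuous[OF continuous_on_subset[OF cw]]) (use oA e in auto)
  have w0: "?w z = 0" if "z \<in> S" "r' < cmod z" for z :: complex
  proof -
    have o: "open (- cball 0 r')" "z \<in> - cball 0 r'" using that by (auto simp: open_Compl)
    have "has_wirtinger u 0 0 (at z within S)" "has_wirtinger v 0 0 (at z within S)"
      using has_wirtinger_transform[OF has_wirtinger_const[of 0] o that(1), of u]
        has_wirtinger_transform[OF has_wirtinger_const[of 0] o that(1), of v] zero by auto
    then show ?thesis using has_wirtinger_imp_eq[OF mS that(1)] by simp
  qed
  have inA: "z \<in> exp ` B" if z: "Im z \<noteq> 0" "e < cmod z" "cmod z < q" for z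
  proof (rule image_eqI)
    let ?x = "Complex (ln (cmod z)) (Arg2pi z)"
    have "z \<noteq> 0" using z by auto
    then have "exp ?x = of_real (cmod z) * cis (Arg2pi z)" by (simp add: exp_eq_polar)
    also have "\<dots> = z" unfolding cis_conv_exp by (rule Arg2pi_eq[symmetric])
    finally show "z = exp ?x" by (rule sym)
    have "Arg2pi z \<noteq> 0"
      using z Arg2pi_eq_0[of z] complex_is_Real_iff by auto
    then have "0 < Arg2pi z" "Arg2pi z < 2 * pi" using Arg2pi_ge_0[of z] Arg2pi_lt_2pi[of z] by auto
    moreover have "0 < cmod z" using z e by linarith
    then have "ln e < ln (cmod z)" "ln (cmod z) < ln q" using z e e0 by simp_all
    ultimately show "?x \<in> B" by (auto simp: B_def in_box_complex)
  qed
  have outA: "e < cmod z \<and> cmod z < q" if "z \<in> exp ` B" for z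
  proof -
    from that obtain w where w: "w \<in> B" "z = exp w" by blast
    then have "exp (ln e) < cmod z \<and> cmod z < exp (ln q)" by (auto simp: B_def in_box_complex norm_exp_eq_Re)
    then show ?thesis using e e0 by simp
  qed
  have "(LINT z:?A|lborel. ?w z) = (LINT z:exp ` B|lborel. ?w z)"
    unfolding set_lebesgue_integral_def
  proof (rule integral_cong_AE)
    show "AE z in lborel. indicator ?A z *\<^sub>R ?w z = indicator (exp ` B) z *\<^sub>R ?w z"
      using AE_lborel_Im_nonzero
    proof eventually_elim
      case (elim z)
      show ?case
      proof (cases "cmod z < q")
        case True
        then have "z \<in> ?A \<longleftrightarrow> z \<in> exp ` B" using elim inA[of z] outA[of z] expS by blast
        then show ?thesis by (simp add: indicator_def)
      next
        case False
        then have "z \<notin> exp ` B" "z \<in> S \<longrightarrow> ?w z = 0" using outA[of z] w0[of z] q by auto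
        then show ?thesis by (auto simp: indicator_def)
      qed
    qed
  qed (use m1 m2 in simp_all)
  also have "\<dots> = (LINT w:B|lborel. of_real ((cmod (deriv exp w))\<^sup>2) * ?w (exp w))"
    by (rule holomorphic_change_of_variables(2)[OF oB hB injB m1, symmetric])
  also have "\<dots> = (LINT w:B|lborel. ?k w)"
    by (rule set_lebesgue_integral_cong) (use oB k BR RE in auto)
  also have "\<dots> = (LINT w:R|lborel. ?k w)"
    unfolding set_lebesgue_integral_def
  proof (rule integral_cong_AE)
    have ck: "continuous_on R ?k" by (intro continuous_intros cR)
    show "(\<lambda>w. indicator B w *\<^sub>R ?k w) \<in> borel_measurable lborel"
      using borel_measurable_indicator_continuous[OF continuous_on_subset[OF ck BR]] oB by simp
    show "(\<lambda>w. indicator R w *\<^sub>R ?k w) \<in> borel_measurable lborel"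
      using borel_measurable_indicator_continuous[OF ck] by (simp add: R_def)
    have "negligible (R - B)" unfolding R_def B_def by (rule negligible_frontier_interval)
    then have "R - B \<in> null_sets lebesgue" by (simp add: negligible_iff_null_sets)
    moreover have "R - B \<in> sets lborel" by (simp add: R_def B_def)
    ultimately have "R - B \<in> null_sets lborel" by (simp add: null_sets_completion_iff)
    from AE_not_in[OF this] show "AE w in lborel. indicator B w *\<^sub>R ?k w = indicator R w *\<^sub>R ?k w"
      by eventually_elim (use BR in \<open>auto simp: indicator_def\<close>)
  qed
  finally show ?thesis using green by simp
qed

section \<open>Charts, transition maps and forms on a Riemann surface\<close>

locale riemann =
  fixes X :: "'a topology" and A :: "'a chart set"
  assumes rs: "riemann_surface X A"
begin

lemma Hausdorff: "Hausdorff_space X"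
  using rs unfolding riemann_surface_def by (elim conjE)

lemma atlas_charts: "\<forall>c\<in>A. is_chart X c"
  using rs unfolding riemann_surface_def by (elim conjE)

lemma atlas_Union: "(\<Union>c\<in>A. fst c) = topspace X"
  using rs unfolding riemann_surface_def by (elim conjE)

lemma atlas_transitions: "\<forall>c\<in>A. \<forall>c'\<in>A. holomorphic_transition c c'"
  using rs unfolding riemann_surface_def by (elim conjE)

lemma chart: "c \<in> A \<Longrightarrow> is_chart X c"
  using atlas_charts by (rule bspec)

lemma atlas_covers: "x \<in> topspace X \<Longrightarrow> \<exists>c\<in>A. x \<in> fst c"
  unfolding atlas_Union[symmetric] by blast

lemma chart_open: "c \<in> A \<Longrightarrow> openin X (fst c)"
  using chart by (simp add: is_chart_def)

lemma chart_subset: "c \<in> A \<Longrightarrow> fst c \<subseteq> topspace X"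
  using chart_open openin_subset by blast

lemma chart_model: "c \<in> A \<Longrightarrow> model_set (chart_image c)"
  using chart by (simp add: is_chart_def model_set_def)

lemma chart_homeo: "c \<in> A \<Longrightarrow> homeomorphic_map (subtopology X (fst c)) (top_of_set (chart_image c)) (snd c)"
  using chart by (simp add: is_chart_def)

lemma topspace_chart: "c \<in> A \<Longrightarrow> topspace (subtopology X (fst c)) = fst c"
  using chart_subset[of c] by (simp add: topspace_subtopology Int_absorb1)

lemma chart_inj: "c \<in> A \<Longrightarrow> inj_on (snd c) (fst c)"
  using homeomorphic_imp_injective_map[OF chart_homeo] topspace_chart by metis

lemma chart_inv_left [simp]: "c \<in> A \<Longrightarrow> x \<in> fst c \<Longrightarrow> chart_inv c (snd c x) = x"
  by (simp add: chart_inv_def inv_into_f_f chart_inj)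

lemma chart_inv_right [simp]: "z \<in> chart_image c \<Longrightarrow> snd c (chart_inv c z) = z"
  by (simp add: chart_inv_def chart_image_def f_inv_into_f)

lemma chart_inv_in: "z \<in> chart_image c \<Longrightarrow> chart_inv c z \<in> fst c"
  by (simp add: chart_inv_def chart_image_def inv_into_into)

lemma chart_in_image: "x \<in> fst c \<Longrightarrow> snd c x \<in> chart_image c"
  by (simp add: chart_image_def)

lemma chart_open_image:
  assumes "c \<in> A" "openin X V"
  obtains T where "open T" "\<forall>x\<in>fst c. snd c x \<in> T \<longleftrightarrow> x \<in> V"
proof -
  have "open_map (subtopology X (fst c)) (top_of_set (chart_image c)) (snd c)"
    using homeomorphic_imp_open_map[OF chart_homeo[OF assms(1)]] .
  moreover have "openin (subtopology X (fst c)) (fst c \<inter> V)"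
    using assms chart_open by (metis openin_subtopology_Int2)
  ultimately have "openin (top_of_set (chart_image c)) (snd c ` (fst c \<inter> V))"
    by (simp add: open_map_def)
  then obtain T where T: "open T" "snd c ` (fst c \<inter> V) = chart_image c \<inter> T"
    by (auto simp: openin_open)
  have "\<forall>x\<in>fst c. snd c x \<in> T \<longleftrightarrow> x \<in> V"
  proof (intro ballI iffI)
    fix x assume x: "x \<in> fst c" "snd c x \<in> T"
    have "snd c x \<in> snd c ` (fst c \<inter> V)"
      unfolding T(2) using chart_in_image[OF x(1)] x(2) by (rule IntI)
    then obtain y where "y \<in> fst c \<inter> V" "snd c x = snd c y" by blast
    then show "x \<in> V" using chart_inj[OF assms(1)] x by (auto dest: inj_onD)
  next
    fix x assume x: "x \<in> fst c" "x \<in> V"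
    then have "snd c x \<in> snd c ` (fst c \<inter> V)" by (intro imageI IntI)
    then show "snd c x \<in> T" unfolding T(2) by (rule IntD2)
  qed
  with T(1) show ?thesis by (rule that)
qed

lemma chart_preimage_open:
  assumes "c \<in> A" "open T"
  shows "openin X {x \<in> fst c. snd c x \<in> T}"
proof -
  have "continuous_map (subtopology X (fst c)) (top_of_set (chart_image c)) (snd c)"
    using homeomorphic_imp_continuous_map[OF chart_homeo[OF assms(1)]] .
  then have "openin (subtopology X (fst c)) {x \<in> topspace (subtopology X (fst c)). snd c x \<in> chart_image c \<inter> T}"
    by (rule openin_continuous_map_preimage) (use assms in \<open>auto simp: openin_open\<close>)
  moreover have "{x \<in> topspace (subtopology X (fst c)). snd c x \<in> chart_image c \<inter> T} = {x \<in> fst c. snd c x \<in> T}"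
    unfolding topspace_chart[OF assms(1)] by (auto simp: chart_in_image)
  ultimately show ?thesis using openin_open_subtopology[OF chart_open[OF assms(1)]] by simp
qed

lemma closedin_chart_compact:
  assumes "c \<in> A" "compact K" "K \<subseteq> chart_image c"
  shows "closedin X (chart_inv c ` K)"
proof -
  obtain g where g: "homeomorphic_maps (subtopology X (fst c)) (top_of_set (chart_image c)) (snd c) g"
    using chart_homeo[OF assms(1)] by (auto simp: homeomorphic_map_maps)
  have gi: "g z = chart_inv c z" if "z \<in> chart_image c" for z
  proof -
    have "g z = g (snd c (chart_inv c z))" using that by simp
    also have "\<dots> = chart_inv c z"
      using g chart_inv_in[OF that] topspace_chart[OF assms(1)] by (auto simp: homeomorphic_maps_def)
    finally show ?thesis .
  qed
  have "continuous_map (top_of_set (chart_image c)) (subtopology X (fst c)) g"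
    using g by (simp add: homeomorphic_maps_def)
  moreover have "compactin (top_of_set (chart_image c)) K"
    using assms by (simp add: compactin_subtopology)
  ultimately have "compactin (subtopology X (fst c)) (g ` K)" by (rule image_compactin[rotated])
  then have "compactin X (g ` K)" by (simp add: compactin_subtopology)
  moreover have "g ` K = chart_inv c ` K" using gi assms(3) by (intro image_cong) auto
  ultimately have "compactin X (chart_inv c ` K)" by simp
  then show "closedin X (chart_inv c ` K)" by (rule compactin_imp_closedin[OF Hausdorff])
qed

lemma compact_chart_image:
  assumes "c \<in> A" "compactin X K" "K \<subseteq> fst c"
  shows "compact (snd c ` K)"
proof -
  have "continuous_map (subtopology X (fst c)) (top_of_set (chart_image c)) (snd c)"
    using homeomorphic_imp_continuous_map[OF chart_homeo[OF assms(1)]] .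
  moreover have "compactin (subtopology X (fst c)) K" using assms by (simp add: compactin_subtopology)
  ultimately have "compactin (top_of_set (chart_image c)) (snd c ` K)" by (rule image_compactin[rotated])
  then show ?thesis by (simp add: compactin_subtopology)
qed

lemma chart_image_minus:
  assumes "c \<in> A"
  shows "snd c ` (fst c - D) = chart_image c \<inter> - snd c ` (fst c \<inter> D)"
  using chart_inj[OF assms] by (auto simp: chart_image_def dest: inj_onD)

lemma mem_chart_image_minus:
  assumes "c \<in> A"
  shows "z \<in> snd c ` (fst c - D) \<longleftrightarrow> z \<in> chart_image c \<and> chart_inv c z \<notin> D"
proof
  assume "z \<in> snd c ` (fst c - D)"
  then show "z \<in> chart_image c \<and> chart_inv c z \<notin> D" using assms by (auto simp: chart_in_image)
next
  assume z: "z \<in> chart_image c \<and> chart_inv c z \<notin> D"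
  then have "z = snd c (chart_inv c z)" "chart_inv c z \<in> fst c - D" by (auto simp: chart_inv_in)
  then show "z \<in> snd c ` (fst c - D)" by (rule image_eqI)
qed

lemma open_Compl_finite_image: "finite D \<Longrightarrow> open (- snd c ` (fst c \<inter> D) :: complex set)"
  by (intro open_Compl finite_imp_closed finite_imageI finite_Int) simp

text \<open>A holomorphic extension of the transition map to an open set, whose ordinary derivative can be
  used at boundary points as well.\<close>

definition trans_ext :: "'a chart \<Rightarrow> 'a chart \<Rightarrow> complex set \<Rightarrow> (complex \<Rightarrow> complex) \<Rightarrow> bool" where
  "trans_ext c c' W g \<longleftrightarrow> open W \<and> transition_dom c c' \<subseteq> W \<and> g holomorphic_on W
     \<and> (\<forall>x\<in>fst c \<inter> fst c'. g (snd c x) = snd c' x)"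

lemma transition_dom_open:
  assumes "c \<in> A" "c' \<in> A"
  obtains T where "open T" "transition_dom c c' = chart_image c \<inter> T"
proof -
  obtain T where T: "open T" "\<forall>x\<in>fst c. snd c x \<in> T \<longleftrightarrow> x \<in> fst c'"
    using chart_open_image[OF assms(1) chart_open[OF assms(2)]] .
  have "transition_dom c c' = chart_image c \<inter> T"
    using T(2) by (auto simp: transition_dom_def chart_image_def)
  with T(1) show ?thesis by (rule that)
qed

lemma transition_dom_model: "c \<in> A \<Longrightarrow> c' \<in> A \<Longrightarrow> model_set (transition_dom c c')"
  by (metis chart_model model_set_Int transition_dom_open)

lemma transition_apply: "c \<in> A \<Longrightarrow> x \<in> fst c \<Longrightarrow> transition c c' (snd c x) = snd c' x"
  by (simp add: transition_def)

lemma trans_ext_exists: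
  assumes "c \<in> A" "c' \<in> A"
  obtains W g where "trans_ext c c' W g"
proof -
  have "holomorphic_transition c c'" using atlas_transitions assms by blast
  then obtain g where g: "g analytic_on transition_dom c c'"
    "\<forall>z\<in>transition_dom c c'. g z = transition c c' z" by (auto simp: holomorphic_transition_def)
  then obtain W where W: "open W" "transition_dom c c' \<subseteq> W" "g holomorphic_on W"
    by (auto simp: analytic_on_holomorphic)
  have "\<forall>x\<in>fst c \<inter> fst c'. g (snd c x) = snd c' x"
    using g(2) assms by (auto simp: transition_dom_def transition_apply)
  with W have "trans_ext c c' W g" by (simp add: trans_ext_def)
  then show ?thesis by (rule that)
qed

lemma trans_ext_deriv:
  assumes "trans_ext c c' W g" "x \<in> fst c \<inter> fst c'"
  shows "(g has_field_derivative deriv g (snd c x)) (at (snd c x) within V)"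
    and "snd c x \<in> W" and "g (snd c x) = snd c' x" and "snd c x \<in> transition_dom c c'"
proof -
  show T: "snd c x \<in> transition_dom c c'" using assms(2) by (auto simp: transition_dom_def)
  then show W: "snd c x \<in> W" using assms(1) by (auto simp: trans_ext_def)
  have "(g has_field_derivative deriv g (snd c x)) (at (snd c x))"
    using assms(1) W by (auto simp: trans_ext_def intro: holomorphic_derivI)
  then show "(g has_field_derivative deriv g (snd c x)) (at (snd c x) within V)"
    by (rule DERIV_subset) simp
  show "g (snd c x) = snd c' x" using assms by (auto simp: trans_ext_def)
qed

lemma transition_deriv:
  assumes c: "c \<in> A" and te: "trans_ext c c' W g" and x: "x \<in> fst c \<inter> fst c'"
  shows "(transition c c' has_field_derivative deriv g (snd c x)) (at (snd c x) within transition_dom c c')"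
proof -
  have eq: "transition c c' z = g z" if "z \<in> transition_dom c c'" for z
    using te c that by (auto simp: trans_ext_def transition_dom_def transition_apply)
  show ?thesis
    unfolding has_field_derivative_def
    by (rule has_derivative_transform[OF trans_ext_deriv(4)[OF te x] eq
          trans_ext_deriv(1)[OF te x, unfolded has_field_derivative_def]])
qed

lemma is_formD:
  assumes "is_form p q A D \<omega>" "c \<in> A" "c' \<in> A" "trans_ext c c' W g" "x \<in> fst c \<inter> fst c'" "x \<notin> D"
  shows "\<omega> c (snd c x) = \<omega> c' (snd c' x) * deriv g (snd c x) ^ p * cnj (deriv g (snd c x)) ^ q"
proof -
  have "x \<in> (fst c \<inter> fst c') - D" using assms by blast
  from assms(1)[unfolded is_form_def, rule_format, OF assms(2,3) this transition_deriv[OF assms(2,4,5)]]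
  show ?thesis .
qed

lemma is_formI:
  assumes "\<And>c c' W g x. c \<in> A \<Longrightarrow> c' \<in> A \<Longrightarrow> trans_ext c c' W g \<Longrightarrow> x \<in> fst c \<inter> fst c' \<Longrightarrow> x \<notin> D \<Longrightarrow>
    \<omega> c (snd c x) = \<omega> c' (snd c' x) * deriv g (snd c x) ^ p * cnj (deriv g (snd c x)) ^ q"
  shows "is_form p q A D \<omega>"
  unfolding is_form_def
proof (intro ballI allI impI)
  fix c c' x t
  assume c: "c \<in> A" "c' \<in> A" and x: "x \<in> fst c \<inter> fst c' - D"
    and t: "(transition c c' has_field_derivative t) (at (snd c x) within transition_dom c c')"
  obtain W g where te: "trans_ext c c' W g" using trans_ext_exists[OF c] .
  have x': "x \<in> fst c \<inter> fst c'" "x \<notin> D" using x by auto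
  have "t = deriv g (snd c x)"
    using has_wirtinger_unique(1)[OF transition_dom_model[OF c] trans_ext_deriv(4)[OF te x'(1)]
      has_wirtinger_field_derivative[OF t] has_wirtinger_field_derivative[OF transition_deriv[OF c(1) te x'(1)]]] .
  then show "\<omega> c (snd c x) = \<omega> c' (snd c' x) * t ^ p * cnj t ^ q"
    using assms[OF c te x'] by simp
qed

lemma smooth_form_offI:
  assumes "\<And>c c' W g x. c \<in> A \<Longrightarrow> c' \<in> A \<Longrightarrow> trans_ext c c' W g \<Longrightarrow> x \<in> fst c \<inter> fst c' \<Longrightarrow> x \<notin> D \<Longrightarrow>
    \<omega> c (snd c x) = \<omega> c' (snd c' x) * deriv g (snd c x) ^ p * cnj (deriv g (snd c x)) ^ q"
    and "\<And>c. c \<in> A \<Longrightarrow> smooth_on (\<omega> c) (snd c ` (fst c - D))"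
  shows "smooth_form_off p q A D \<omega>"
  unfolding smooth_form_off_def by (intro conjI ballI is_formI assms)

lemma smooth_form_offD:
  assumes "smooth_form_off p q A D \<omega>" "c \<in> A"
  shows "smooth_on (\<omega> c) (snd c ` (fst c - D))"
  using assms by (simp add: smooth_form_off_def)

lemma coefficient_wirtinger:
  assumes f: "smooth_on f (snd c ` (fst c - D))" and D: "finite D" and c: "c \<in> A"
  shows "\<And>x. x \<in> fst c - D \<Longrightarrow> has_wirtinger f (wirtinger_z (chart_image c) f (snd c x))
      (wirtinger_zbar (chart_image c) f (snd c x)) (at (snd c x) within chart_image c)"
    and "smooth_on (wirtinger_z (chart_image c) f) (snd c ` (fst c - D))"
    and "smooth_on (wirtinger_zbar (chart_image c) f) (snd c ` (fst c - D))"
proof -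
  note f' = f[unfolded chart_image_minus[OF c]]
  note o = open_Compl_finite_image[OF D, of c]
  note m = chart_model[OF c]
  show "has_wirtinger f (wirtinger_z (chart_image c) f (snd c x))
      (wirtinger_zbar (chart_image c) f (snd c x)) (at (snd c x) within chart_image c)" if "x \<in> fst c - D" for x
  proof (rule has_wirtinger_smooth_on[OF f' o m])
    show "snd c x \<in> chart_image c \<inter> - snd c ` (fst c \<inter> D)"
      using that unfolding chart_image_minus[OF c, symmetric] by (rule imageI)
  qed
  show "smooth_on (wirtinger_z (chart_image c) f) (snd c ` (fst c - D))"
    "smooth_on (wirtinger_zbar (chart_image c) f) (snd c ` (fst c - D))"
    unfolding chart_image_minus[OF c]
    using smooth_on_wirtinger_z[OF f' o m] smooth_on_wirtinger_zbar[OF f' o m] .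
qed

text \<open>The coefficients of a form in two charts differ by a factor $m$, a power of $g'$ or of
  $\overline{g'}$. For a $(0,1)$-form $m = \overline{g'}$ has $m_z = 0$, and for a $(1,0)$-form
  $m = g'$ has $m_{\bar z} = 0$; this is why $\partial$ of the former and $\bar\partial$ of the
  latter transform as $2$-forms.\<close>

lemma coefficient_chain_rule:
  assumes c: "c \<in> A" "c' \<in> A" and te: "trans_ext c c' W g" and D: "finite D"
    and f: "smooth_on f (snd c ` (fst c - D))" and f': "smooth_on f' (snd c' ` (fst c' - D))"
    and eq: "\<And>x. x \<in> fst c \<inter> fst c' \<Longrightarrow> x \<notin> D \<Longrightarrow> f (snd c x) = f' (snd c' x) * m (snd c x)"
    and x: "x \<in> fst c \<inter> fst c'" "x \<notin> D"
    and m: "has_wirtinger m mA mB (at (snd c x))"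
  shows "wirtinger_z (chart_image c) f (snd c x)
      = wirtinger_z (chart_image c') f' (snd c' x) * deriv g (snd c x) * m (snd c x) + f' (snd c' x) * mA"
    and "wirtinger_zbar (chart_image c) f (snd c x)
      = wirtinger_zbar (chart_image c') f' (snd c' x) * cnj (deriv g (snd c x)) * m (snd c x) + f' (snd c' x) * mB"
proof -
  let ?T = "transition_dom c c'" and ?z = "snd c x"
  have T: "?z \<in> ?T" and gz: "g ?z = snd c' x" using trans_ext_deriv[OF te x(1)] by auto
  have gT: "g ` ?T \<subseteq> chart_image c'"
    using te by (auto simp: transition_dom_def trans_ext_def chart_image_def)
  have TS: "?T \<subseteq> chart_image c" by (auto simp: transition_dom_def chart_image_def)
  have x': "x \<in> fst c - D" "x \<in> fst c' - D" using x by auto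
  have "has_wirtinger f' (wirtinger_z (chart_image c') f' (snd c' x)) (wirtinger_zbar (chart_image c') f' (snd c' x))
      (at (g ?z) within chart_image c')"
    using coefficient_wirtinger(1)[OF f' D c(2) x'(2)] gz by simp
  from has_wirtinger_mult[OF has_wirtinger_compose_inner[OF this trans_ext_deriv(1)[OF te x(1)] gT]
      has_wirtinger_subset[OF m subset_UNIV]]
  have h: "has_wirtinger (\<lambda>z. f' (g z) * m z)
     (wirtinger_z (chart_image c') f' (snd c' x) * deriv g ?z * m ?z + f' (g ?z) * mA)
     (wirtinger_zbar (chart_image c') f' (snd c' x) * cnj (deriv g ?z) * m ?z + f' (g ?z) * mB) (at ?z within ?T)" .
  have 1: "has_wirtinger f
     (wirtinger_z (chart_image c') f' (snd c' x) * deriv g ?z * m ?z + f' (g ?z) * mA)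
     (wirtinger_zbar (chart_image c') f' (snd c' x) * cnj (deriv g ?z) * m ?z + f' (g ?z) * mB) (at ?z within ?T)"
  proof (rule has_wirtinger_transform[OF h open_Compl_finite_image[OF D, of c]])
    show "?z \<in> - snd c ` (fst c \<inter> D)"
      using x x' chart_image_minus[OF c(1), of D] by blast
    show "?z \<in> ?T" by (rule T)
    fix w assume w: "w \<in> - snd c ` (fst c \<inter> D) \<inter> ?T"
    then obtain y where y: "y \<in> fst c \<inter> fst c'" "w = snd c y" by (auto simp: transition_dom_def)
    then have "y \<notin> D" using w by auto
    then show "f' (g w) * m w = f w" using eq[OF y(1)] y trans_ext_deriv(3)[OF te y(1)] by simp
  qed
  have 2: "has_wirtinger f (wirtinger_z (chart_image c) f ?z) (wirtinger_zbar (chart_image c) f ?z) (at ?z within ?T)"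
    by (rule has_wirtinger_subset[OF coefficient_wirtinger(1)[OF f D c(1) x'(1)] TS])
  show "wirtinger_z (chart_image c) f (snd c x)
      = wirtinger_z (chart_image c') f' (snd c' x) * deriv g (snd c x) * m (snd c x) + f' (snd c' x) * mA"
    "wirtinger_zbar (chart_image c) f (snd c x)
      = wirtinger_zbar (chart_image c') f' (snd c' x) * cnj (deriv g (snd c x)) * m (snd c x) + f' (snd c' x) * mB"
    using has_wirtinger_unique[OF transition_dom_model[OF c] T 2 1] gz by simp_all
qed

lemma trans_ext_deriv_wirtinger:
  assumes "trans_ext c c' W g" "x \<in> fst c \<inter> fst c'"
  shows "has_wirtinger (deriv g) (deriv (deriv g) (snd c x)) 0 (at (snd c x))"
    and "has_wirtinger (\<lambda>z. cnj (deriv g z)) 0 (cnj (deriv (deriv g) (snd c x))) (at (snd c x))"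
proof -
  have "deriv g holomorphic_on W" "open W" using assms by (auto simp: trans_ext_def intro: holomorphic_deriv)
  then have "(deriv g has_field_derivative deriv (deriv g) (snd c x)) (at (snd c x))"
    using trans_ext_deriv(2)[OF assms] by (auto intro: holomorphic_derivI)
  then show 1: "has_wirtinger (deriv g) (deriv (deriv g) (snd c x)) 0 (at (snd c x))"
    by (rule has_wirtinger_field_derivative)
  show "has_wirtinger (\<lambda>z. cnj (deriv g z)) 0 (cnj (deriv (deriv g) (snd c x))) (at (snd c x))"
    using has_wirtinger_cnj[OF 1] by simp
qed

lemma smooth_form_off_del_01:
  assumes b: "smooth_form_off 0 1 A D b" and D: "finite D"
  shows "smooth_form_off 1 1 A D (del_01 b)"
proof (rule smooth_form_offI)
  fix c c' W g x assume c: "c \<in> A" "c' \<in> A" and te: "trans_ext c c' W g" and x: "x \<in> fst c \<inter> fst c'" "x \<notin> D"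
  have "b c (snd c y) = b c' (snd c' y) * cnj (deriv g (snd c y))" if "y \<in> fst c \<inter> fst c'" "y \<notin> D" for y
    using is_formD[OF _ c te that, of 0 1 b] b by (simp add: smooth_form_off_def)
  from coefficient_chain_rule(1)[OF c te D smooth_form_offD[OF b c(1)] smooth_form_offD[OF b c(2)] this x
      trans_ext_deriv_wirtinger(2)[OF te x(1)]]
  show "del_01 b c (snd c x) = del_01 b c' (snd c' x) * deriv g (snd c x) ^ 1 * cnj (deriv g (snd c x)) ^ 1"
    by (simp add: del_01_def)
qed (use coefficient_wirtinger(2)[OF smooth_form_offD[OF b] D] in \<open>simp add: del_01_def\<close>)

lemma smooth_form_off_delbar_10:
  assumes b: "smooth_form_off 1 0 A D b" and D: "finite D"
  shows "smooth_form_off 1 1 A D (delbar_10 b)"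
proof (rule smooth_form_offI)
  fix c c' W g x assume c: "c \<in> A" "c' \<in> A" and te: "trans_ext c c' W g" and x: "x \<in> fst c \<inter> fst c'" "x \<notin> D"
  have "b c (snd c y) = b c' (snd c' y) * deriv g (snd c y)" if "y \<in> fst c \<inter> fst c'" "y \<notin> D" for y
    using is_formD[OF _ c te that, of 1 0 b] b by (simp add: smooth_form_off_def)
  from coefficient_chain_rule(2)[OF c te D smooth_form_offD[OF b c(1)] smooth_form_offD[OF b c(2)] this x
      trans_ext_deriv_wirtinger(1)[OF te x(1)]]
  show "delbar_10 b c (snd c x) = delbar_10 b c' (snd c' x) * deriv g (snd c x) ^ 1 * cnj (deriv g (snd c x)) ^ 1"
    by (simp add: delbar_10_def)
qed (use coefficient_wirtinger(3)[OF smooth_form_offD[OF b] D] in \<open>simp add: delbar_10_def smooth_on_minus\<close>)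

lemma smooth_form_off_delbar_00:
  assumes b: "smooth_form_off 0 0 A D b" and D: "finite D"
  shows "smooth_form_off 0 1 A D (\<lambda>c. wirtinger_zbar (chart_image c) (b c))"
proof (rule smooth_form_offI)
  fix c c' W g x assume c: "c \<in> A" "c' \<in> A" and te: "trans_ext c c' W g" and x: "x \<in> fst c \<inter> fst c'" "x \<notin> D"
  have "b c (snd c y) = b c' (snd c' y) * 1" if "y \<in> fst c \<inter> fst c'" "y \<notin> D" for y
    using is_formD[OF _ c te that, of 0 0 b] b by (simp add: smooth_form_off_def)
  from coefficient_chain_rule(2)[OF c te D smooth_form_offD[OF b c(1)] smooth_form_offD[OF b c(2)] this x
      has_wirtinger_const[of 1]]
  show "wirtinger_zbar (chart_image c) (b c) (snd c x) = wirtinger_zbar (chart_image c') (b c') (snd c' x)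
      * deriv g (snd c x) ^ 0 * cnj (deriv g (snd c x)) ^ 1" by simp
qed (use coefficient_wirtinger(3)[OF smooth_form_offD[OF b] D] in simp)

lemma smooth_form_off_add:
  assumes "smooth_form_off p q A D a" "smooth_form_off p q A D b"
  shows "smooth_form_off p q A D (\<lambda>c z. a c z + b c z)"
proof (rule smooth_form_offI)
  fix c c' W g x assume *: "c \<in> A" "c' \<in> A" "trans_ext c c' W g" "x \<in> fst c \<inter> fst c'" "x \<notin> D"
  have "is_form p q A D a" "is_form p q A D b" using assms by (auto simp: smooth_form_off_def)
  from is_formD[OF this(1) *] is_formD[OF this(2) *]
  show "a c (snd c x) + b c (snd c x) = (a c' (snd c' x) + b c' (snd c' x)) * deriv g (snd c x) ^ p * cnj (deriv g (snd c x)) ^ q"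
    by (simp add: algebra_simps)
qed (use assms smooth_form_offD in \<open>auto intro: smooth_on_add\<close>)

lemma smooth_form_off_minus:
  assumes "smooth_form_off p q A D a"
  shows "smooth_form_off p q A D (\<lambda>c z. - a c z)"
proof (rule smooth_form_offI)
  fix c c' W g x assume *: "c \<in> A" "c' \<in> A" "trans_ext c c' W g" "x \<in> fst c \<inter> fst c'" "x \<notin> D"
  have "is_form p q A D a" using assms by (auto simp: smooth_form_off_def)
  from is_formD[OF this(1) *]
  show "- a c (snd c x) = (- a c' (snd c' x)) * deriv g (snd c x) ^ p * cnj (deriv g (snd c x)) ^ q"
    by (simp add: algebra_simps)
qed (use assms smooth_form_offD in \<open>auto intro: smooth_on_minus\<close>)

lemma smooth_form_off_ext_d:
  assumes "smooth_form_off 1 0 A D a" "smooth_form_off 0 1 A D b" "finite D"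
  shows "smooth_form_off 1 1 A D (ext_d (a, b))"
  using smooth_form_off_add[OF smooth_form_off_delbar_10 smooth_form_off_del_01] assms
  by (simp add: ext_d_def)

text \<open>Functions on the surface are viewed as \<open>(0,0)\<close>-forms, so that cutoff functions and partitions of
  unity can be treated with the calculus of forms.\<close>

definition scalar :: "('a \<Rightarrow> complex) \<Rightarrow> 'a form" where
  "scalar s = (\<lambda>c z. s (chart_inv c z))"

definition smooth_off :: "'a set \<Rightarrow> ('a \<Rightarrow> complex) \<Rightarrow> bool" where
  "smooth_off D s \<longleftrightarrow> (\<forall>c\<in>A. smooth_on (scalar s c) (snd c ` (fst c - D)))"

lemma scalar_apply [simp]: "c \<in> A \<Longrightarrow> x \<in> fst c \<Longrightarrow> scalar s c (snd c x) = s x"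
  by (simp add: scalar_def)

lemma smooth_off_form: "smooth_off D s \<Longrightarrow> smooth_form_off 0 0 A D (scalar s)"
  by (rule smooth_form_offI) (auto simp: smooth_off_def)

lemma smooth_off_subset:
  assumes "smooth_off D s" "D \<subseteq> D'" shows "smooth_off D' s"
  unfolding smooth_off_def
proof
  fix c assume "c \<in> A"
  with assms(1) have "smooth_on (scalar s c) (snd c ` (fst c - D))" by (simp add: smooth_off_def)
  then show "smooth_on (scalar s c) (snd c ` (fst c - D'))"
    by (rule smooth_on_subset) (use assms(2) in blast)
qed

lemma smooth_form_off_scale:
  assumes "smooth_off D s" "smooth_form_off p q A D a"
  shows "smooth_form_off p q A D (\<lambda>c z. scalar s c z * a c z)"
proof (rule smooth_form_offI)
  fix c c' W g x assume *: "c \<in> A" "c' \<in> A" "trans_ext c c' W g" "x \<in> fst c \<inter> fst c'" "x \<notin> D"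
  have "is_form p q A D a" using assms by (auto simp: smooth_form_off_def)
  from is_formD[OF this(1) *] *
  show "scalar s c (snd c x) * a c (snd c x) = (scalar s c' (snd c' x) * a c' (snd c' x)) * deriv g (snd c x) ^ p * cnj (deriv g (snd c x)) ^ q"
    by (simp add: algebra_simps)
qed (use assms smooth_form_offD in \<open>auto intro: smooth_on_mult simp: smooth_off_def\<close>)

text \<open>Where the form is singular the factor vanishes identically, so that the product extends
  smoothly by zero.\<close>

lemma smooth_form_off_scale_cut:
  assumes s: "smooth_off {} s" and a: "smooth_form_off p q A D a"
    and N: "openin X N" "D \<subseteq> N" "\<forall>x\<in>N. s x = 0" and D: "finite D"
  shows "smooth_form_off p q A {} (\<lambda>c z. scalar s c z * a c z)"
proof (rule smooth_form_offI)
  fix c c' W g x assume *: "c \<in> A" "c' \<in> A" "trans_ext c c' W g" "x \<in> fst c \<inter> fst c'"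
  show "scalar s c (snd c x) * a c (snd c x) = (scalar s c' (snd c' x) * a c' (snd c' x)) * deriv g (snd c x) ^ p * cnj (deriv g (snd c x)) ^ q"
  proof (cases "x \<in> D")
    case True
    then show ?thesis using * N by auto
  next
    case False
    have "is_form p q A D a" using a by (auto simp: smooth_form_off_def)
    from is_formD[OF this(1) * False] * show ?thesis by (simp add: algebra_simps)
  qed
next
  fix c assume c: "c \<in> A"
  obtain T where T: "open T" "\<forall>x\<in>fst c. snd c x \<in> T \<longleftrightarrow> x \<in> N" using chart_open_image[OF c N(1)] .
  show "smooth_on (\<lambda>z. scalar s c z * a c z) (snd c ` (fst c - {}))"
  proof (rule smooth_on_local)
    fix z assume "z \<in> snd c ` (fst c - {})"
    then obtain x where x: "x \<in> fst c" "z = snd c x" by auto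
    show "\<exists>T. open T \<and> z \<in> T \<and> smooth_on (\<lambda>z. scalar s c z * a c z) (snd c ` (fst c - {}) \<inter> T)"
    proof (cases "x \<in> N")
      case True
      have "smooth_on (\<lambda>z. scalar s c z * a c z) (snd c ` (fst c - {}) \<inter> T)"
        by (rule smooth_on_cong[OF smooth_on_const[of 0]]) (use T(2) N(3) c in auto)
      then show ?thesis using T x True by blast
    next
      case False
      have "smooth_on (\<lambda>z. scalar s c z * a c z) (snd c ` (fst c - D))"
        using smooth_off_subset[OF s, of D] smooth_form_offD[OF a c] c
        by (auto intro!: smooth_on_mult simp: smooth_off_def)
      then have "smooth_on (\<lambda>z. scalar s c z * a c z) (snd c ` (fst c - {}) \<inter> - snd c ` (fst c \<inter> D))"
        unfolding chart_image_minus[OF c] by (simp add: chart_image_def)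
      moreover have "z \<in> snd c ` (fst c - D)" using x False N(2) by blast
      then have "z \<in> - snd c ` (fst c \<inter> D)" unfolding chart_image_minus[OF c] by blast
      ultimately show ?thesis using open_Compl_finite_image[OF D, of c] by blast
    qed
  qed
qed

end

section \<open>Integrals in different charts\<close>

lemma set_lebesgue_AE_eq:
  fixes f g :: "complex \<Rightarrow> complex"
  assumes "(\<lambda>z. indicator S z *\<^sub>R f z) \<in> borel_measurable borel"
    and "(\<lambda>z. indicator T z *\<^sub>R g z) \<in> borel_measurable borel"
    and "AE z in lborel. indicator S z *\<^sub>R f z = indicator T z *\<^sub>R g z"
  shows "set_integrable lborel S f \<longleftrightarrow> set_integrable lborel T g"
    and "(LINT z:S|lborel. f z) = (LINT z:T|lborel. g z)"
  unfolding set_integrable_def set_lebesgue_integral_def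
  by (rule integrable_cong_AE, use assms in simp_all) (rule integral_cong_AE, use assms in simp_all)

lemma AE_not_in_finite: "finite P \<Longrightarrow> AE z in (lborel :: complex measure). z \<notin> P"
  by (rule AE_not_in[OF finite_imp_null_set_lborel])

lemma model_set_borel: "model_set S \<Longrightarrow> S \<in> sets borel"
proof -
  assume "model_set S"
  then consider "open S" | T where "open T" "S = half_plane \<inter> T"
    by (auto simp: model_set_def openin_open)
  then show ?thesis
  proof cases
    case 2
    have "closed half_plane" unfolding half_plane_def by (rule closed_halfspace_Im_ge)
    with 2 show ?thesis by (auto intro: borel_closed borel_open)
  qed simp
qed

lemma model_set_interior:
  assumes "model_set S" "z \<in> S" "Im z \<noteq> 0" shows "z \<in> interior S"
proof -
  from assms(1) consider "open S" | T where "open T" "S = half_plane \<inter> T"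
    by (auto simp: model_set_def openin_open)
  then show ?thesis
  proof cases
    case 1 then show ?thesis using assms by (simp add: interior_open)
  next
    case 2
    have "open ({w. 0 < Im w} \<inter> T)" using 2 by (intro open_Int open_halfspace_Im_gt)
    moreover have "{w. 0 < Im w} \<inter> T \<subseteq> S" using 2 by (auto simp: half_plane_def)
    moreover have "z \<in> {w. 0 < Im w} \<inter> T" using assms 2 by (auto simp: half_plane_def)
    ultimately show ?thesis by (auto simp: interior_def)
  qed
qed

lemma model_set_compact_nbhd:
  assumes "model_set S" "z \<in> S"
  obtains r where "r > 0" "compact (cball z r \<inter> S)"
proof -
  obtain H where H: "closed H" "openin (top_of_set H) S"
  proof (cases "open S")
    case True then show ?thesis by (intro that[of UNIV]) auto
  next
    case False
    have "closed half_plane" unfolding half_plane_def by (rule closed_halfspace_Im_ge)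
    then show ?thesis using False assms by (intro that[of half_plane]) (auto simp: model_set_def)
  qed
  obtain T where T: "open T" "S = H \<inter> T" using H(2) by (auto simp: openin_open)
  then obtain r where r: "r > 0" "cball z r \<subseteq> T" using assms by (auto simp: open_contains_cball)
  then have "cball z r \<inter> S = cball z r \<inter> H" using T by auto
  moreover have "compact (cball z r \<inter> H)" using H(1) by (intro compact_Int_closed compact_cball)
  ultimately show ?thesis using r(1) that by simp
qed

context riemann
begin

definition chart_ext :: "'a chart \<Rightarrow> (complex \<Rightarrow> complex) \<Rightarrow> 'a \<Rightarrow> complex" where
  "chart_ext c u x = (if x \<in> fst c then u (snd c x) else 0)"

text \<open>The image of the support in the surface is compact, hence closed in the Hausdorff space \<open>X\<close>; so
  a point outside the chart has a neighbourhood on which the extension vanishes.\<close>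

lemma smooth_off_chart_ext:
  assumes c: "c \<in> A" and K: "compact K" "K \<subseteq> chart_image c" "\<And>z. z \<in> chart_image c - K \<Longrightarrow> u z = 0"
    and u: "smooth_on u (snd c ` (fst c - D))"
  shows "smooth_off D (chart_ext c u)"
  unfolding smooth_off_def
proof (rule ballI, rule smooth_on_local)
  fix c' z assume c': "c' \<in> A" and "z \<in> snd c' ` (fst c' - D)"
  then obtain x where x: "x \<in> fst c'" "x \<notin> D" "z = snd c' x" by auto
  show "\<exists>T. open T \<and> z \<in> T \<and> smooth_on (scalar (chart_ext c u) c') (snd c' ` (fst c' - D) \<inter> T)"
  proof (cases "x \<in> fst c")
    case True
    obtain W g where te: "trans_ext c' c W g" using trans_ext_exists[OF c' c] .
    obtain T where T: "open T" "\<forall>y\<in>fst c'. snd c' y \<in> T \<longleftrightarrow> y \<in> fst c"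
      using chart_open_image[OF c' chart_open[OF c]] .
    let ?S = "snd c' ` (fst c' - D) \<inter> T"
    have S: "\<exists>y. y \<in> fst c' \<inter> fst c \<and> y \<notin> D \<and> w = snd c' y" if "w \<in> ?S" for w
      using that T(2) by auto
    have "smooth_on (\<lambda>w. u (g w)) ?S"
    proof (rule smooth_on_compose_inner[OF u])
      show "open W" "g holomorphic_on W" using te by (auto simp: trans_ext_def)
      show "?S \<subseteq> W"
      proof
        fix w assume "w \<in> ?S"
        then obtain y where "y \<in> fst c' \<inter> fst c" "w = snd c' y" using S by blast
        then show "w \<in> W" using trans_ext_deriv(2)[OF te] by auto
      qed
      show "g ` ?S \<subseteq> snd c ` (fst c - D)"
      proof (rule image_subsetI)
        fix w assume "w \<in> ?S"
        then obtain y where "y \<in> fst c' \<inter> fst c" "y \<notin> D" "w = snd c' y" using S by blast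
        then show "g w \<in> snd c ` (fst c - D)" using trans_ext_deriv(3)[OF te] by auto
      qed
    qed
    then have "smooth_on (scalar (chart_ext c u) c') ?S"
    proof (rule smooth_on_cong)
      fix w assume "w \<in> ?S"
      then obtain y where "y \<in> fst c' \<inter> fst c" "y \<notin> D" "w = snd c' y" using S by blast
      then show "u (g w) = scalar (chart_ext c u) c' w"
        using trans_ext_deriv(3)[OF te] c' by (simp add: chart_ext_def)
    qed
    moreover have "z \<in> T" using T(2) x True by simp
    ultimately show ?thesis using T(1) by (intro exI[of _ T]) simp
  next
    case False
    let ?V = "topspace X - chart_inv c ` K"
    have V: "openin X ?V" using closedin_chart_compact[OF c K(1,2)] by (simp add: openin_diff)
    obtain T where T: "open T" "\<forall>y\<in>fst c'. snd c' y \<in> T \<longleftrightarrow> y \<in> ?V"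
      using chart_open_image[OF c' V] .
    have "x \<notin> chart_inv c ` K" using False K(2) chart_inv_in by blast
    then have "z \<in> T" using T(2) x chart_subset[OF c'] by auto
    moreover have "smooth_on (scalar (chart_ext c u) c') (snd c' ` (fst c' - D) \<inter> T)"
    proof (rule smooth_on_cong[OF smooth_on_const[of 0]])
      fix w assume "w \<in> snd c' ` (fst c' - D) \<inter> T"
      then obtain y where y: "y \<in> fst c'" "y \<in> ?V" "w = snd c' y" using T(2) by auto
      have "chart_ext c u y = 0"
      proof (cases "y \<in> fst c")
        case True
        then have "snd c y \<notin> K" using y(2) c by (auto intro: image_eqI[of _ _ "snd c y"])
        then show ?thesis using True K(3) chart_in_image[OF True] by (simp add: chart_ext_def)
      qed (simp add: chart_ext_def)
      then show "0 = scalar (chart_ext c u) c' w" using y c' by simp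
    qed
    ultimately show ?thesis using T(1) by (intro exI[of _ T]) simp
  qed
qed

lemma chart_ext_zero:
  assumes "c \<in> A" "\<And>z. z \<in> chart_image c - K \<Longrightarrow> u z = 0" "x \<notin> chart_inv c ` K"
  shows "chart_ext c u x = 0"
proof (cases "x \<in> fst c")
  case True
  then have "snd c x \<notin> K" using assms(1,3) by (auto intro: image_eqI[of _ _ "snd c x"])
  then show ?thesis using True assms(2) chart_in_image[OF True] by (simp add: chart_ext_def)
qed (simp add: chart_ext_def)

definition patch :: "'a chart \<Rightarrow> 'a set \<Rightarrow> complex set" where
  "patch c V = snd c ` (fst c \<inter> V)"

lemma patch_subset: "patch c V \<subseteq> chart_image c"
  by (auto simp: patch_def chart_image_def)

lemma patch_model:
  assumes "c \<in> A" "openin X V" shows "model_set (patch c V)"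
proof -
  obtain T where T: "open T" "\<forall>y\<in>fst c. snd c y \<in> T \<longleftrightarrow> y \<in> V"
    using chart_open_image[OF assms] .
  then have "patch c V = chart_image c \<inter> T" by (auto simp: patch_def chart_image_def)
  then show ?thesis using model_set_Int[OF chart_model[OF assms(1)] T(1)] by simp
qed

lemma trans_ext_inj: "c \<in> A \<Longrightarrow> c' \<in> A \<Longrightarrow> trans_ext c c' W g \<Longrightarrow> inj_on g (transition_dom c c')"
proof (rule inj_onI)
  fix z w assume *: "c \<in> A" "c' \<in> A" "trans_ext c c' W g" "z \<in> transition_dom c c'" "w \<in> transition_dom c c'" "g z = g w"
  then obtain x y where xy: "x \<in> fst c \<inter> fst c'" "z = snd c x" "y \<in> fst c \<inter> fst c'" "w = snd c y"
    by (auto simp: transition_dom_def)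
  then have "snd c' x = snd c' y" using * trans_ext_deriv(3)[OF *(3)] by metis
  then have "x = y" using xy chart_inj[OF *(2)] by (auto dest: inj_onD)
  then show "z = w" using xy by simp
qed

lemma trans_ext_patch:
  assumes c: "c \<in> A" "c' \<in> A" and te: "trans_ext c c' W g" and V: "V \<subseteq> fst c \<inter> fst c'"
  shows "g ` patch c V \<subseteq> patch c' V" "patch c V \<subseteq> transition_dom c c'" "patch c V \<subseteq> W"
proof -
  show T: "patch c V \<subseteq> transition_dom c c'" using V by (auto simp: patch_def transition_dom_def)
  then show "patch c V \<subseteq> W" using te by (auto simp: trans_ext_def)
  show "g ` patch c V \<subseteq> patch c' V"
  proof (rule image_subsetI)
    fix w assume "w \<in> patch c V"
    then obtain x where x: "x \<in> V" "x \<in> fst c" "w = snd c x" by (auto simp: patch_def)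
    then have "g w = snd c' x" using trans_ext_deriv(3)[OF te, of x] V by auto
    then show "g w \<in> patch c' V" using x V by (auto simp: patch_def)
  qed
qed

lemma trans_ext_open_image:
  assumes c: "c \<in> A" "c' \<in> A" and te: "trans_ext c c' W g" and V: "V \<subseteq> fst c \<inter> fst c'"
  shows "open (g ` interior (patch c V))" "g holomorphic_on interior (patch c V)" "inj_on g (interior (patch c V))"
proof -
  have s: "interior (patch c V) \<subseteq> transition_dom c c'" "interior (patch c V) \<subseteq> W"
    using trans_ext_patch(2,3)[OF c te V] interior_subset by blast+
  show h: "g holomorphic_on interior (patch c V)"
    using te s(2) by (auto simp: trans_ext_def intro: holomorphic_on_subset)
  show i: "inj_on g (interior (patch c V))" using trans_ext_inj[OF c te] s(1) by (rule inj_on_subset)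
  show "open (g ` interior (patch c V))" by (rule open_mapping_thm3[OF h open_interior i])
qed

text \<open>Holomorphic injections are open, so a transition map and its inverse preserve interior points.\<close>

lemma trans_ext_interior:
  assumes c: "c \<in> A" "c' \<in> A" and te: "trans_ext c c' W g" and V: "V \<subseteq> fst c \<inter> fst c'"
  shows "g ` interior (patch c V) = interior (patch c' V)"
proof
  have le: "g ` interior (patch c V) \<subseteq> interior (patch c' V)"
    if c: "c \<in> A" "c' \<in> A" and te: "trans_ext c c' W g" and V: "V \<subseteq> fst c \<inter> fst c'" for c c' W g
    using trans_ext_open_image(1)[OF c te V] trans_ext_patch(1)[OF c te V] interior_subset[of "patch c V"]
    by (intro interior_maximal) auto
  show "g ` interior (patch c V) \<subseteq> interior (patch c' V)" by (rule le[OF c te V])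
  obtain W' g' where te': "trans_ext c' c W' g'" using trans_ext_exists[OF c(2,1)] .
  have V': "V \<subseteq> fst c' \<inter> fst c" using V by blast
  show "interior (patch c' V) \<subseteq> g ` interior (patch c V)"
  proof
    fix w assume w: "w \<in> interior (patch c' V)"
    then have "w \<in> patch c' V" using interior_subset by blast
    then obtain x where x: "x \<in> V" "x \<in> fst c'" "w = snd c' x" by (auto simp: patch_def)
    then have "g (g' w) = w"
      using trans_ext_deriv(3)[OF te', of x] trans_ext_deriv(3)[OF te, of x] V by auto
    moreover have "g' w \<in> interior (patch c V)" using le[OF c(2,1) te' V'] w by blast
    ultimately show "w \<in> g ` interior (patch c V)" by (intro image_eqI[of _ _ "g' w"]) simp_all
  qed
qed

lemma coefficient_measurable:
  assumes c: "c \<in> A" and D: "finite D" and f: "smooth_on f (snd c ` (fst c - D))"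
    and T: "T \<in> sets borel" "T \<subseteq> chart_image c"
  shows "(\<lambda>z. indicator T z *\<^sub>R (f z * k)) \<in> borel_measurable borel"
proof -
  let ?P = "snd c ` (fst c \<inter> D)"
  have P: "finite ?P" using D by simp
  have "T - ?P \<subseteq> snd c ` (fst c - D)" unfolding chart_image_minus[OF c] using T(2) by blast
  then have "continuous_on (T - ?P) f" using smooth_on_continuous[OF f] continuous_on_subset by blast
  then have "continuous_on (T - ?P) (\<lambda>z. f z * k)" by (intro continuous_intros)
  then have m: "(\<lambda>z. indicator (T - ?P) z *\<^sub>R (f z * k)) \<in> borel_measurable borel"
    using T(1) P by (intro borel_measurable_indicator_continuous) (auto intro: borel_closed finite_imp_closed)
  show ?thesis
    by (rule measurable_discrete_difference[OF m countable_finite[OF P]]) (auto simp: indicator_def)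
qed

text \<open>The coefficient of a \<open>(1,1)\<close>-form picks up the factor $|g'|^2$, which is also the Jacobian of the
  transition map. The formula for open sets applies to the interiors of the patches; what is left
  of a patch lies on the real line and is a null set, just as the finitely many singular points.\<close>

lemma chart_change_integral:
  assumes c: "c \<in> A" "c' \<in> A" and D: "finite D" and \<omega>: "smooth_form_off 1 1 A D \<omega>"
    and V: "openin X V" "V \<subseteq> fst c \<inter> fst c'"
  shows "set_integrable lborel (patch c V) (\<lambda>z. \<omega> c z * k) \<longleftrightarrow> set_integrable lborel (patch c' V) (\<lambda>z. \<omega> c' z * k)"
    and "(LINT z:patch c V|lborel. \<omega> c z * k) = (LINT z:patch c' V|lborel. \<omega> c' z * k)"
proof -
  obtain W g where te: "trans_ext c c' W g" using trans_ext_exists[OF c] .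
  let ?I = "interior (patch c V)" and ?I' = "interior (patch c' V)"
  note op = trans_ext_open_image[OF c te V(2)]
  have gI: "g ` ?I = ?I'" by (rule trans_ext_interior[OF c te V(2)])
  have m: "(\<lambda>z. indicator (patch e V) z *\<^sub>R (\<omega> e z * k)) \<in> borel_measurable borel"
    "(\<lambda>z. indicator (interior (patch e V)) z *\<^sub>R (\<omega> e z * k)) \<in> borel_measurable borel" if e: "e \<in> A" for e
    using coefficient_measurable[OF e D smooth_form_offD[OF \<omega> e] model_set_borel[OF patch_model[OF e V(1)]] patch_subset]
      coefficient_measurable[OF e D smooth_form_offD[OF \<omega> e], of "interior (patch e V)"]
      interior_subset[of "patch e V"] patch_subset[of e V] by auto
  have ae: "AE z in lborel. indicator (patch e V) z *\<^sub>R (\<omega> e z * k) = indicator (interior (patch e V)) z *\<^sub>R (\<omega> e z * k)"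
    if e: "e \<in> A" for e
    using AE_lborel_Im_nonzero
  proof eventually_elim
    case (elim z)
    have "z \<in> patch e V \<longleftrightarrow> z \<in> interior (patch e V)"
      using model_set_interior[OF patch_model[OF e V(1)] _ elim] interior_subset[of "patch e V"] by blast
    then show ?case by (simp add: indicator_def)
  qed
  note 1 = set_lebesgue_AE_eq[OF m[OF c(1)] ae[OF c(1)]]
  note 2 = set_lebesgue_AE_eq[OF m[OF c(2)] ae[OF c(2)]]
  let ?h = "\<lambda>z. of_real ((cmod (deriv g z))\<^sup>2) * (\<omega> c' (g z) * k)"
  have eq: "\<omega> c z * k = ?h z" if "z \<in> ?I" "z \<notin> snd c ` (fst c \<inter> D)" for z
  proof -
    have "z \<in> patch c V" using that interior_subset by blast
    then obtain x where x: "x \<in> V" "x \<in> fst c" "z = snd c x" by (auto simp: patch_def)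
    then have x': "x \<in> fst c \<inter> fst c'" "x \<notin> D" using V that by auto
    have "is_form 1 1 A D \<omega>" using \<omega> by (simp add: smooth_form_off_def)
    from is_formD[OF this c te x'] have "\<omega> c z = \<omega> c' (g z) * (deriv g z * cnj (deriv g z))"
      using x(3) trans_ext_deriv(3)[OF te x'(1)] by (simp add: mult.assoc)
    then show ?thesis using complex_norm_square[of "deriv g z"] by (simp add: mult_ac)
  qed
  have eq': "indicator ?I z *\<^sub>R (\<omega> c z * k) = indicator ?I z *\<^sub>R ?h z" if z: "z \<notin> snd c ` (fst c \<inter> D)" for z
  proof (cases "z \<in> ?I")
    case True
    show ?thesis unfolding eq[OF True z] by (rule refl)
  next
    case False
    then show ?thesis by simp
  qed
  have fin: "finite (snd c ` (fst c \<inter> D))" using D by simp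
  have m3: "(\<lambda>z. indicator ?I z *\<^sub>R ?h z) \<in> borel_measurable borel"
    by (rule measurable_discrete_difference[OF m(2)[OF c(1)] countable_finite[OF fin] _ _ eq']) simp_all
  have ae3: "AE z in lborel. indicator ?I z *\<^sub>R (\<omega> c z * k) = indicator ?I z *\<^sub>R ?h z"
    by (rule AE_mp[OF AE_not_in_finite[OF fin]], rule AE_I2, rule impI) (rule eq')
  note 3 = set_lebesgue_AE_eq[OF m(2)[OF c(1)] m3 ae3]
  have m': "(\<lambda>z. indicator (g ` ?I) z *\<^sub>R (\<omega> c' z * k)) \<in> borel_measurable borel"
    unfolding gI by (rule m(2)[OF c(2)])
  note 4 = holomorphic_change_of_variables[OF open_interior op(2,3) m', unfolded gI]
  show "set_integrable lborel (patch c V) (\<lambda>z. \<omega> c z * k) \<longleftrightarrow> set_integrable lborel (patch c' V) (\<lambda>z. \<omega> c' z * k)"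
    by (simp only: 1(1) 2(1) 3(1) 4(1))
  show "(LINT z:patch c V|lborel. \<omega> c z * k) = (LINT z:patch c' V|lborel. \<omega> c' z * k)"
    by (simp only: 1(2) 2(2) 3(2) 4(2))
qed

lemma half_plane_neq_UNIV: "half_plane \<noteq> UNIV"
proof
  assume "half_plane = UNIV"
  then have "- \<i> \<in> half_plane" by simp
  then show False by (simp add: half_plane_def)
qed

text \<open>Otherwise the transition map to a half-plane chart would map an open set onto a neighbourhood of
  a real point that lies in the half plane.\<close>

lemma open_chart_no_boundary:
  assumes c: "c \<in> A" and o: "open (chart_image c)"
  shows "fst c \<inter> surface_boundary A = {}"
proof (rule ccontr)
  assume "fst c \<inter> surface_boundary A \<noteq> {}"
  then obtain x c' where x: "x \<in> fst c" "c' \<in> A" "x \<in> fst c'"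
    "openin (top_of_set half_plane) (chart_image c')" "Im (snd c' x) = 0"
    by (auto simp: surface_boundary_def)
  obtain W g where te: "trans_ext c c' W g" using trans_ext_exists[OF c x(2)] .
  let ?V = "fst c \<inter> fst c'"
  have V: "openin X ?V" using chart_open c x(2) by (simp add: openin_Int)
  obtain T where T: "open T" "\<forall>y\<in>fst c. snd c y \<in> T \<longleftrightarrow> y \<in> ?V" using chart_open_image[OF c V] .
  then have "patch c ?V = chart_image c \<inter> T" by (auto simp: patch_def chart_image_def)
  then have "open (patch c ?V)" using o T(1) by (simp add: open_Int)
  then have "open (g ` patch c ?V)"
    using trans_ext_open_image(1)[OF c x(2) te subset_refl] by (simp add: interior_open)
  moreover have "snd c' x \<in> g ` patch c ?V"
    using x trans_ext_deriv(3)[OF te, of x] by (auto simp: patch_def intro!: image_eqI[of _ g "snd c x"])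
  ultimately obtain e where e: "e > 0" "ball (snd c' x) e \<subseteq> g ` patch c ?V"
    by (auto simp: open_contains_ball)
  have "g ` patch c ?V \<subseteq> half_plane"
    by (rule subset_trans[OF trans_ext_patch(1)[OF c x(2) te subset_refl]
          subset_trans[OF patch_subset openin_imp_subset[OF x(4)]]])
  then have "ball (snd c' x) e \<subseteq> half_plane" using e(2) by (rule subset_trans[rotated])
  moreover have "snd c' x - of_real (e / 2) * \<i> \<in> ball (snd c' x) e"
    using e(1) by (simp add: dist_norm norm_mult norm_divide)
  ultimately have "snd c' x - of_real (e / 2) * \<i> \<in> half_plane" by (rule subsetD)
  then have "0 \<le> Im (snd c' x - of_real (e / 2) * \<i>)" unfolding half_plane_def by (rule CollectD)
  then show False using e x(5) by simp
qed

text \<open>A chart image inside the open upper half plane is also open in the plane. It counts as a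
  half-plane chart here, which is harmless as it does not meet the real line.\<close>

definition chart_half :: "'a chart \<Rightarrow> complex set" where
  "chart_half c = (if openin (top_of_set half_plane) (chart_image c) then half_plane else UNIV)"

lemma chart_half_cases: "chart_half c = UNIV \<or> chart_half c = half_plane"
  by (simp add: chart_half_def)

lemma chart_half_openin: "c \<in> A \<Longrightarrow> openin (top_of_set (chart_half c)) (chart_image c)"
  using chart_model[of c] by (auto simp: chart_half_def model_set_def)

lemma boundary_trace_eq:
  assumes c: "c \<in> A"
  shows "boundary_trace A c = (if chart_half c = UNIV then {} else {x. complex_of_real x \<in> chart_image c})"
proof (cases "openin (top_of_set half_plane) (chart_image c)")
  case True
  have "boundary_trace A c = {x. complex_of_real x \<in> chart_image c}"
  proof (intro equalityI subsetI)
    fix x assume "x \<in> {x. complex_of_real x \<in> chart_image c}"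
    then have *: "complex_of_real x \<in> chart_image c" by simp
    have "chart_inv c (of_real x) \<in> surface_boundary A"
      unfolding surface_boundary_def using c True chart_inv_in[OF *] * by auto
    then show "x \<in> boundary_trace A c"
      using * chart_inv_in[OF *] by (auto simp: boundary_trace_def intro!: image_eqI[of _ _ "chart_inv c (of_real x)"])
  qed (auto simp: boundary_trace_def chart_image_def)
  then show ?thesis using True half_plane_neq_UNIV by (simp add: chart_half_def)
next
  case False
  then have "open (chart_image c)" using chart_model[OF c] by (simp add: model_set_def)
  then show ?thesis using False
    unfolding boundary_trace_def open_chart_no_boundary[OF c \<open>open (chart_image c)\<close>]
    by (simp add: chart_half_def)
qed

lemma partition_facts:
  assumes "partition_of_unity X A C \<rho>"
  shows "finite C" "\<And>c. c \<in> C \<Longrightarrow> c \<in> A" "\<And>c. c \<in> C \<Longrightarrow> smooth_off {} (\<lambda>x. of_real (\<rho> c x))"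
    and "\<And>c x. c \<in> C \<Longrightarrow> x \<in> topspace X \<Longrightarrow> x \<notin> fst c \<Longrightarrow> \<rho> c x = 0"
    and "\<And>x. x \<in> topspace X \<Longrightarrow> (\<Sum>c\<in>C. \<rho> c x) = 1"
    and "\<And>c. c \<in> C \<Longrightarrow> X closure_of {x\<in>topspace X. \<rho> c x \<noteq> 0} \<subseteq> fst c"
proof -
  show "finite C" "\<And>c. c \<in> C \<Longrightarrow> c \<in> A" "\<And>x. x \<in> topspace X \<Longrightarrow> (\<Sum>c\<in>C. \<rho> c x) = 1"
    and cl: "\<And>c. c \<in> C \<Longrightarrow> X closure_of {x\<in>topspace X. \<rho> c x \<noteq> 0} \<subseteq> fst c"
    using assms by (auto simp: partition_of_unity_def)
  show "smooth_off {} (\<lambda>x. of_real (\<rho> c x))" if "c \<in> C" for c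
    using assms that by (auto simp: partition_of_unity_def smooth_off_def scalar_def chart_image_def)
  show "\<rho> c x = 0" if "c \<in> C" "x \<in> topspace X" "x \<notin> fst c" for c x
  proof (rule ccontr)
    assume "\<rho> c x \<noteq> 0"
    then have "x \<in> X closure_of {x\<in>topspace X. \<rho> c x \<noteq> 0}"
      using that closure_of_subset[of "{x\<in>topspace X. \<rho> c x \<noteq> 0}" X] by auto
    then show False using cl that by blast
  qed
qed

lemma chart_integral_patch:
  assumes c: "c \<in> A" and D: "finite D" and \<omega>: "smooth_form_off 1 1 A D \<omega>" and V: "openin X V"
    and zero: "\<And>x. x \<in> fst c \<Longrightarrow> x \<notin> V \<Longrightarrow> x \<notin> D \<Longrightarrow> \<omega> c (snd c x) = 0"
  shows "set_integrable lborel (chart_image c) (\<lambda>z. \<omega> c z * k) \<longleftrightarrow> set_integrable lborel (patch c V) (\<lambda>z. \<omega> c z * k)"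
    and "(LINT z:chart_image c|lborel. \<omega> c z * k) = (LINT z:patch c V|lborel. \<omega> c z * k)"
proof -
  have m1: "(\<lambda>z. indicator (chart_image c) z *\<^sub>R (\<omega> c z * k)) \<in> borel_measurable borel"
    by (rule coefficient_measurable[OF c D smooth_form_offD[OF \<omega> c] model_set_borel[OF chart_model[OF c]] subset_refl])
  have m2: "(\<lambda>z. indicator (patch c V) z *\<^sub>R (\<omega> c z * k)) \<in> borel_measurable borel"
    by (rule coefficient_measurable[OF c D smooth_form_offD[OF \<omega> c] model_set_borel[OF patch_model[OF c V]] patch_subset])
  have "finite (snd c ` (fst c \<inter> D))" using D by simp
  from AE_not_in_finite[OF this]
  have ae: "AE z in lborel. indicator (chart_image c) z *\<^sub>R (\<omega> c z * k) = indicator (patch c V) z *\<^sub>R (\<omega> c z * k)"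
  proof eventually_elim
    case (elim z)
    show ?case
    proof (cases "z \<in> chart_image c \<and> z \<notin> patch c V")
      case True
      then obtain x where "x \<in> fst c" "z = snd c x" "x \<notin> V" "x \<notin> D"
        using elim by (auto simp: patch_def chart_image_def)
      then show ?thesis using zero by simp
    next
      case False
      then show ?thesis using patch_subset[of c V] by (auto simp: indicator_def)
    qed
  qed
  show "set_integrable lborel (chart_image c) (\<lambda>z. \<omega> c z * k) \<longleftrightarrow> set_integrable lborel (patch c V) (\<lambda>z. \<omega> c z * k)"
    "(LINT z:chart_image c|lborel. \<omega> c z * k) = (LINT z:patch c V|lborel. \<omega> c z * k)"
    using set_lebesgue_AE_eq[OF m1 m2 ae] .
qed

text \<open>When the form vanishes outside the chart \<open>e\<close>, every summand of an integral computed with a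
  partition of unity can be moved to \<open>e\<close>, where the partition functions add up to one.\<close>

lemma single_chart_integral:
  assumes P: "partition_of_unity X A C \<rho>" and D: "finite D" and \<omega>: "smooth_form_off 1 1 A D \<omega>"
    and e: "e \<in> A" and zero: "\<And>c x. c \<in> A \<Longrightarrow> x \<in> fst c \<Longrightarrow> x \<notin> fst e \<Longrightarrow> x \<notin> D \<Longrightarrow> \<omega> c (snd c x) = 0"
    and int: "\<And>c. c \<in> C \<Longrightarrow> set_integrable lborel (chart_image c) (\<lambda>z. of_real (\<rho> c (chart_inv c z)) * \<omega> c z * k)"
  shows "set_integrable lborel (chart_image e) (\<lambda>z. \<omega> e z * k)"
    and "(\<Sum>c\<in>C. LINT z:chart_image c|lborel. of_real (\<rho> c (chart_inv c z)) * \<omega> c z * k)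
      = (LINT z:chart_image e|lborel. \<omega> e z * k)"
proof -
  define \<omega>' where "\<omega>' c = (\<lambda>c' z. scalar (\<lambda>x. of_real (\<rho> c x)) c' z * \<omega> c' z)" for c
  note pf = partition_facts[OF P]
  have f: "smooth_form_off 1 1 A D (\<omega>' c)" if "c \<in> C" for c
    unfolding \<omega>'_def by (rule smooth_form_off_scale[OF smooth_off_subset[OF pf(3)[OF that]] \<omega>]) simp
  have eq: "\<omega>' c c' z = of_real (\<rho> c (chart_inv c' z)) * \<omega> c' z" for c c' z
    by (simp add: \<omega>'_def scalar_def)
  have vanish: "\<omega>' c c' (snd c' x) = 0" if "c \<in> C" "c' \<in> A" "x \<in> fst c'" "x \<notin> fst c \<inter> fst e" "x \<notin> D" for c c' x
  proof (cases "x \<in> fst e")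
    case True
    then have "\<rho> c x = 0" using pf(4)[OF that(1), of x] chart_subset[OF that(2)] that by blast
    then show ?thesis using that by (simp add: eq)
  next
    case False
    then show ?thesis using zero[OF that(2,3) False that(5)] by (simp add: eq)
  qed
  have both: "set_integrable lborel (chart_image e) (\<lambda>z. \<omega>' c e z * k)
     \<and> (LINT z:chart_image c|lborel. \<omega>' c c z * k) = (LINT z:chart_image e|lborel. \<omega>' c e z * k)" if c: "c \<in> C" for c
  proof -
    have cA: "c \<in> A" by (rule pf(2)[OF c])
    let ?V = "fst c \<inter> fst e"
    have V: "openin X ?V" using chart_open cA e by (simp add: openin_Int)
    have 1: "set_integrable lborel (chart_image c) (\<lambda>z. \<omega>' c c z * k) \<longleftrightarrow> set_integrable lborel (patch c ?V) (\<lambda>z. \<omega>' c c z * k)"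
      "(LINT z:chart_image c|lborel. \<omega>' c c z * k) = (LINT z:patch c ?V|lborel. \<omega>' c c z * k)"
      by (rule chart_integral_patch[OF cA D f[OF c] V], rule vanish[OF c cA]; assumption)+
    have 2: "set_integrable lborel (chart_image e) (\<lambda>z. \<omega>' c e z * k) \<longleftrightarrow> set_integrable lborel (patch e ?V) (\<lambda>z. \<omega>' c e z * k)"
      "(LINT z:chart_image e|lborel. \<omega>' c e z * k) = (LINT z:patch e ?V|lborel. \<omega>' c e z * k)"
      by (rule chart_integral_patch[OF e D f[OF c] V], rule vanish[OF c e]; assumption)+
    note 3 = chart_change_integral[OF cA e D f[OF c] V subset_refl]
    have "set_integrable lborel (chart_image c) (\<lambda>z. \<omega>' c c z * k)" using int[OF c] by (simp add: eq)
    then have "set_integrable lborel (chart_image e) (\<lambda>z. \<omega>' c e z * k)"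
      by (rule iffD2[OF 2(1) iffD1[OF 3(1) iffD1[OF 1(1)]]])
    moreover have "(LINT z:chart_image c|lborel. \<omega>' c c z * k) = (LINT z:chart_image e|lborel. \<omega>' c e z * k)"
      by (rule trans[OF 1(2) trans[OF 3(2) 2(2)[symmetric]]])
    ultimately show ?thesis ..
  qed
  have sum: "\<omega> e z * k = (\<Sum>c\<in>C. \<omega>' c e z * k)" if z: "z \<in> chart_image e" for z
  proof -
    have "(\<Sum>c\<in>C. \<omega>' c e z * k) = of_real (\<Sum>c\<in>C. \<rho> c (chart_inv e z)) * \<omega> e z * k"
      by (simp add: eq sum_distrib_right)
    moreover have "chart_inv e z \<in> topspace X"
      using chart_subset[OF e] chart_inv_in[OF z] by (rule subsetD)
    ultimately show ?thesis by (simp add: pf(5))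
  qed
  have sum': "indicator (chart_image e) z *\<^sub>R (\<omega> e z * k) = (\<Sum>c\<in>C. indicator (chart_image e) z *\<^sub>R (\<omega>' c e z * k))" for z
    by (cases "z \<in> chart_image e") (simp_all add: sum)
  have i: "\<And>c. c \<in> C \<Longrightarrow> integrable lborel (\<lambda>z. indicator (chart_image e) z *\<^sub>R (\<omega>' c e z * k))"
    using both by (simp add: set_integrable_def)
  show "set_integrable lborel (chart_image e) (\<lambda>z. \<omega> e z * k)"
    unfolding set_integrable_def sum' by (rule Bochner_Integration.integrable_sum[OF i])
  have "(LINT z:chart_image e|lborel. \<omega> e z * k) = (\<Sum>c\<in>C. LINT z:chart_image e|lborel. \<omega>' c e z * k)"
    unfolding set_lebesgue_integral_def sum' by (rule Bochner_Integration.integral_sum[OF i])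
  also have "\<dots> = (\<Sum>c\<in>C. LINT z:chart_image c|lborel. \<omega>' c c z * k)"
    by (rule sum.cong[OF refl]) (rule conjunct2[OF both, symmetric])
  finally show "(\<Sum>c\<in>C. LINT z:chart_image c|lborel. of_real (\<rho> c (chart_inv c z)) * \<omega> c z * k)
      = (LINT z:chart_image e|lborel. \<omega> e z * k)" by (simp only: eq)
qed

section \<open>Poles, integrability and partitions of unity\<close>

lemma centred_chartD:
  assumes "centred_chart A x c"
  shows "c \<in> A" "x \<in> fst c" "snd c x = 0" "open (chart_image c)" "chart_inv c 0 = x" "0 \<in> chart_image c"
proof -
  show 1: "c \<in> A" "x \<in> fst c" "snd c x = 0" "open (chart_image c)"
    using assms by (auto simp: centred_chart_def)
  show "0 \<in> chart_image c" using chart_in_image[OF 1(2)] 1(3) by simp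
  show "chart_inv c 0 = x" using chart_inv_left[OF 1(1,2)] 1(3) by simp
qed

lemma centred_chart_ball:
  assumes c: "centred_chart A x c" and D: "finite D"
  obtains r where "r > 0" "ball 0 r \<subseteq> chart_image c" "\<forall>z\<in>ball 0 r - {0}. chart_inv c z \<notin> D"
proof -
  note cd = centred_chartD[OF c]
  let ?P = "snd c ` (fst c \<inter> D) - {0}"
  have "open (chart_image c \<inter> - ?P)"
    using cd(4) D by (intro open_Int open_Compl finite_imp_closed) auto
  moreover have "0 \<in> chart_image c \<inter> - ?P" using cd by simp
  ultimately obtain r where r: "r > 0" "ball 0 r \<subseteq> chart_image c \<inter> - ?P"
    by (metis openE)
  have "\<forall>z\<in>ball 0 r - {0}. chart_inv c z \<notin> D"
  proof
    fix z :: complex assume z: "z \<in> ball 0 r - {0}"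
    then have *: "z \<in> chart_image c" "z \<notin> ?P" using r by auto
    show "chart_inv c z \<notin> D"
    proof
      assume "chart_inv c z \<in> D"
      then have "snd c (chart_inv c z) \<in> snd c ` (fst c \<inter> D)" using chart_inv_in[OF *(1)] by blast
      then show False using * z by simp
    qed
  qed
  with r show ?thesis by (intro that[of r]) auto
qed

text \<open>The order of a pole may be measured in any centred coordinate. A change of coordinates that fixes
  zero is $h(z) = z\,k(z)$ with $k$ holomorphic and without zeros, so that
  $h^{-N} = k^{-N} z^{-N}$, and $k^{-N}$ can be absorbed into the smooth numerator.\<close>

lemma pole_transfer:
  assumes f: "is_form p q A D \<omega>" and D: "finite D" and pole: "pole_at A x N \<omega>" and c: "centred_chart A x c"
  obtains g r where "0 < r" "ball 0 r \<subseteq> chart_image c" "smooth_on g (ball 0 r)"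
    "\<forall>z\<in>ball 0 r - {0}. \<omega> c z = g z / z ^ N" "\<forall>z\<in>ball 0 r - {0}. chart_inv c z \<notin> D"
proof -
  note cd = centred_chartD[OF c]
  obtain d g0 r0 where d: "centred_chart A x d" "0 < r0" "ball 0 r0 \<subseteq> chart_image d" "smooth_on g0 (ball 0 r0)"
    "\<forall>z\<in>ball 0 r0 - {0}. \<omega> d z = g0 z / z ^ N"
    using pole unfolding pole_at_def by blast
  note dd = centred_chartD[OF d(1)]
  obtain r1 where r1: "r1 > 0" "ball 0 r1 \<subseteq> chart_image c" "\<forall>z\<in>ball 0 r1 - {0}. chart_inv c z \<notin> D"
    using centred_chart_ball[OF c D] .
  obtain W h where te: "trans_ext c d W h" using trans_ext_exists[OF cd(1) dd(1)] .
  obtain T where T: "open T" "\<forall>y\<in>fst c. snd c y \<in> T \<longleftrightarrow> y \<in> fst d"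
    using chart_open_image[OF cd(1) chart_open[OF dd(1)]] .
  have x: "x \<in> fst c \<inter> fst d" using cd(2) dd(2) by simp
  have h0: "h 0 = 0" "0 \<in> W" using trans_ext_deriv(2,3)[OF te x] cd(3) dd(3) by simp_all
  have W: "open W" "h holomorphic_on W" using te by (auto simp: trans_ext_def)
  have "open (W \<inter> h -` ball 0 r0)"
    using W by (intro continuous_open_preimage holomorphic_on_imp_continuous_on) auto
  then have o: "open ((W \<inter> h -` ball 0 r0) \<inter> T \<inter> ball 0 r1)"
    by (rule open_Int[OF open_Int[OF _ T(1)] open_ball])
  have "0 \<in> T" using T(2) x cd(3) by (metis IntD1 IntD2)
  then have "0 \<in> (W \<inter> h -` ball 0 r0) \<inter> T \<inter> ball 0 r1" using h0 d(2) r1(1) by simp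
  then obtain r where r: "r > 0" "ball 0 r \<subseteq> (W \<inter> h -` ball 0 r0) \<inter> T \<inter> ball 0 r1"
    using openE[OF o] by metis
  let ?B = "ball 0 r :: complex set"
  have BW: "?B \<subseteq> W" "h ` ?B \<subseteq> ball 0 r0" "?B \<subseteq> T" "?B \<subseteq> ball 0 r1" using r(2) by auto
  have BS: "?B \<subseteq> chart_image c" using BW(4) r1(2) by (rule subset_trans)
  have pt: "\<exists>y. y \<in> fst c \<inter> fst d \<and> z = snd c y \<and> chart_inv c z = y" if "z \<in> ?B" for z
  proof (intro exI[of _ "chart_inv c z"] conjI)
    have z: "z \<in> chart_image c" "z \<in> T" using subsetD[OF BS that] subsetD[OF BW(3) that] .
    then show "chart_inv c z \<in> fst c \<inter> fst d"
      using bspec[OF T(2) chart_inv_in[OF z(1)]] chart_inv_in[OF z(1)] z by simp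
    show "z = snd c (chart_inv c z)" using z by simp
  qed simp
  have hB: "h holomorphic_on ?B" using W(2) BW(1) by (rule holomorphic_on_subset)
  have "?B \<subseteq> transition_dom c d" using pt by (fastforce simp: transition_dom_def)
  then have inj: "inj_on h ?B" by (rule inj_on_subset[OF trans_ext_inj[OF cd(1) dd(1) te]])
  define k where "k = (\<lambda>z. if z = 0 then deriv h 0 else (h z - h 0) / (z - 0))"
  have kh: "k holomorphic_on ?B" unfolding k_def by (rule pole_lemma_open[OF hB]) simp
  have hz: "h z = z * k z" for z by (simp add: k_def h0)
  have k0: "k z \<noteq> 0" if "z \<in> ?B" for z
  proof (cases "z = 0")
    case True
    have "deriv h 0 \<noteq> 0" by (rule holomorphic_injective_imp_regular[OF hB _ inj]) (use r in auto)
    then show ?thesis using True by (simp add: k_def)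
  next
    case False
    have "h z \<noteq> h 0" using inj that r(1) False by (auto dest: inj_onD)
    then show ?thesis using False h0 by (simp add: k_def)
  qed
  define g where "g = (\<lambda>z. g0 (h z) * deriv h z ^ p * cnj (deriv h z) ^ q * inverse (k z) ^ N)"
  have dh: "smooth_on (deriv h) ?B" by (intro smooth_on_holomorphic holomorphic_deriv hB) auto
  have "smooth_on (\<lambda>z. inverse (k z)) ?B"
    by (rule smooth_on_inverse[OF smooth_on_holomorphic[OF open_ball kh] k0])
  then have "smooth_on g ?B" unfolding g_def
    by (intro smooth_on_mult smooth_on_power smooth_on_cnj dh
        smooth_on_compose_inner[OF d(4) open_ball hB subset_refl BW(2)])
  moreover have "\<forall>z\<in>?B - {0}. \<omega> c z = g z / z ^ N"
  proof
    fix z assume z: "z \<in> ?B - {0}"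
    then obtain y where y: "y \<in> fst c \<inter> fst d" "z = snd c y" "chart_inv c z = y" using pt by blast
    have "y \<notin> D" using r1(3) BW(4) z y(3) by blast
    from is_formD[OF f cd(1) dd(1) te y(1) this] trans_ext_deriv(3)[OF te y(1)]
    have 1: "\<omega> c z = \<omega> d (h z) * deriv h z ^ p * cnj (deriv h z) ^ q" by (simp add: y(2))
    have "h z \<noteq> 0" using hz[of z] k0[of z] z by simp
    moreover have "h z \<in> ball 0 r0" using BW(2) z by blast
    ultimately have "\<omega> d (h z) = g0 (h z) / (z * k z) ^ N" using d(5) hz by simp
    then show "\<omega> c z = g z / z ^ N"
      unfolding 1 g_def by (simp add: power_mult_distrib power_inverse divide_inverse)
  qed
  moreover have "\<forall>z\<in>?B - {0}. chart_inv c z \<notin> D" using r1(3) BW(4) by blast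
  ultimately show ?thesis using r(1) BS by (intro that)
qed

lemma log_2formsD:
  assumes "\<omega> \<in> log_2forms A D"
  shows "smooth_form_off 1 1 A D \<omega>" "\<And>x. x \<in> D \<Longrightarrow> pole_at A x 1 \<omega>"
  using assms by (auto simp: log_2forms_def)

text \<open>Away from \<open>D\<close> the coefficient is locally bounded, and at a point of \<open>D\<close> it is bounded by
  $C/|z|$ in a centred coordinate.\<close>

lemma log_form_locally_integrable:
  assumes \<omega>: "\<omega> \<in> log_2forms A D" and D: "finite D" and c: "c \<in> A" and x: "x \<in> fst c"
  shows "\<exists>T. open T \<and> snd c x \<in> T \<and> set_integrable lborel (chart_image c \<inter> T) (\<lambda>z. \<omega> c z * k)"
proof (cases "x \<in> D")
  case False
  note sm = log_2formsD(1)[OF \<omega>]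
  let ?O = "- snd c ` (fst c \<inter> D)" and ?S = "chart_image c" and ?z = "snd c x"
  have o: "open ?O" by (rule open_Compl_finite_image[OF D])
  have "continuous_on (?S \<inter> ?O) (\<omega> c)"
    using smooth_on_continuous[OF smooth_form_offD[OF sm c]] unfolding chart_image_minus[OF c] .
  then have cont: "continuous_on (?S \<inter> ?O) (\<lambda>z. \<omega> c z * k)" by (intro continuous_intros)
  have zS: "?z \<in> ?S \<inter> ?O" using x False unfolding chart_image_minus[OF c, symmetric] by blast
  then obtain d where d: "d > 0" "\<And>w. w \<in> ?S \<inter> ?O \<Longrightarrow> dist w ?z < d \<Longrightarrow> dist (\<omega> c w * k) (\<omega> c ?z * k) < 1"
    using cont unfolding continuous_on_iff by (metis zero_less_one)
  let ?T = "ball ?z d \<inter> ?O"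
  have m: "(\<lambda>z. indicator (?S \<inter> ?T) z *\<^sub>R (\<omega> c z * k)) \<in> borel_measurable borel"
    by (rule coefficient_measurable[OF c D smooth_form_offD[OF sm c]])
      (use o model_set_borel[OF chart_model[OF c]] in auto)
  have "integrable lborel (\<lambda>z. indicator (?S \<inter> ?T) z *\<^sub>R (\<omega> c z * k))"
  proof (rule integrableI_bounded_set[where A = "?S \<inter> ?T" and B = "norm (\<omega> c ?z * k) + 1"])
    show "?S \<inter> ?T \<in> sets lborel" using o model_set_borel[OF chart_model[OF c]] by auto
    have "emeasure lborel (?S \<inter> ?T) \<le> emeasure lborel (ball ?z d)" by (rule emeasure_mono) auto
    also have "\<dots> < \<infinity>" by (rule emeasure_bounded_finite[OF bounded_ball])
    finally show "emeasure lborel (?S \<inter> ?T) < \<infinity>" .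
    show "AE w in lborel. w \<in> ?S \<inter> ?T \<longrightarrow> norm (indicator (?S \<inter> ?T) w *\<^sub>R (\<omega> c w * k)) \<le> norm (\<omega> c ?z * k) + 1"
    proof (rule AE_I2, rule impI)
      fix w assume w: "w \<in> ?S \<inter> ?T"
      then have "dist (\<omega> c w * k) (\<omega> c ?z * k) < 1" by (intro d) (auto simp: dist_commute)
      then have "norm (\<omega> c w * k) \<le> norm (\<omega> c ?z * k) + 1"
        using norm_triangle_sub[of "\<omega> c w * k" "\<omega> c ?z * k"] by (simp add: dist_norm)
      then show "norm (indicator (?S \<inter> ?T) w *\<^sub>R (\<omega> c w * k)) \<le> norm (\<omega> c ?z * k) + 1"
        using w by simp
    qed
  qed (use m in \<open>auto simp: indicator_def\<close>)
  moreover have "open ?T" "?z \<in> ?T" using o d(1) zS by auto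
  ultimately show ?thesis unfolding set_integrable_def by blast
next
  case True
  note sm = log_2formsD(1)[OF \<omega>]
  obtain e g r where e: "centred_chart A x e" "0 < r" "ball 0 r \<subseteq> chart_image e" "smooth_on g (ball 0 r)"
    "\<forall>z\<in>ball 0 r - {0}. \<omega> e z = g z / z ^ 1"
    using log_2formsD(2)[OF \<omega> True] unfolding pole_at_def by blast
  note ed = centred_chartD[OF e(1)]
  let ?B = "ball 0 (r / 2) :: complex set"
  have "compact (g ` cball 0 (r / 2))"
    using e(2) by (intro compact_continuous_image continuous_on_subset[OF smooth_on_continuous[OF e(4)]]) auto
  then obtain C where C: "\<And>z. z \<in> cball 0 (r / 2) \<Longrightarrow> norm (g z) \<le> C"
    using compact_imp_bounded[of "g ` cball 0 (r / 2)"] unfolding bounded_iff by blast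
  have Be: "?B \<subseteq> chart_image e" using e(2,3) by (force intro: subset_trans)
  have i: "set_integrable lborel ?B (\<lambda>z. \<omega> e z * k)"
  proof (rule set_integrable_inverse_norm_bound[where C = "C * norm k"])
    show "(\<lambda>z. indicator ?B z *\<^sub>R (\<omega> e z * k)) \<in> borel_measurable borel"
      by (rule coefficient_measurable[OF ed(1) D smooth_form_offD[OF sm ed(1)] _ Be]) simp
    fix z assume z: "z \<in> ?B - {0}"
    then have "\<omega> e z = g z / z" using e(2,5) by simp
    moreover have "norm (g z) \<le> C" using C[of z] z by simp
    ultimately show "cmod (\<omega> e z * k) \<le> C * norm k / cmod z"
      by (simp add: norm_mult norm_divide divide_right_mono mult_right_mono)
  qed (use e(2) in simp)
  let ?V = "{y \<in> fst e. snd e y \<in> ?B} \<inter> fst c"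
  have V: "openin X ?V" using chart_preimage_open[OF ed(1) open_ball] chart_open[OF c] by (rule openin_Int)
  have pe: "patch e ?V \<subseteq> ?B" by (auto simp: patch_def)
  have "set_integrable lborel (patch e ?V) (\<lambda>z. \<omega> e z * k)"
    using set_integrable_subset[OF i _ pe] model_set_borel[OF patch_model[OF ed(1) V]] by simp
  then have ic: "set_integrable lborel (patch c ?V) (\<lambda>z. \<omega> c z * k)"
    using chart_change_integral(1)[OF c ed(1) D sm V] by blast
  obtain T where T: "open T" "\<forall>y\<in>fst c. snd c y \<in> T \<longleftrightarrow> y \<in> ?V" using chart_open_image[OF c V] .
  then have "patch c ?V = chart_image c \<inter> T" by (auto simp: patch_def chart_image_def)
  moreover have "snd c x \<in> T" using T(2) x ed e(2) by simp
  ultimately show ?thesis using ic T(1) by auto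
qed

lemma log_form_integrable:
  assumes \<omega>: "\<omega> \<in> log_2forms A D" and D: "finite D" and c: "c \<in> A"
    and K: "compact K" "K \<subseteq> chart_image c"
    and zero: "\<And>x. x \<in> fst c \<Longrightarrow> x \<notin> D \<Longrightarrow> snd c x \<notin> K \<Longrightarrow> \<omega> c (snd c x) = 0"
  shows "set_integrable lborel (chart_image c) (\<lambda>z. \<omega> c z * k)"
proof -
  note sm = log_2formsD(1)[OF \<omega>]
  let ?f = "\<lambda>z. \<omega> c z * k" and ?S = "chart_image c"
  have "\<forall>z\<in>K. \<exists>T. open T \<and> z \<in> T \<and> set_integrable lborel (?S \<inter> T) ?f"
  proof
    fix z assume "z \<in> K"
    then obtain x where "x \<in> fst c" "z = snd c x" using K(2) by (auto simp: chart_image_def)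
    then show "\<exists>T. open T \<and> z \<in> T \<and> set_integrable lborel (?S \<inter> T) ?f"
      using log_form_locally_integrable[OF \<omega> D c] by simp
  qed
  then obtain T where T: "\<And>z. z \<in> K \<Longrightarrow> open (T z) \<and> z \<in> T z \<and> set_integrable lborel (?S \<inter> T z) ?f"
    by metis
  obtain F where F: "F \<subseteq> K" "finite F" "K \<subseteq> (\<Union>z\<in>F. T z)"
    by (rule compactE_image[OF K(1), of K T]) (use T in auto)
  have Sb: "?S \<in> sets borel" by (rule model_set_borel[OF chart_model[OF c]])
  have "set_integrable lborel (\<Union>z\<in>F. ?S \<inter> T z) ?f"
    by (rule set_integrable_UN[OF F(2)]) (use T F(1) Sb in auto)
  then have iK: "set_integrable lborel K ?f"
    by (rule set_integrable_subset) (use K F(3) in \<open>auto intro: borel_compact\<close>)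
  have m1: "(\<lambda>z. indicator K z *\<^sub>R ?f z) \<in> borel_measurable borel"
    by (rule coefficient_measurable[OF c D smooth_form_offD[OF sm c] borel_compact[OF K(1)] K(2)])
  have m2: "(\<lambda>z. indicator ?S z *\<^sub>R ?f z) \<in> borel_measurable borel"
    by (rule coefficient_measurable[OF c D smooth_form_offD[OF sm c] Sb subset_refl])
  have fin: "finite (snd c ` (fst c \<inter> D))" using D by simp
  have eq: "indicator K z *\<^sub>R ?f z = indicator ?S z *\<^sub>R ?f z" if z: "z \<notin> snd c ` (fst c \<inter> D)" for z
  proof (cases "z \<in> ?S \<and> z \<notin> K")
    case True
    then obtain x where "x \<in> fst c" "z = snd c x" by (auto simp: chart_image_def)
    then have "\<omega> c z = 0" using zero[of x] z True by blast
    then show ?thesis by simp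
  next
    case False
    then show ?thesis using K(2) by (auto simp: indicator_def)
  qed
  have ae: "AE z in lborel. indicator K z *\<^sub>R ?f z = indicator ?S z *\<^sub>R ?f z"
    by (rule AE_mp[OF AE_not_in_finite[OF fin]], rule AE_I2, rule impI) (rule eq)
  show ?thesis using set_lebesgue_AE_eq(1)[OF m1 m2 ae] iK by blast
qed

text \<open>Bump functions around finitely many points, divided by their sum. Since a partition of unity
  assigns one function to each chart, the bumps that live in the same chart are added up.\<close>

lemma partition_exists:
  assumes comp: "compact_space X"
  obtains C \<rho> where "partition_of_unity X A C \<rho>"
proof -
  have "\<forall>x\<in>topspace X. \<exists>c r. c \<in> A \<and> x \<in> fst c \<and> 0 < r \<and> compact (cball (snd c x) r \<inter> chart_image c)"
  proof
    fix x assume "x \<in> topspace X"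
    then obtain c where c: "c \<in> A" "x \<in> fst c" using atlas_covers by blast
    obtain r where "r > 0" "compact (cball (snd c x) r \<inter> chart_image c)"
      using model_set_compact_nbhd[OF chart_model[OF c(1)] chart_in_image[OF c(2)]] .
    then show "\<exists>c r. c \<in> A \<and> x \<in> fst c \<and> 0 < r \<and> compact (cball (snd c x) r \<inter> chart_image c)" using c by blast
  qed
  then obtain ch r where ch: "\<And>x. x \<in> topspace X \<Longrightarrow> ch x \<in> A \<and> x \<in> fst (ch x) \<and> 0 < r x
      \<and> compact (cball (snd (ch x) x) (r x) \<inter> chart_image (ch x))" by metis
  define u where "u x = (\<lambda>z. cutoff (r x) (z - snd (ch x) x))" for x
  define b where "b x y = (if y \<in> fst (ch x) then u x (snd (ch x) y) else 0)" for x y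
  define K where "K x = cball (snd (ch x) x) (r x) \<inter> chart_image (ch x)" for x
  define V where "V x = {y \<in> fst (ch x). snd (ch x) y \<in> ball (snd (ch x) x) (r x)}" for x
  have u0: "u x z = 0" if "x \<in> topspace X" "z \<in> chart_image (ch x) - K x" for x z
    using that ch[OF that(1)] by (auto simp: u_def K_def dist_norm norm_minus_commute intro!: cutoff_eq_0)
  have smu: "smooth_on (\<lambda>z. of_real (u x z)) S" if x: "x \<in> topspace X" for x S
    unfolding u_def
    by (rule smooth_on_compose_inner[OF smooth_on_cutoff[of "r x" UNIV] open_UNIV, of "\<lambda>z. z - snd (ch x) x"])
      (use ch[OF x] in \<open>auto intro!: holomorphic_intros\<close>)
  have bext: "complex_of_real (b x y) = chart_ext (ch x) (\<lambda>z. of_real (u x z)) y" for x y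
    by (simp add: b_def chart_ext_def)
  have smb: "smooth_off {} (\<lambda>y. of_real (b x y))" if x: "x \<in> topspace X" for x
    unfolding bext
    by (rule smooth_off_chart_ext[where K = "K x"])
      (use ch[OF x] u0[OF x] smu[OF x] in \<open>auto simp: K_def\<close>)
  have b_nonneg: "0 \<le> b x y" for x y by (simp add: b_def u_def cutoff_nonneg)
  have b_pos: "0 < b x y" if "y \<in> V x" for x y
    using that by (auto simp: V_def b_def u_def dist_norm norm_minus_commute intro!: cutoff_pos)
  have Vo: "openin X (V x)" if "x \<in> topspace X" for x
    unfolding V_def using ch[OF that] by (intro chart_preimage_open) auto
  have xV: "x \<in> V x" if "x \<in> topspace X" for x using ch[OF that] by (simp add: V_def)
  obtain F where F: "finite F" "F \<subseteq> topspace X" "topspace X \<subseteq> \<Union> (V ` F)"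
  proof -
    have "\<exists>\<F>. finite \<F> \<and> \<F> \<subseteq> V ` topspace X \<and> topspace X \<subseteq> \<Union>\<F>"
    proof (rule compactinD)
      show "compactin X (topspace X)" using comp by (simp add: compact_space_def)
      show "openin X U" if "U \<in> V ` topspace X" for U using that Vo by auto
      show "topspace X \<subseteq> \<Union> (V ` topspace X)" using xV by auto
    qed
    then obtain \<F> where fam: "finite \<F>" "\<F> \<subseteq> V ` topspace X" "topspace X \<subseteq> \<Union>\<F>"
      by (elim exE conjE)
    from finite_subset_image[OF fam(1,2)] obtain F where "F \<subseteq> topspace X" "finite F" "\<F> = V ` F"
      by auto
    with fam(3) show ?thesis by (intro that[of F]) simp_all
  qed
  define S where "S y = (\<Sum>x\<in>F. b x y)" for y
  have S_pos: "0 < S y" if y: "y \<in> topspace X" for y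
  proof -
    obtain x where "x \<in> F" "y \<in> V x" using subsetD[OF F(3) y] by blast
    then show ?thesis unfolding S_def using F(1) b_nonneg b_pos by (intro sum_pos2[of F x]) auto
  qed
  define \<rho> where "\<rho> c y = (\<Sum>x\<in>{x\<in>F. ch x = c}. b x y) / S y" for c y
  have "partition_of_unity X A (ch ` F) \<rho>"
    unfolding partition_of_unity_def
  proof (intro conjI ballI)
    show "finite (ch ` F)" using F by simp
    show "ch ` F \<subseteq> A" using F(2) ch by blast
    show "0 \<le> \<rho> c x" if "x \<in> topspace X" for c x
      unfolding \<rho>_def using S_pos[OF that] b_nonneg by (intro divide_nonneg_pos sum_nonneg) auto
    show "(\<Sum>c\<in>ch ` F. \<rho> c x) = 1" if "x \<in> topspace X" for x
    proof -
      have "(\<Sum>c\<in>ch ` F. \<rho> c x) = (\<Sum>c\<in>ch ` F. \<Sum>y\<in>{y\<in>F. ch y = c}. b y x) / S x"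
        by (simp add: \<rho>_def sum_divide_distrib)
      also have "(\<Sum>c\<in>ch ` F. \<Sum>y\<in>{y\<in>F. ch y = c}. b y x) = S x"
        unfolding S_def by (rule sum.image_gen[OF F(1), symmetric])
      finally show ?thesis using S_pos[OF that] by simp
    qed
    show "X closure_of {x \<in> topspace X. \<rho> c x \<noteq> 0} \<subseteq> fst c" for c
    proof -
      let ?L = "\<Union>x\<in>{x\<in>F. ch x = c}. chart_inv (ch x) ` K x"
      have cl: "closedin X ?L"
      proof (rule closedin_Union)
        show "finite ((\<lambda>x. chart_inv (ch x) ` K x) ` {x \<in> F. ch x = c})" using F(1) by simp
        fix L assume "L \<in> (\<lambda>x. chart_inv (ch x) ` K x) ` {x \<in> F. ch x = c}"
        then obtain x where x: "x \<in> F" "L = chart_inv (ch x) ` K x" by blast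
        have "ch x \<in> A" "compact (K x)" using ch[of x] x(1) F(2) by (auto simp: K_def)
        then show "closedin X L" unfolding x(2) by (rule closedin_chart_compact) (simp add: K_def)
      qed
      have sub: "{x \<in> topspace X. \<rho> c x \<noteq> 0} \<subseteq> ?L"
      proof
        fix y assume "y \<in> {x \<in> topspace X. \<rho> c x \<noteq> 0}"
        then have "(\<Sum>x\<in>{x\<in>F. ch x = c}. b x y) \<noteq> 0" by (auto simp: \<rho>_def)
        then obtain x where x: "x \<in> F" "ch x = c" "b x y \<noteq> 0" using sum.not_neutral_contains_not_neutral by blast
        then have xt: "x \<in> topspace X" using F(2) by blast
        have "y \<in> chart_inv (ch x) ` K x"
        proof (rule ccontr)
          assume "y \<notin> chart_inv (ch x) ` K x"
          then have "chart_ext (ch x) (\<lambda>z. of_real (u x z)) y = 0"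
            using ch[OF xt] u0[OF xt] by (intro chart_ext_zero[where K = "K x"]) auto
          then show False using x(3) unfolding bext[symmetric] by simp
        qed
        then show "y \<in> ?L" using x by blast
      qed
      have "?L \<subseteq> fst c"
      proof
        fix y assume "y \<in> ?L"
        then obtain x z where "ch x = c" "z \<in> K x" "y = chart_inv (ch x) z" by blast
        then show "y \<in> fst c" using chart_inv_in[of z c] by (simp add: K_def)
      qed
      with closure_of_minimal[OF sub cl] show ?thesis by (rule subset_trans)
    qed
    show "smooth_on (\<lambda>z. of_real (\<rho> c (chart_inv c' z))) (chart_image c')" if "c' \<in> A" for c c'
    proof -
      have sb: "smooth_on (\<lambda>z. of_real (b x (chart_inv c' z))) (chart_image c')" if "x \<in> F" for x
        using smb[of x] that F(2) \<open>c' \<in> A\<close> by (auto simp: smooth_off_def scalar_def chart_image_def)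
      have "smooth_on (\<lambda>z. (\<Sum>x\<in>{x\<in>F. ch x = c}. of_real (b x (chart_inv c' z)))
          / (\<Sum>x\<in>F. of_real (b x (chart_inv c' z)))) (chart_image c')"
      proof (rule smooth_on_divide)
        fix z assume "z \<in> chart_image c'"
        then have "chart_inv c' z \<in> topspace X" by (rule subsetD[OF chart_subset[OF that] chart_inv_in])
        then have "S (chart_inv c' z) \<noteq> 0" using S_pos by force
        then show "(\<Sum>x\<in>F. of_real (b x (chart_inv c' z)) :: complex) \<noteq> 0"
          unfolding S_def by (simp flip: of_real_sum)
      qed (auto intro!: smooth_on_sum sb)
      then show ?thesis by (simp add: \<rho>_def S_def)
    qed
  qed
  then show ?thesis by (rule that)
qed

end

section \<open>Stokes' formula on the surface\<close>

lemma tendsto_set_integral_remove_disc: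
  fixes w :: "complex \<Rightarrow> complex"
  assumes w: "set_integrable lborel S w" and S: "S \<in> sets borel"
  shows "((\<lambda>e. LINT z:{z\<in>S. e < cmod z}|lborel. w z) \<longlongrightarrow> (LINT z:S|lborel. w z)) (at_right 0)"
proof (rule tendsto_at_right_sequentially[of 0 1])
  fix e :: "nat \<Rightarrow> real" assume e: "\<And>n. 0 < e n" "e \<longlonglongrightarrow> 0"
  let ?f = "\<lambda>z. indicator S z *\<^sub>R w z"
  have i: "integrable lborel ?f" using w by (simp add: set_integrable_def)
  have eq: "indicator {z\<in>S. r < cmod z} z *\<^sub>R w z = indicator {z. r < cmod z} z *\<^sub>R ?f z" for r z
    by (auto simp: indicator_def)
  have o: "open {z::complex. r < cmod z}" for r by (intro open_Collect_less continuous_intros)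
  show "(\<lambda>n. LINT z:{z\<in>S. e n < cmod z}|lborel. w z) \<longlonglongrightarrow> (LINT z:S|lborel. w z)"
    unfolding set_lebesgue_integral_def eq
  proof (rule integral_dominated_convergence[where w = "\<lambda>z. norm (?f z)"])
    show m: "?f \<in> borel_measurable lborel" using i by (rule borel_measurable_integrable)
    show "(\<lambda>z. indicator {z. e n < cmod z} z *\<^sub>R ?f z) \<in> borel_measurable lborel" for n
      by (rule borel_measurable_scaleR[OF borel_measurable_indicator m]) (use o[of "e n"] in simp)
    show "integrable lborel (\<lambda>z. norm (?f z))" using i by (rule integrable_norm)
    show "AE z in lborel. norm (indicator {z. e n < cmod z} z *\<^sub>R ?f z) \<le> norm (?f z)" for n
      by (auto simp: indicator_def)
    show "AE z in lborel. (\<lambda>n. indicator {z. e n < cmod z} z *\<^sub>R ?f z) \<longlonglongrightarrow> ?f z"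
    proof (rule AE_mp[OF AE_not_in_finite[of "{0}"]], simp, intro AE_I2 impI)
      fix z :: complex assume "z \<notin> {0}"
      then have "0 < cmod z" by simp
      with e(2) have "\<forall>\<^sub>F n in sequentially. e n < cmod z" by (rule order_tendstoD)
      then have "\<forall>\<^sub>F n in sequentially. indicator {z. e n < cmod z} z *\<^sub>R ?f z = ?f z"
        by eventually_elim simp
      then show "(\<lambda>n. indicator {z. e n < cmod z} z *\<^sub>R ?f z) \<longlonglongrightarrow> ?f z"
        by (rule tendsto_eventually)
    qed
  qed
qed simp

context riemann
begin

lemma log_2forms_scale:
  assumes s: "smooth_off {} s" and \<omega>: "\<omega> \<in> log_2forms A D"
  shows "(\<lambda>c z. scalar s c z * \<omega> c z) \<in> log_2forms A D"
proof -
  have "smooth_form_off 1 1 A D (\<lambda>c z. scalar s c z * \<omega> c z)"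
    by (rule smooth_form_off_scale[OF smooth_off_subset[OF s] log_2formsD(1)[OF \<omega>]]) simp
  moreover have "pole_at A x 1 (\<lambda>c z. scalar s c z * \<omega> c z)" if x: "x \<in> D" for x
  proof -
    obtain e g r where e: "centred_chart A x e" "0 < r" "ball 0 r \<subseteq> chart_image e" "smooth_on g (ball 0 r)"
      "\<forall>z\<in>ball 0 r - {0}. \<omega> e z = g z / z ^ 1"
      using log_2formsD(2)[OF \<omega> x] unfolding pole_at_def by blast
    have "smooth_on (scalar s e) (chart_image e)"
      using s centred_chartD(1)[OF e(1)] by (simp add: smooth_off_def chart_image_def)
    then have "smooth_on (\<lambda>z. scalar s e z * g z) (ball 0 r)"
      by (rule smooth_on_mult[OF smooth_on_subset e(4)]) (rule e(3))
    then show ?thesis unfolding pole_at_def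
      using e by (intro exI[of _ e] exI[of _ "\<lambda>z. scalar s e z * g z"] exI[of _ r]) simp
  qed
  ultimately show ?thesis by (simp add: log_2forms_def)
qed

text \<open>The support is a closed subset of a compact space. The two forms of vanishing off \<open>K\<close> are for
  points of the whole surface and for coordinates in the chart.\<close>

lemma partition_support_compact:
  assumes comp: "compact_space X" and P: "partition_of_unity X A C \<rho>" and c: "c \<in> C"
  obtains K where "compact K" "K \<subseteq> chart_image c"
    "\<forall>x\<in>topspace X. x \<notin> chart_inv c ` K \<longrightarrow> \<rho> c x = 0" "\<forall>x\<in>fst c. snd c x \<notin> K \<longrightarrow> \<rho> c x = 0"
proof -
  note pf = partition_facts[OF P]
  have cA: "c \<in> A" by (rule pf(2)[OF c])
  let ?cl = "X closure_of {x\<in>topspace X. \<rho> c x \<noteq> 0}"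
  have sub: "?cl \<subseteq> fst c" by (rule pf(6)[OF c])
  have "compactin X ?cl" using comp by (intro closedin_compact_space) auto
  from compact_chart_image[OF cA this sub] have K: "compact (snd c ` ?cl)" .
  have in_cl: "x \<in> ?cl" if "x \<in> topspace X" "\<rho> c x \<noteq> 0" for x
    using closure_of_subset[of "{x\<in>topspace X. \<rho> c x \<noteq> 0}" X] that by auto
  show ?thesis
  proof (rule that[OF K])
    show "snd c ` ?cl \<subseteq> chart_image c" using sub by (auto simp: chart_image_def)
    show "\<forall>x\<in>topspace X. x \<notin> chart_inv c ` snd c ` ?cl \<longrightarrow> \<rho> c x = 0"
    proof (intro ballI impI, rule ccontr)
      fix x assume x: "x \<in> topspace X" "x \<notin> chart_inv c ` snd c ` ?cl" "\<rho> c x \<noteq> 0"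
      then have "x \<in> ?cl" by (intro in_cl)
      then have "chart_inv c (snd c x) = x" using cA sub by auto
      moreover have "chart_inv c (snd c x) \<in> chart_inv c ` snd c ` ?cl"
        using \<open>x \<in> ?cl\<close> by (intro imageI)
      ultimately show False using x(2) by simp
    qed
    show "\<forall>x\<in>fst c. snd c x \<notin> snd c ` ?cl \<longrightarrow> \<rho> c x = 0"
    proof (intro ballI impI, rule ccontr)
      fix x assume x: "x \<in> fst c" "snd c x \<notin> snd c ` ?cl" "\<rho> c x \<noteq> 0"
      then have "x \<in> ?cl" using chart_subset[OF cA] by (intro in_cl) auto
      then show False using x(2) by (simp add: imageI)
    qed
  qed
qed

lemma partition_log_integrable:
  assumes comp: "compact_space X" and P: "partition_of_unity X A C \<rho>" and c: "c \<in> C"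
    and \<omega>: "\<omega> \<in> log_2forms A D" and D: "finite D"
  shows "set_integrable lborel (chart_image c) (\<lambda>z. of_real (\<rho> c (chart_inv c z)) * \<omega> c z * k)"
proof -
  note pf = partition_facts[OF P]
  obtain K where K: "compact K" "K \<subseteq> chart_image c"
    "\<forall>x\<in>topspace X. x \<notin> chart_inv c ` K \<longrightarrow> \<rho> c x = 0" "\<forall>x\<in>fst c. snd c x \<notin> K \<longrightarrow> \<rho> c x = 0"
    using partition_support_compact[OF comp P c] .
  have "set_integrable lborel (chart_image c) (\<lambda>z. scalar (\<lambda>x. of_real (\<rho> c x)) c z * \<omega> c z * k)"
    by (rule log_form_integrable[OF log_2forms_scale[OF pf(3)[OF c] \<omega>] D pf(2)[OF c] K(1,2)])
      (use K(4) pf(2)[OF c] in simp)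
  then show ?thesis by (simp only: scalar_def)
qed

lemma wirtinger_cong_local:
  assumes c: "c \<in> A" and D: "finite D" and f: "smooth_on f (snd c ` (fst c - D))"
    and f': "smooth_on f' (snd c ` (fst c - D))"
    and N: "openin X N" and x: "x \<in> fst c" "x \<in> N" "x \<notin> D"
    and eq: "\<And>y. y \<in> fst c \<Longrightarrow> y \<in> N \<Longrightarrow> y \<notin> D \<Longrightarrow> f (snd c y) = f' (snd c y)"
  shows "wirtinger_z (chart_image c) f (snd c x) = wirtinger_z (chart_image c) f' (snd c x)"
    and "wirtinger_zbar (chart_image c) f (snd c x) = wirtinger_zbar (chart_image c) f' (snd c x)"
proof -
  obtain T where T: "open T" "\<forall>y\<in>fst c. snd c y \<in> T \<longleftrightarrow> y \<in> N" using chart_open_image[OF c N] .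
  let ?T = "T \<inter> - snd c ` (fst c \<inter> D)" and ?S = "chart_image c"
  have x': "x \<in> fst c - D" using x by simp
  have "snd c x \<in> ?S \<inter> - snd c ` (fst c \<inter> D)"
    unfolding chart_image_minus[OF c, symmetric] using x' by (rule imageI)
  then have xT: "snd c x \<in> ?T" using T(2) x by simp
  have o: "open ?T" using T(1) open_Compl_finite_image[OF D] by (rule open_Int)
  have S: "snd c x \<in> ?S" by (rule chart_in_image[OF x(1)])
  have "has_wirtinger f' (wirtinger_z ?S f (snd c x)) (wirtinger_zbar ?S f (snd c x)) (at (snd c x) within ?S)"
  proof (rule has_wirtinger_transform[OF coefficient_wirtinger(1)[OF f D c x'] o xT S])
    fix w assume w: "w \<in> ?T \<inter> ?S"
    then obtain y where y: "y \<in> fst c" "w = snd c y" by (auto simp: chart_image_def)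
    then have "y \<in> N" "y \<notin> D" using w T(2) by auto
    then show "f w = f' w" using eq y by simp
  qed
  from has_wirtinger_unique[OF chart_model[OF c] S this coefficient_wirtinger(1)[OF f' D c x']]
  show "wirtinger_z ?S f (snd c x) = wirtinger_z ?S f' (snd c x)"
    "wirtinger_zbar ?S f (snd c x) = wirtinger_zbar ?S f' (snd c x)" .
qed

lemma ext_d_cong_local:
  assumes c: "c \<in> A" and D: "finite D"
    and f: "smooth_form_off 1 0 A D a" "smooth_form_off 0 1 A D b" "smooth_form_off 1 0 A D a'" "smooth_form_off 0 1 A D b'"
    and N: "openin X N" and x: "x \<in> fst c" "x \<in> N" "x \<notin> D"
    and eq: "\<And>y. y \<in> fst c \<Longrightarrow> y \<in> N \<Longrightarrow> y \<notin> D \<Longrightarrow> a c (snd c y) = a' c (snd c y)"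
      "\<And>y. y \<in> fst c \<Longrightarrow> y \<in> N \<Longrightarrow> y \<notin> D \<Longrightarrow> b c (snd c y) = b' c (snd c y)"
  shows "ext_d (a, b) c (snd c x) = ext_d (a', b') c (snd c x)"
proof -
  have "wirtinger_zbar (chart_image c) (a c) (snd c x) = wirtinger_zbar (chart_image c) (a' c) (snd c x)"
    by (rule wirtinger_cong_local(2)[OF c D smooth_form_offD[OF f(1) c] smooth_form_offD[OF f(3) c] N x])
      (rule eq(1))
  moreover have "wirtinger_z (chart_image c) (b c) (snd c x) = wirtinger_z (chart_image c) (b' c) (snd c x)"
    by (rule wirtinger_cong_local(1)[OF c D smooth_form_offD[OF f(2) c] smooth_form_offD[OF f(4) c] N x])
      (rule eq(2))
  ultimately show ?thesis by (simp add: ext_d_def delbar_10_def del_01_def)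
qed

lemma ext_d_sum:
  assumes c: "c \<in> A" and D: "finite D" and I: "finite I"
    and f: "\<And>i. i \<in> I \<Longrightarrow> smooth_form_off 1 0 A D (a i)" "\<And>i. i \<in> I \<Longrightarrow> smooth_form_off 0 1 A D (b i)"
    and f': "smooth_form_off 1 0 A D a'" "smooth_form_off 0 1 A D b'" and x: "x \<in> fst c" "x \<notin> D"
    and eq: "\<And>y. y \<in> fst c \<Longrightarrow> y \<notin> D \<Longrightarrow> a' c (snd c y) = (\<Sum>i\<in>I. a i c (snd c y))"
      "\<And>y. y \<in> fst c \<Longrightarrow> y \<notin> D \<Longrightarrow> b' c (snd c y) = (\<Sum>i\<in>I. b i c (snd c y))"
  shows "ext_d (a', b') c (snd c x) = (\<Sum>i\<in>I. ext_d (a i, b i) c (snd c x))"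
proof -
  let ?S = "chart_image c" and ?z = "snd c x"
  have x': "x \<in> fst c - D" using x by simp
  have S: "?z \<in> ?S" by (rule chart_in_image[OF x(1)])
  have N: "openin X (topspace X)" by simp
  have xN: "x \<in> topspace X" using chart_subset[OF c] x by blast
  have sa: "smooth_on (\<lambda>z. \<Sum>i\<in>I. a i c z) (snd c ` (fst c - D))"
    by (intro smooth_on_sum smooth_form_offD[OF f(1) c])
  have sb: "smooth_on (\<lambda>z. \<Sum>i\<in>I. b i c z) (snd c ` (fst c - D))"
    by (intro smooth_on_sum smooth_form_offD[OF f(2) c])
  have "has_wirtinger (\<lambda>z. \<Sum>i\<in>I. a i c z) (\<Sum>i\<in>I. wirtinger_z ?S (a i c) ?z) (\<Sum>i\<in>I. wirtinger_zbar ?S (a i c) ?z) (at ?z within ?S)"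
    by (intro has_wirtinger_sum coefficient_wirtinger(1)[OF smooth_form_offD[OF f(1) c] D c x'])
  from has_wirtinger_imp_eq(2)[OF chart_model[OF c] S this]
  have 1: "wirtinger_zbar ?S (a' c) ?z = (\<Sum>i\<in>I. wirtinger_zbar ?S (a i c) ?z)"
    using wirtinger_cong_local(2)[OF c D smooth_form_offD[OF f'(1) c] sa N x(1) xN x(2)] eq(1) by simp
  have "has_wirtinger (\<lambda>z. \<Sum>i\<in>I. b i c z) (\<Sum>i\<in>I. wirtinger_z ?S (b i c) ?z) (\<Sum>i\<in>I. wirtinger_zbar ?S (b i c) ?z) (at ?z within ?S)"
    by (intro has_wirtinger_sum coefficient_wirtinger(1)[OF smooth_form_offD[OF f(2) c] D c x'])
  from has_wirtinger_imp_eq(1)[OF chart_model[OF c] S this]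
  have 2: "wirtinger_z ?S (b' c) ?z = (\<Sum>i\<in>I. wirtinger_z ?S (b i c) ?z)"
    using wirtinger_cong_local(1)[OF c D smooth_form_offD[OF f'(2) c] sb N x(1) xN x(2)] eq(2) by simp
  show ?thesis by (simp add: ext_d_def delbar_10_def del_01_def 1 2 sum_subtractf)
qed

lemma log_2forms_empty: "smooth_form_off 1 1 A {} \<omega> \<Longrightarrow> \<omega> \<in> log_2forms A {}"
  by (simp add: log_2forms_def)

lemma ext_d_eq: "ext_d (a, b) c z = wirtinger_z (chart_image c) (b c) z - wirtinger_zbar (chart_image c) (a c) z"
  by (simp add: ext_d_def delbar_10_def del_01_def)

lemma ext_d_zero_off_support:
  assumes D: "finite D" and a: "smooth_form_off 1 0 A D a" and b: "smooth_form_off 0 1 A D b"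
    and F: "closedin X F"
    and zero: "\<And>c x. c \<in> A \<Longrightarrow> x \<in> fst c \<Longrightarrow> x \<notin> F \<Longrightarrow> a c (snd c x) = 0 \<and> b c (snd c x) = 0"
    and c: "c \<in> A" and x: "x \<in> fst c" "x \<notin> F" "x \<notin> D"
  shows "ext_d (a, b) c (snd c x) = 0"
proof -
  let ?N = "topspace X - F"
  have N: "openin X ?N" using F by (simp add: openin_diff)
  have xN: "x \<in> ?N" using chart_subset[OF c] x by blast
  have z: "smooth_on (\<lambda>z. 0) S" for S by (rule smooth_on_const)
  have S: "snd c x \<in> chart_image c" by (rule chart_in_image[OF x(1)])
  have "wirtinger_zbar (chart_image c) (a c) (snd c x) = wirtinger_zbar (chart_image c) (\<lambda>z. 0) (snd c x)"
    by (rule wirtinger_cong_local(2)[OF c D smooth_form_offD[OF a c] z N x(1) xN x(3)]) (use zero[OF c] in auto)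
  moreover have "wirtinger_z (chart_image c) (b c) (snd c x) = wirtinger_z (chart_image c) (\<lambda>z. 0) (snd c x)"
    by (rule wirtinger_cong_local(1)[OF c D smooth_form_offD[OF b c] z N x(1) xN x(3)]) (use zero[OF c] in auto)
  ultimately show ?thesis
    using has_wirtinger_imp_eq[OF chart_model[OF c] S has_wirtinger_const[of 0]] by (simp add: ext_d_eq)
qed

text \<open>Integrals are defined through some partition of unity; these are the values for a given one,
  which must be kept apart until they are known to agree.\<close>

abbreviation surface_sum :: "'a chart set \<Rightarrow> ('a chart \<Rightarrow> 'a \<Rightarrow> real) \<Rightarrow> 'a form \<Rightarrow> complex" where
  "surface_sum C \<rho> \<omega> \<equiv> (\<Sum>c\<in>C. LINT z:chart_image c|lborel. of_real (\<rho> c (chart_inv c z)) * \<omega> c z * (- 2 * \<i>))"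

abbreviation boundary_sum ::
  "'a chart set \<Rightarrow> ('a chart \<Rightarrow> 'a \<Rightarrow> real) \<Rightarrow> 'a form \<Rightarrow> 'a form \<Rightarrow> complex" where
  "boundary_sum C \<rho> a b \<equiv> (\<Sum>c\<in>C. LINT x:boundary_trace A c|lborel.
     of_real (\<rho> c (chart_inv c (of_real x))) * (a c (of_real x) + b c (of_real x)))"

lemma stokes_single_chart:
  assumes comp: "compact_space X" and P: "partition_of_unity X A C \<rho>"
    and a: "smooth_form_off 1 0 A {} a" and b: "smooth_form_off 0 1 A {} b"
    and e: "e \<in> A" and K: "compact K" "K \<subseteq> chart_image e"
    and zero: "\<And>c x. c \<in> A \<Longrightarrow> x \<in> fst c \<Longrightarrow> x \<notin> chart_inv e ` K \<Longrightarrow> a c (snd c x) = 0 \<and> b c (snd c x) = 0"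
  shows "set_integrable lborel (boundary_trace A e) (\<lambda>x. a e (of_real x) + b e (of_real x))"
    and "(surface_sum C \<rho> (ext_d (a, b)))
      = (LINT x:boundary_trace A e|lborel. a e (of_real x) + b e (of_real x))"
proof -
  have fin: "finite {}" by simp
  have d: "smooth_form_off 1 1 A {} (ext_d (a, b))" by (rule smooth_form_off_ext_d[OF a b fin])
  have F: "closedin X (chart_inv e ` K)" by (rule closedin_chart_compact[OF e K])
  have dz: "ext_d (a, b) c (snd c x) = 0" if "c \<in> A" "x \<in> fst c" "x \<notin> fst e" for c x
  proof (rule ext_d_zero_off_support[OF fin a b F zero that(1,2)])
    show "x \<notin> chart_inv e ` K" using that(3) K(2) chart_inv_in by blast
  qed auto
  have s: "smooth_on (a e) (chart_image e)" "smooth_on (b e) (chart_image e)"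
    using smooth_form_offD[OF a e] smooth_form_offD[OF b e] by (simp_all add: chart_image_def)
  have z: "a e z = 0" "b e z = 0" if z: "z \<in> chart_image e - K" for z
  proof -
    have "chart_inv e z \<notin> chart_inv e ` K"
    proof
      assume "chart_inv e z \<in> chart_inv e ` K"
      then obtain w where w: "w \<in> K" "chart_inv e z = chart_inv e w" by blast
      then have "z = w" using z K(2) chart_inv_right[of z e] chart_inv_right[of w e] by auto
      then show False using w z by blast
    qed
    from zero[OF e chart_inv_in this] z show "a e z = 0" "b e z = 0" by auto
  qed
  have B: "boundary_trace A e = (if chart_half e = UNIV then {} else {x. complex_of_real x \<in> chart_image e})"
    by (rule boundary_trace_eq[OF e])
  note st = stokes_compact_support[OF chart_half_cases chart_half_openin[OF e] s K z, folded B ext_d_eq]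
  show "set_integrable lborel (boundary_trace A e) (\<lambda>x. a e (of_real x) + b e (of_real x))"
    by (rule st(2))
  have "(surface_sum C \<rho> (ext_d (a, b)))
     = (LINT z:chart_image e|lborel. ext_d (a, b) e z * (- 2 * \<i>))"
    by (rule single_chart_integral(2)[OF P fin d e dz partition_log_integrable[OF comp P _ log_2forms_empty[OF d] fin]])
  also have "\<dots> = (LINT x:boundary_trace A e|lborel. a e (of_real x) + b e (of_real x))"
    by (rule st(3))
  finally show "(surface_sum C \<rho> (ext_d (a, b)))
      = (LINT x:boundary_trace A e|lborel. a e (of_real x) + b e (of_real x))" .
qed

text \<open>The partition of unity on the right cuts the form into pieces supported in one chart. The one on
  the left only serves to evaluate surface integrals and is unrelated to the first; in
  consequence neither side depends on its partition.\<close>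

lemma stokes_smooth:
  assumes comp: "compact_space X" and P: "partition_of_unity X A C \<rho>" and P': "partition_of_unity X A C' \<rho>'"
    and a: "smooth_form_off 1 0 A {} a" and b: "smooth_form_off 0 1 A {} b"
  shows "\<And>e. e \<in> C' \<Longrightarrow> set_integrable lborel (boundary_trace A e)
      (\<lambda>x. of_real (\<rho>' e (chart_inv e (of_real x))) * (a e (of_real x) + b e (of_real x)))"
    and "(surface_sum C \<rho> (ext_d (a, b)))
      = (boundary_sum C' \<rho>' a b)"
proof -
  note pf = partition_facts[OF P] and pf' = partition_facts[OF P']
  define s where "s e = scalar (\<lambda>x. complex_of_real (\<rho>' e x))" for e
  define a' where "a' e = (\<lambda>c z. s e c z * a c z)" for e
  define b' where "b' e = (\<lambda>c z. s e c z * b c z)" for e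
  have fin: "finite {}" by simp
  have fa: "smooth_form_off 1 0 A {} (a' e)" and fb: "smooth_form_off 0 1 A {} (b' e)" if e: "e \<in> C'" for e
    unfolding a'_def b'_def s_def by (rule smooth_form_off_scale[OF pf'(3)[OF e] a], rule smooth_form_off_scale[OF pf'(3)[OF e] b])
  have one: "set_integrable lborel (boundary_trace A e) (\<lambda>x. a' e e (of_real x) + b' e e (of_real x))
    \<and> (\<Sum>c\<in>C. LINT z:chart_image c|lborel. of_real (\<rho> c (chart_inv c z)) * ext_d (a' e, b' e) c z * (- 2 * \<i>))
      = (LINT x:boundary_trace A e|lborel. a' e e (of_real x) + b' e e (of_real x))" if e: "e \<in> C'" for e
  proof -
    obtain K where K: "compact K" "K \<subseteq> chart_image e" "\<forall>x\<in>topspace X. x \<notin> chart_inv e ` K \<longrightarrow> \<rho>' e x = 0"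
      "\<forall>x\<in>fst e. snd e x \<notin> K \<longrightarrow> \<rho>' e x = 0"
      using partition_support_compact[OF comp P' e] .
    have "a' e c (snd c x) = 0 \<and> b' e c (snd c x) = 0" if "c \<in> A" "x \<in> fst c" "x \<notin> chart_inv e ` K" for c x
    proof -
      have "\<rho>' e x = 0" using K(3) that chart_subset[OF that(1)] by blast
      then show ?thesis using that by (simp add: a'_def b'_def s_def)
    qed
    from stokes_single_chart[OF comp P fa[OF e] fb[OF e] pf'(2)[OF e] K(1,2) this] show ?thesis by blast
  qed
  have eq: "a' e e (of_real x) + b' e e (of_real x)
     = of_real (\<rho>' e (chart_inv e (of_real x))) * (a e (of_real x) + b e (of_real x))" for e x
    by (simp add: a'_def b'_def s_def scalar_def algebra_simps)
  show "set_integrable lborel (boundary_trace A e)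
      (\<lambda>x. of_real (\<rho>' e (chart_inv e (of_real x))) * (a e (of_real x) + b e (of_real x)))" if "e \<in> C'" for e
    using one[OF that] unfolding eq by (rule conjunct1)
  have sum1: "(\<Sum>e\<in>C'. s e c (snd c y)) = 1" if c: "c \<in> A" and y: "y \<in> fst c" for c y
  proof -
    have "(\<Sum>e\<in>C'. s e c (snd c y)) = of_real (\<Sum>e\<in>C'. \<rho>' e y)" using c y by (simp add: s_def)
    moreover have "y \<in> topspace X" by (rule subsetD[OF chart_subset[OF c] y])
    ultimately show ?thesis by (simp only: pf'(5) of_real_1)
  qed
  have dsum: "ext_d (a, b) c (snd c x) = (\<Sum>e\<in>C'. ext_d (a' e, b' e) c (snd c x))" if c: "c \<in> A" and x: "x \<in> fst c" for c x
  proof (rule ext_d_sum[OF c fin pf'(1) fa fb a b x])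
    fix y assume y: "y \<in> fst c"
    show "a c (snd c y) = (\<Sum>e\<in>C'. a' e c (snd c y))"
      unfolding a'_def sum_distrib_right[symmetric] sum1[OF c y] by simp
    show "b c (snd c y) = (\<Sum>e\<in>C'. b' e c (snd c y))"
      unfolding b'_def sum_distrib_right[symmetric] sum1[OF c y] by simp
  qed simp_all
  let ?g = "\<lambda>e c z. of_real (\<rho> c (chart_inv c z)) * ext_d (a' e, b' e) c z * (- 2 * \<i>)"
  have gi: "set_integrable lborel (chart_image c) (?g e c)" if "e \<in> C'" "c \<in> C" for e c
    by (rule partition_log_integrable[OF comp P that(2) log_2forms_empty fin])
      (rule smooth_form_off_ext_d[OF fa[OF that(1)] fb[OF that(1)] fin])
  have "(LINT z:chart_image c|lborel. of_real (\<rho> c (chart_inv c z)) * ext_d (a, b) c z * (- 2 * \<i>))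
     = (\<Sum>e\<in>C'. LINT z:chart_image c|lborel. ?g e c z)" if c: "c \<in> C" for c
  proof -
    have *: "indicator (chart_image c) z *\<^sub>R (of_real (\<rho> c (chart_inv c z)) * ext_d (a, b) c z * (- 2 * \<i>))
       = (\<Sum>e\<in>C'. indicator (chart_image c) z *\<^sub>R ?g e c z)" for z
    proof (cases "z \<in> chart_image c")
      case True
      then obtain x where x: "x \<in> fst c" "z = snd c x" by (auto simp: chart_image_def)
      show ?thesis unfolding x(2) dsum[OF pf(2)[OF c] x(1)]
        by (simp only: sum_distrib_left sum_distrib_right scaleR_sum_right)
    qed simp
    show ?thesis unfolding set_lebesgue_integral_def *
      by (rule Bochner_Integration.integral_sum) (use gi[OF _ c] in \<open>simp add: set_integrable_def\<close>)
  qed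
  then have "(surface_sum C \<rho> (ext_d (a, b)))
     = (\<Sum>c\<in>C. \<Sum>e\<in>C'. LINT z:chart_image c|lborel. ?g e c z)" by (rule sum.cong[OF refl])
  also have "\<dots> = (\<Sum>e\<in>C'. \<Sum>c\<in>C. LINT z:chart_image c|lborel. ?g e c z)" by (rule sum.swap)
  also have "\<dots> = (\<Sum>e\<in>C'. LINT x:boundary_trace A e|lborel. a' e e (of_real x) + b' e e (of_real x))"
    by (rule sum.cong[OF refl]) (rule conjunct2[OF one])
  finally show "(surface_sum C \<rho> (ext_d (a, b)))
      = (boundary_sum C' \<rho>' a b)"
    unfolding eq .
qed

definition chart_cutoff :: "'a chart \<Rightarrow> real \<Rightarrow> 'a \<Rightarrow> complex" where
  "chart_cutoff e r = chart_ext e (\<lambda>z. of_real (cutoff r z))"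

lemma chart_cutoff_facts:
  assumes e: "e \<in> A" and r: "0 < r" "cball 0 r \<subseteq> chart_image e"
  shows "smooth_off {} (chart_cutoff e r)"
    and "\<And>x. x \<notin> chart_inv e ` cball 0 r \<Longrightarrow> chart_cutoff e r x = 0"
    and "\<And>x. x \<in> fst e \<Longrightarrow> snd e x \<in> ball 0 (r / 2) \<Longrightarrow> chart_cutoff e r x = 1"
proof -
  have z: "complex_of_real (cutoff r z) = 0" if "z \<in> chart_image e - cball 0 r" for z
    using that r by (simp add: cutoff_eq_0)
  show "smooth_off {} (chart_cutoff e r)" unfolding chart_cutoff_def
    by (rule smooth_off_chart_ext[OF e compact_cball r(2) z smooth_on_cutoff[OF r(1)]])
  show "chart_cutoff e r x = 0" if "x \<notin> chart_inv e ` cball 0 r" for x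
    unfolding chart_cutoff_def by (rule chart_ext_zero[OF e z that])
  show "chart_cutoff e r x = 1" if "x \<in> fst e" "snd e x \<in> ball 0 (r / 2)" for x
    using that r by (simp add: chart_cutoff_def chart_ext_def cutoff_eq_1)
qed

text \<open>The piece of a form around one pole \<open>p\<close>. The derivative of the piece is \<open>\<eta>\<close> near \<open>p\<close> and zero near the
  other singular points, hence logarithmic and integrable. The integral over the complement of a
  disc around \<open>p\<close> is minus a circle integral by the formula for an annulus; as the disc shrinks it
  tends to the integral over the surface, and so the circle integrals have a limit.\<close>

lemma stokes_pole:
  assumes comp: "compact_space X" and P: "partition_of_unity X A C \<rho>" and D: "finite D" and p: "p \<in> D"
    and e: "centred_chart A p e" and r: "0 < r" "ball 0 r \<subseteq> chart_image e" "\<forall>z\<in>ball 0 r - {0}. chart_inv e z \<notin> D"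
    and a: "smooth_form_off 1 0 A D a" and b: "smooth_form_off 0 1 A D b"
    and \<eta>: "\<eta> \<in> log_2forms A D"
    and d: "\<And>c x. c \<in> A \<Longrightarrow> x \<in> fst c \<Longrightarrow> x \<notin> D \<Longrightarrow> ext_d (a, b) c (snd c x) = \<eta> c (snd c x)"
  defines "s \<equiv> scalar (chart_cutoff e (r / 2))"
  defines "a' \<equiv> \<lambda>c z. s c z * a c z" and "b' \<equiv> \<lambda>c z. s c z * b c z"
  shows "ext_d (a', b') \<in> log_2forms A D"
    and "((\<lambda>\<epsilon>. circle_integral (a, b) e \<epsilon>) \<longlongrightarrow>
      - (surface_sum C \<rho> (ext_d (a', b')))) (at_right 0)"
proof -
  note ed = centred_chartD[OF e]
  let ?F = "chart_inv e ` cball 0 (r / 2)"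
  have cb: "cball 0 (r / 2) \<subseteq> chart_image e" using r(1,2) by (auto intro!: subsetD[OF r(2)])
  have r2: "0 < r / 2" using r by simp
  note cc = chart_cutoff_facts[OF ed(1) r2 cb]
  have fa: "smooth_form_off 1 0 A D a'" and fb: "smooth_form_off 0 1 A D b'"
    unfolding a'_def b'_def s_def
    by (rule smooth_form_off_scale[OF smooth_off_subset[OF cc(1)] a], simp)
      (rule smooth_form_off_scale[OF smooth_off_subset[OF cc(1)] b], simp)
  have F: "closedin X ?F" by (rule closedin_chart_compact[OF ed(1) compact_cball cb])
  have sm: "smooth_form_off 1 1 A D (ext_d (a', b'))" by (rule smooth_form_off_ext_d[OF fa fb D])
  have zero: "a' c (snd c x) = 0 \<and> b' c (snd c x) = 0" if "c \<in> A" "x \<in> fst c" "x \<notin> ?F" for c x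
    using that cc(2)[of x] by (simp add: a'_def b'_def s_def)
  have dz: "ext_d (a', b') c (snd c x) = 0" if "c \<in> A" "x \<in> fst c" "x \<notin> ?F" "x \<notin> D" for c x
    by (rule ext_d_zero_off_support[OF D fa fb F zero that])
  let ?N = "{y \<in> fst e. snd e y \<in> ball 0 (r / 2 / 2)}"
  have N: "openin X ?N" by (rule chart_preimage_open[OF ed(1) open_ball])
  have dN: "ext_d (a', b') c (snd c x) = \<eta> c (snd c x)" if "c \<in> A" "x \<in> fst c" "x \<in> ?N" "x \<notin> D" for c x
  proof -
    have "ext_d (a', b') c (snd c x) = ext_d (a, b) c (snd c x)"
      by (rule ext_d_cong_local[OF that(1) D fa fb a b N that(2,3,4)])
        (use that(1) cc(3) in \<open>auto simp: a'_def b'_def s_def\<close>)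
    then show ?thesis using d that by simp
  qed
  have "pole_at A x 1 (ext_d (a', b'))" if x: "x \<in> D" for x
  proof -
    obtain q g t where q: "centred_chart A x q" "0 < t" "ball 0 t \<subseteq> chart_image q" "smooth_on g (ball 0 t)"
      "\<forall>z\<in>ball 0 t - {0}. \<eta> q z = g z / z ^ 1"
      using log_2formsD(2)[OF \<eta> x] unfolding pole_at_def by blast
    note qd = centred_chartD[OF q(1)]
    obtain t1 where t1: "t1 > 0" "ball 0 t1 \<subseteq> chart_image q" "\<forall>z\<in>ball 0 t1 - {0}. chart_inv q z \<notin> D"
      using centred_chart_ball[OF q(1) D] .
    define M where "M = (if x = p then ?N else topspace X - ?F)"
    have M: "openin X M" using N F by (simp add: M_def openin_diff)
    have xM: "x \<in> M"
    proof (cases "x = p")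
      case True
      then show ?thesis using ed r by (simp add: M_def)
    next
      case False
      have "x \<notin> ?F"
      proof
        assume "x \<in> ?F"
        then obtain z :: complex where z: "z \<in> cball 0 (r / 2)" "x = chart_inv e z" by blast
        then have "z \<noteq> 0" using ed(5) False by auto
        moreover have "z \<in> ball 0 r" using z r by simp
        ultimately show False using r(3) z x by blast
      qed
      then show ?thesis using False chart_subset[OF qd(1)] qd(2) by (auto simp: M_def)
    qed
    obtain T where T: "open T" "\<forall>y\<in>fst q. snd q y \<in> T \<longleftrightarrow> y \<in> M" using chart_open_image[OF qd(1) M] .
    have "0 \<in> T \<inter> ball 0 t \<inter> ball 0 t1" using T(2) xM qd(2,3) q(2) t1(1) by (metis IntI centre_in_ball)
    moreover have "open (T \<inter> ball 0 t \<inter> ball 0 t1)" using T(1) by (intro open_Int open_ball)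
    ultimately obtain t2 where t2: "t2 > 0" "ball 0 t2 \<subseteq> T \<inter> ball 0 t \<inter> ball 0 t1" by (metis openE)
    define g' where "g' = (if x = p then g else (\<lambda>z. 0))"
    have "smooth_on g' (ball 0 t2)"
      unfolding g'_def using smooth_on_subset[OF q(4)] t2(2) smooth_on_const[of 0] by auto
    moreover have "\<forall>z\<in>ball 0 t2 - {0}. ext_d (a', b') q z = g' z / z ^ 1"
    proof
      fix z :: complex assume z: "z \<in> ball 0 t2 - {0}"
      then have zz: "z \<in> T" "z \<in> ball 0 t - {0}" "z \<in> ball 0 t1 - {0}" using t2(2) by auto
      have zi: "z \<in> chart_image q" using t1(2) zz(3) by blast
      let ?y = "chart_inv q z"
      have y: "?y \<in> fst q" "snd q ?y = z" "?y \<notin> D" using chart_inv_in[OF zi] zi t1(3) zz(3) by auto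
      have yM: "?y \<in> M" using bspec[OF T(2) y(1)] zz(1) unfolding y(2) by (rule iffD1)
      show "ext_d (a', b') q z = g' z / z ^ 1"
      proof (cases "x = p")
        case True
        have "?y \<in> ?N" using yM unfolding M_def True by (simp only: simp_thms if_True)
        from dN[OF qd(1) y(1) this y(3)] show ?thesis using True q(5) zz(2) y(2) by (simp add: g'_def)
      next
        case False
        then have "?y \<notin> ?F" using yM by (simp add: M_def)
        from dz[OF qd(1) y(1) this y(3)] show ?thesis using False y(2) by (simp add: g'_def)
      qed
    qed
    moreover have "ball 0 t2 \<subseteq> chart_image q" using t2(2) t1(2) by blast
    ultimately show ?thesis unfolding pole_at_def using q(1) t2(1) by (intro exI conjI)
  qed
  with sm show log: "ext_d (a', b') \<in> log_2forms A D" by (simp add: log_2forms_def)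
  have dz': "ext_d (a', b') c (snd c x) = 0" if "c \<in> A" "x \<in> fst c" "x \<notin> fst e" "x \<notin> D" for c x
  proof (rule dz[OF that(1,2) _ that(4)])
    show "x \<notin> ?F"
    proof
      assume "x \<in> ?F"
      then obtain z where "z \<in> cball 0 (r / 2)" "x = chart_inv e z" by blast
      then show False using that(3) chart_inv_in[OF subsetD[OF cb]] by simp
    qed
  qed
  let ?w = "\<lambda>z. (wirtinger_z (chart_image e) (b' e) z - wirtinger_zbar (chart_image e) (a' e) z) * (- 2 * \<i>)"
  note sc = single_chart_integral[OF P D sm ed(1) dz' partition_log_integrable[OF comp P _ log D], unfolded ext_d_eq[of a' b' e]]
  let ?I = "(surface_sum C \<rho> (ext_d (a', b')))"
  have int: "set_integrable lborel (chart_image e) ?w" using sc(1)[of "- 2 * \<i>"] .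
  have val: "?I = (LINT z:chart_image e|lborel. ?w z)" using sc(2)[of "- 2 * \<i>"] .
  have lim: "((\<lambda>\<epsilon>. - (LINT z:{z\<in>chart_image e. \<epsilon> < cmod z}|lborel. ?w z)) \<longlongrightarrow> - ?I) (at_right 0)"
    unfolding val
    by (intro tendsto_minus tendsto_set_integral_remove_disc[OF int] model_set_borel chart_model ed(1))
  have sub: "chart_image e \<inter> - {0} \<subseteq> chart_image e" by blast
  have zero': "a' e z = 0 \<and> b' e z = 0" if z: "z \<in> chart_image e - cball 0 (r / 2)" for z
  proof -
    have "chart_inv e z \<notin> ?F"
    proof
      assume "chart_inv e z \<in> ?F"
      then obtain w where w: "w \<in> cball 0 (r / 2)" "chart_inv e z = chart_inv e w" by (rule imageE) (rule that)
      have "z \<in> chart_image e" using z by (rule DiffD1)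
      from chart_inv_right[OF this] have "z = snd e (chart_inv e w)" unfolding w(2) by (rule sym)
      also have "\<dots> = w" by (rule chart_inv_right[OF subsetD[OF cb w(1)]])
      finally show False using DiffD2[OF z] w(1) by simp
    qed
    from zero[OF ed(1) chart_inv_in this] z show ?thesis by auto
  qed
  have smooth_punctured: "smooth_on f (chart_image e \<inter> - {0})"
    if f: "smooth_on f (snd e ` (fst e - D))" and f0: "\<And>z. z \<in> chart_image e - cball 0 (r / 2) \<Longrightarrow> f z = 0" for f
  proof (rule smooth_on_local)
    fix z assume z: "z \<in> chart_image e \<inter> - {0}"
    show "\<exists>T. open T \<and> z \<in> T \<and> smooth_on f (chart_image e \<inter> - {0} \<inter> T)"
    proof (cases "z \<in> ball 0 r")
      case True
      have "smooth_on f (chart_image e \<inter> - {0} \<inter> ball 0 r)"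
      proof (rule smooth_on_subset[OF f], rule subsetI)
        fix w assume "w \<in> chart_image e \<inter> - {0} \<inter> ball 0 r"
        then show "w \<in> snd e ` (fst e - D)"
          unfolding mem_chart_image_minus[OF ed(1)] using r(3) by blast
      qed
      then show ?thesis using True open_ball by blast
    next
      case False
      have "smooth_on f (chart_image e \<inter> - {0} \<inter> - cball 0 (r / 2))"
        by (rule smooth_on_cong[OF smooth_on_const[of 0]]) (use f0 in auto)
      moreover have "open (- cball 0 (r / 2) :: complex set)" by (simp add: open_Compl)
      moreover have "z \<in> - cball 0 (r / 2)" using False r(1) by auto
      ultimately show ?thesis by blast
    qed
  qed
  have su: "smooth_on (a' e) (chart_image e \<inter> - {0})" and sv: "smooth_on (b' e) (chart_image e \<inter> - {0})"
    by (rule smooth_punctured[OF smooth_form_offD[OF fa ed(1)]], use zero' in blast)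
      (rule smooth_punctured[OF smooth_form_offD[OF fb ed(1)]], use zero' in blast)
  show "((\<lambda>\<epsilon>. circle_integral (a, b) e \<epsilon>) \<longlongrightarrow> - ?I) (at_right 0)"
  proof (rule Lim_transform_eventually[OF lim])
    show "\<forall>\<^sub>F \<epsilon> in at_right 0. - (LINT z:{z\<in>chart_image e. \<epsilon> < cmod z}|lborel. ?w z) = circle_integral (a, b) e \<epsilon>"
    proof (rule eventually_mono[OF eventually_at_right_real[of 0 "r / 4"]])
      show "0 < r / 4" using r by simp
      fix \<epsilon> assume eps: "\<epsilon> \<in> {0<..<r / 4}"
      have e1: "0 < \<epsilon>" "\<epsilon> < r / 2" "r / 2 < r" using eps r(1) by auto
      have "(LINT z:{z\<in>chart_image e. \<epsilon> < cmod z}|lborel. ?w z)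
        = - integral {0..2 * pi} (\<lambda>t. a' e (of_real \<epsilon> * cis t) * (\<i> * (of_real \<epsilon> * cis t))
            + b' e (of_real \<epsilon> * cis t) * cnj (\<i> * (of_real \<epsilon> * cis t)))"
        by (rule annulus_stokes[OF ed(4) r(2) e1(3) su sv _ _ e1(1,2)]) (use zero' in blast)+
      also have "integral {0..2 * pi} (\<lambda>t. a' e (of_real \<epsilon> * cis t) * (\<i> * (of_real \<epsilon> * cis t))
            + b' e (of_real \<epsilon> * cis t) * cnj (\<i> * (of_real \<epsilon> * cis t))) = circle_integral (a, b) e \<epsilon>"
        unfolding circle_integral_def Let_def fst_conv snd_conv
      proof (rule integral_cong)
        fix t
        let ?z = "of_real \<epsilon> * cis t"
        have n: "cmod ?z = \<epsilon>" using e1 by (simp add: norm_mult)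
        have "?z \<in> ball 0 r" using n e1 by simp
        then have zS: "?z \<in> chart_image e" by (rule subsetD[OF r(2)])
        have "s e ?z = 1" unfolding s_def scalar_def
          by (rule cc(3)[OF chart_inv_in[OF zS]]) (use n eps zS in simp)
        then show "a' e ?z * (\<i> * ?z) + b' e ?z * cnj (\<i> * ?z) = a e ?z * (\<i> * ?z) + b e ?z * cnj (\<i> * ?z)"
          by (simp add: a'_def b'_def)
      qed
      finally show "- (LINT z:{z\<in>chart_image e. \<epsilon> < cmod z}|lborel. ?w z) = circle_integral (a, b) e \<epsilon>"
        by simp
    qed
  qed
qed

lemma smooth_off_one_minus_sum:
  assumes "\<And>i. i \<in> I \<Longrightarrow> smooth_off D (f i)"
  shows "smooth_off D (\<lambda>x. 1 - (\<Sum>i\<in>I. f i x))"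
  unfolding smooth_off_def
proof
  fix c assume c: "c \<in> A"
  have "smooth_on (\<lambda>z. 1 - (\<Sum>i\<in>I. scalar (f i) c z)) (snd c ` (fst c - D))"
    using assms c by (intro smooth_on_diff smooth_on_const smooth_on_sum) (simp add: smooth_off_def)
  then show "smooth_on (scalar (\<lambda>x. 1 - (\<Sum>i\<in>I. f i x)) c) (snd c ` (fst c - D))"
    by (simp add: scalar_def)
qed

text \<open>The cutoff functions live on discs that meet \<open>D\<close> in their centres only. Near a point of \<open>D\<close> one of
  them is constantly one and the others vanish, so that one minus their sum vanishes there.\<close>

lemma cutoff_family:
  assumes D: "finite D" and e: "\<forall>p\<in>D. centred_chart A p (e p)"
  obtains r N where
    "\<forall>p\<in>D. 0 < r p \<and> ball 0 (r p) \<subseteq> chart_image (e p) \<and> (\<forall>z\<in>ball 0 (r p) - {0}. chart_inv (e p) z \<notin> D)"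
    "\<forall>p\<in>D. smooth_off {} (chart_cutoff (e p) (r p / 2))"
    "smooth_off {} (\<lambda>x. 1 - (\<Sum>p\<in>D. chart_cutoff (e p) (r p / 2) x))"
    "openin X N" "D \<subseteq> N" "\<forall>x\<in>N. 1 - (\<Sum>p\<in>D. chart_cutoff (e p) (r p / 2) x) = 0"
proof -
  have "\<forall>p\<in>D. \<exists>r. 0 < r \<and> ball 0 r \<subseteq> chart_image (e p) \<and> (\<forall>z\<in>ball 0 r - {0}. chart_inv (e p) z \<notin> D)"
  proof
    fix p assume "p \<in> D"
    then have "centred_chart A p (e p)" using e by blast
    from centred_chart_ball[OF this D]
    show "\<exists>r. 0 < r \<and> ball 0 r \<subseteq> chart_image (e p) \<and> (\<forall>z\<in>ball 0 r - {0}. chart_inv (e p) z \<notin> D)" by metis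
  qed
  from bchoice[OF this] obtain r where
    r: "\<forall>p\<in>D. 0 < r p \<and> ball 0 (r p) \<subseteq> chart_image (e p) \<and> (\<forall>z\<in>ball 0 (r p) - {0}. chart_inv (e p) z \<notin> D)" ..
  have ed: "e p \<in> A" "p \<in> fst (e p)" "snd (e p) p = 0" "chart_inv (e p) 0 = p" if "p \<in> D" for p
  proof -
    have "centred_chart A p (e p)" using e that by blast
    from centred_chartD[OF this]
    show "e p \<in> A" "p \<in> fst (e p)" "snd (e p) p = 0" "chart_inv (e p) 0 = p" by simp_all
  qed
  have r2: "0 < r p / 2" "cball 0 (r p / 2) \<subseteq> chart_image (e p)" "cball 0 (r p / 2) \<subseteq> ball 0 (r p)" if "p \<in> D" for p
  proof -
    show "0 < r p / 2" using r that by simp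
    then show *: "cball 0 (r p / 2) \<subseteq> ball 0 (r p)" by auto
    then show "cball 0 (r p / 2) \<subseteq> chart_image (e p)" using r that by blast
  qed
  let ?F = "\<lambda>p. chart_inv (e p) ` cball 0 (r p / 2)"
  have F: "closedin X (?F p)" if "p \<in> D" for p
    by (rule closedin_chart_compact[OF ed(1)[OF that] compact_cball r2(2)[OF that]])
  have pF: "p \<notin> ?F q" if "p \<in> D" "q \<in> D - {p}" for p q
  proof
    assume "p \<in> ?F q"
    then obtain z where z: "z \<in> cball 0 (r q / 2)" "p = chart_inv (e q) z" by blast
    then have "z \<noteq> 0" using ed(4)[of q] that by auto
    moreover have "z \<in> ball 0 (r q)" using r2(3)[of q] z(1) that by blast
    ultimately show False using r that z(2) by blast
  qed
  let ?\<chi> = "\<lambda>p. chart_cutoff (e p) (r p / 2)"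
  have sm: "\<forall>p\<in>D. smooth_off {} (?\<chi> p)"
    using chart_cutoff_facts(1)[OF ed(1) r2(1,2)] by blast
  let ?N = "\<lambda>p. {y \<in> fst (e p). snd (e p) y \<in> ball 0 (r p / 2 / 2)} - (\<Union>q\<in>D - {p}. ?F q)"
  have N: "openin X (?N p)" "p \<in> ?N p" if p: "p \<in> D" for p
  proof -
    have "closedin X (\<Union>q\<in>D - {p}. ?F q)" using D F by (intro closedin_Union) auto
    then show "openin X (?N p)" by (intro openin_diff chart_preimage_open[OF ed(1)[OF p] open_ball])
    show "p \<in> ?N p" using ed[OF p] r2(1)[OF p] pF[OF p] by auto
  qed
  have one: "(\<Sum>q\<in>D. ?\<chi> q x) = 1" if p: "p \<in> D" and x: "x \<in> ?N p" for p x
  proof -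
    have "?\<chi> p x = 1" by (rule chart_cutoff_facts(3)[OF ed(1)[OF p] r2(1,2)[OF p]]) (use x in auto)
    moreover have "(\<Sum>q\<in>D - {p}. ?\<chi> q x) = 0"
    proof (rule sum.neutral, rule ballI)
      fix q assume q: "q \<in> D - {p}"
      then have qD: "q \<in> D" by simp
      have "x \<notin> ?F q" using x q by blast
      then show "?\<chi> q x = 0" by (rule chart_cutoff_facts(2)[OF ed(1)[OF qD] r2(1,2)[OF qD]])
    qed
    ultimately show ?thesis unfolding sum.remove[OF D p] by simp
  qed
  show ?thesis
  proof (rule that[OF r sm])
    show "smooth_off {} (\<lambda>x. 1 - (\<Sum>p\<in>D. ?\<chi> p x))" by (rule smooth_off_one_minus_sum) (use sm in blast)
    show "openin X (\<Union>p\<in>D. ?N p)" using N(1) by (intro openin_Union) auto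
    show "D \<subseteq> (\<Union>p\<in>D. ?N p)" using N(2) by blast
    show "\<forall>x\<in>(\<Union>p\<in>D. ?N p). 1 - (\<Sum>p\<in>D. ?\<chi> p x) = 0"
    proof
      fix x assume "x \<in> (\<Union>p\<in>D. ?N p)"
      then obtain p where "p \<in> D" "x \<in> ?N p" by (rule UN_E)
      from one[OF this] show "1 - (\<Sum>p\<in>D. ?\<chi> p x) = 0" by simp
    qed
  qed
qed

text \<open>The form is multiplied by a function that vanishes near its singularities. This does not affect
  the boundary integral, because the cutoff functions live in charts with open image and these
  contain no boundary points.\<close>

lemma stokes_cut_off:
  assumes comp: "compact_space X" and P: "partition_of_unity X A C \<rho>" and P': "partition_of_unity X A C' \<rho>'"
    and D: "finite D" and e: "\<forall>p\<in>D. centred_chart A p (e p)"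
    and a: "smooth_form_off 1 0 A D a" and b: "smooth_form_off 0 1 A D b"
    and s: "smooth_off {} (\<lambda>x. 1 - (\<Sum>p\<in>D. chart_cutoff (e p) (t p) x))"
    and N: "openin X N" "D \<subseteq> N" "\<forall>x\<in>N. 1 - (\<Sum>p\<in>D. chart_cutoff (e p) (t p) x) = 0"
  defines "a0 \<equiv> \<lambda>c z. scalar (\<lambda>x. 1 - (\<Sum>p\<in>D. chart_cutoff (e p) (t p) x)) c z * a c z"
    and "b0 \<equiv> \<lambda>c z. scalar (\<lambda>x. 1 - (\<Sum>p\<in>D. chart_cutoff (e p) (t p) x)) c z * b c z"
  shows "\<And>c. c \<in> C \<Longrightarrow> set_integrable lborel (chart_image c) (\<lambda>z. of_real (\<rho> c (chart_inv c z)) * ext_d (a0, b0) c z * (- 2 * \<i>))"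
    and "\<And>c. c \<in> C' \<Longrightarrow> set_integrable lborel (boundary_trace A c)
      (\<lambda>x. of_real (\<rho>' c (chart_inv c (of_real x))) * (a c (of_real x) + b c (of_real x)))"
    and "(surface_sum C \<rho> (ext_d (a0, b0)))
      = (boundary_sum C' \<rho>' a b)"
proof -
  note pf' = partition_facts[OF P']
  have fa: "smooth_form_off 1 0 A {} a0" and fb: "smooth_form_off 0 1 A {} b0"
    unfolding a0_def b0_def
    by (rule smooth_form_off_scale_cut[OF s a N D], rule smooth_form_off_scale_cut[OF s b N D])
  show "set_integrable lborel (chart_image c) (\<lambda>z. of_real (\<rho> c (chart_inv c z)) * ext_d (a0, b0) c z * (- 2 * \<i>))" if "c \<in> C" for c
    by (rule partition_log_integrable[OF comp P that log_2forms_empty[OF smooth_form_off_ext_d[OF fa fb]]]) simp_all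
  have eq: "indicator (boundary_trace A c) x *\<^sub>R (of_real (\<rho>' c (chart_inv c (of_real x))) * (a0 c (of_real x) + b0 c (of_real x)))
     = indicator (boundary_trace A c) x *\<^sub>R (of_real (\<rho>' c (chart_inv c (of_real x))) * (a c (of_real x) + b c (of_real x)))"
    if c: "c \<in> A" for c x
  proof (cases "x \<in> boundary_trace A c")
    case True
    then obtain y where y: "y \<in> fst c" "y \<in> surface_boundary A" "complex_of_real x = snd c y"
      by (auto simp: boundary_trace_def)
    have "chart_cutoff (e p) (t p) y = 0" if "p \<in> D" for p
    proof -
      have "centred_chart A p (e p)" using e that by blast
      from open_chart_no_boundary[OF centred_chartD(1,4)[OF this]] have "y \<notin> fst (e p)" using y(2) by blast
      then show ?thesis by (simp add: chart_cutoff_def chart_ext_def)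
    qed
    then have "a0 c (of_real x) = a c (of_real x)" "b0 c (of_real x) = b c (of_real x)"
      unfolding a0_def b0_def y(3) using c y(1) by simp_all
    then show ?thesis by simp
  qed simp
  note st = stokes_smooth[OF comp P P' fa fb]
  show "set_integrable lborel (boundary_trace A c)
      (\<lambda>x. of_real (\<rho>' c (chart_inv c (of_real x))) * (a c (of_real x) + b c (of_real x)))" if "c \<in> C'" for c
    using st(1)[OF that] unfolding set_integrable_def eq[OF pf'(2)[OF that]] .
  have "(boundary_sum C' \<rho>' a0 b0)
     = (boundary_sum C' \<rho>' a b)"
    unfolding set_lebesgue_integral_def by (rule sum.cong[OF refl]) (simp only: eq[OF pf'(2)])
  with st(2) show "(surface_sum C \<rho> (ext_d (a0, b0)))
      = (boundary_sum C' \<rho>' a b)" by simp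
qed

text \<open>The form is the sum of a piece that vanishes near \<open>D\<close>, which yields the boundary integral, and of
  one piece for each point of \<open>D\<close>, which yields a limit of circle integrals.\<close>

lemma stokes_log:
  assumes comp: "compact_space X" and P: "partition_of_unity X A C \<rho>" and P': "partition_of_unity X A C' \<rho>'"
    and D: "finite D" and e: "\<forall>p\<in>D. centred_chart A p (e p)"
    and a: "smooth_form_off 1 0 A D a" and b: "smooth_form_off 0 1 A D b"
    and \<eta>: "\<eta> \<in> log_2forms A D"
    and d: "\<And>c x. c \<in> A \<Longrightarrow> x \<in> fst c \<Longrightarrow> x \<notin> D \<Longrightarrow> ext_d (a, b) c (snd c x) = \<eta> c (snd c x)"
  obtains L where "\<forall>p\<in>D. ((\<lambda>\<epsilon>. circle_integral (a, b) (e p) \<epsilon>) \<longlongrightarrow> L p) (at_right 0)"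
    "(surface_sum C \<rho> \<eta>)
      = (boundary_sum C' \<rho>' a b) - (\<Sum>p\<in>D. L p)"
proof -
  note pf = partition_facts[OF P]
  obtain r N where r: "\<forall>p\<in>D. 0 < r p \<and> ball 0 (r p) \<subseteq> chart_image (e p) \<and> (\<forall>z\<in>ball 0 (r p) - {0}. chart_inv (e p) z \<notin> D)"
    and sm: "\<forall>p\<in>D. smooth_off {} (chart_cutoff (e p) (r p / 2))"
    and s: "smooth_off {} (\<lambda>x. 1 - (\<Sum>p\<in>D. chart_cutoff (e p) (r p / 2) x))"
    and N: "openin X N" "D \<subseteq> N" "\<forall>x\<in>N. 1 - (\<Sum>p\<in>D. chart_cutoff (e p) (r p / 2) x) = 0"
    using cutoff_family[OF D e] .
  let ?\<chi> = "\<lambda>p. chart_cutoff (e p) (r p / 2)"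
  let ?s = "\<lambda>x. 1 - (\<Sum>p\<in>D. ?\<chi> p x)"
  \<comment> \<open>\<open>None\<close> indexes the part away from the poles, \<open>Some p\<close> the part near \<open>p\<close>.\<close>
  define S where "S i = (case i of None \<Rightarrow> scalar ?s | Some p \<Rightarrow> scalar (?\<chi> p))" for i
  define a' where "a' i = (\<lambda>c z. S i c z * a c z)" for i
  define b' where "b' i = (\<lambda>c z. S i c z * b c z)" for i
  let ?I = "insert None (Some ` D)"
  have I: "finite ?I" using D by simp
  note cut = stokes_cut_off[OF comp P P' D e a b s N]
  let ?g = "\<lambda>i c z. of_real (\<rho> c (chart_inv c z)) * ext_d (a' i, b' i) c z * (- 2 * \<i>)"
  define J where "J i = (\<Sum>c\<in>C. LINT z:chart_image c|lborel. ?g i c z)" for i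
  have none: "a' None = (\<lambda>c z. scalar ?s c z * a c z)" "b' None = (\<lambda>c z. scalar ?s c z * b c z)"
    by (simp_all add: a'_def b'_def S_def)
  have some: "a' (Some p) = (\<lambda>c z. scalar (?\<chi> p) c z * a c z)" "b' (Some p) = (\<lambda>c z. scalar (?\<chi> p) c z * b c z)" for p
    by (simp_all add: a'_def b'_def S_def)
  have pole: "ext_d (a' (Some p), b' (Some p)) \<in> log_2forms A D"
    "((\<lambda>\<epsilon>. circle_integral (a, b) (e p) \<epsilon>) \<longlongrightarrow> - J (Some p)) (at_right 0)" if p: "p \<in> D" for p
  proof -
    have ep: "centred_chart A p (e p)" using e p by blast
    have rp: "0 < r p" "ball 0 (r p) \<subseteq> chart_image (e p)" "\<forall>z\<in>ball 0 (r p) - {0}. chart_inv (e p) z \<notin> D"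
      using r p by blast+
    show "ext_d (a' (Some p), b' (Some p)) \<in> log_2forms A D"
      "((\<lambda>\<epsilon>. circle_integral (a, b) (e p) \<epsilon>) \<longlongrightarrow> - J (Some p)) (at_right 0)"
      unfolding J_def some
      by (rule stokes_pole(1)[OF comp P D p ep rp a b \<eta>], rule d; assumption)
        (rule stokes_pole(2)[OF comp P D p ep rp a b \<eta>], rule d; assumption)
  qed
  have J0: "J None = (boundary_sum C' \<rho>' a b)"
    unfolding J_def none by (rule cut(3))
  have gi: "set_integrable lborel (chart_image c) (?g i c)" if i: "i \<in> ?I" and c: "c \<in> C" for i c
  proof (cases i)
    case None
    show ?thesis unfolding None none by (rule cut(1)[OF c])
  next
    case (Some p)
    then have "p \<in> D" using i by auto
    from pole(1)[OF this] show ?thesis unfolding Some by (rule partition_log_integrable[OF comp P c _ D])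
  qed
  have Ssm: "smooth_off D (case i of None \<Rightarrow> ?s | Some p \<Rightarrow> ?\<chi> p)" if "i \<in> ?I" for i
    using that smooth_off_subset[OF s, of D] sm smooth_off_subset[of "{}" _ D] by (auto split: option.split)
  have Seq: "S i = scalar (case i of None \<Rightarrow> ?s | Some p \<Rightarrow> ?\<chi> p)" for i
    by (simp add: S_def split: option.split)
  have fa: "smooth_form_off 1 0 A D (a' i)" and fb: "smooth_form_off 0 1 A D (b' i)" if i: "i \<in> ?I" for i
    unfolding a'_def b'_def Seq
    by (rule smooth_form_off_scale[OF Ssm[OF i] a], rule smooth_form_off_scale[OF Ssm[OF i] b])
  have sumI: "(\<Sum>i\<in>?I. f i) = f None + (\<Sum>p\<in>D. f (Some p))" for f :: "'a option \<Rightarrow> complex"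
    using D by (simp add: sum.reindex)
  have S1: "(\<Sum>i\<in>?I. S i c (snd c y)) = 1" if "c \<in> A" "y \<in> fst c" for c y
    unfolding sumI using that by (simp add: S_def)
  have dsum: "\<eta> c (snd c x) = (\<Sum>i\<in>?I. ext_d (a' i, b' i) c (snd c x))" if c: "c \<in> A" and x: "x \<in> fst c" "x \<notin> D" for c x
    unfolding d[OF c x, symmetric]
  proof (rule ext_d_sum[OF c D I fa fb a b x])
    fix y assume y: "y \<in> fst c"
    show "a c (snd c y) = (\<Sum>i\<in>?I. a' i c (snd c y))"
      unfolding a'_def sum_distrib_right[symmetric] S1[OF c y] by simp
    show "b c (snd c y) = (\<Sum>i\<in>?I. b' i c (snd c y))"
      unfolding b'_def sum_distrib_right[symmetric] S1[OF c y] by simp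
  qed
  let ?h = "\<lambda>c z. of_real (\<rho> c (chart_inv c z)) * \<eta> c z * (- 2 * \<i>)"
  have "(LINT z:chart_image c|lborel. ?h c z) = (\<Sum>i\<in>?I. LINT z:chart_image c|lborel. ?g i c z)" if c: "c \<in> C" for c
  proof -
    have cA: "c \<in> A" by (rule pf(2)[OF c])
    have hi: "integrable lborel (\<lambda>z. indicator (chart_image c) z *\<^sub>R ?h c z)"
      using partition_log_integrable[OF comp P c \<eta> D] by (simp add: set_integrable_def)
    have gs: "\<And>i. i \<in> ?I \<Longrightarrow> integrable lborel (\<lambda>z. indicator (chart_image c) z *\<^sub>R ?g i c z)"
      using gi[OF _ c] by (simp only: set_integrable_def)
    have fin: "finite (snd c ` (fst c \<inter> D))" using D by simp
    have eq: "indicator (chart_image c) z *\<^sub>R ?h c z = (\<Sum>i\<in>?I. indicator (chart_image c) z *\<^sub>R ?g i c z)"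
      if z: "z \<notin> snd c ` (fst c \<inter> D)" for z
    proof (cases "z \<in> chart_image c")
      case True
      then obtain x where x: "x \<in> fst c" "z = snd c x" by (auto simp: chart_image_def)
      then have "x \<notin> D" using z by blast
      show ?thesis unfolding x(2) dsum[OF cA x(1) \<open>x \<notin> D\<close>]
        by (simp only: sum_distrib_left sum_distrib_right scaleR_sum_right)
    qed simp
    have "(LINT z:chart_image c|lborel. ?h c z) = (LINT z|lborel. (\<Sum>i\<in>?I. indicator (chart_image c) z *\<^sub>R ?g i c z))"
      unfolding set_lebesgue_integral_def
    proof (rule integral_cong_AE)
      show "(\<lambda>z. indicator (chart_image c) z *\<^sub>R ?h c z) \<in> borel_measurable lborel"
        using hi by (rule borel_measurable_integrable)
      show "(\<lambda>z. \<Sum>i\<in>?I. indicator (chart_image c) z *\<^sub>R ?g i c z) \<in> borel_measurable lborel"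
        by (rule borel_measurable_integrable[OF Bochner_Integration.integrable_sum[OF gs]])
      show "AE z in lborel. indicator (chart_image c) z *\<^sub>R ?h c z = (\<Sum>i\<in>?I. indicator (chart_image c) z *\<^sub>R ?g i c z)"
        by (rule AE_mp[OF AE_not_in_finite[OF fin]], rule AE_I2, rule impI) (rule eq)
    qed
    also have "\<dots> = (\<Sum>i\<in>?I. LINT z:chart_image c|lborel. ?g i c z)"
      unfolding set_lebesgue_integral_def by (rule Bochner_Integration.integral_sum[OF gs])
    finally show ?thesis .
  qed
  then have "(\<Sum>c\<in>C. LINT z:chart_image c|lborel. ?h c z) = (\<Sum>c\<in>C. \<Sum>i\<in>?I. LINT z:chart_image c|lborel. ?g i c z)"
    by (rule sum.cong[OF refl])
  also have "\<dots> = (\<Sum>i\<in>?I. J i)" unfolding J_def by (rule sum.swap)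
  also have "\<dots> = J None - (\<Sum>p\<in>D. - J (Some p))" unfolding sumI by (simp add: sum_negf)
  finally have val: "(\<Sum>c\<in>C. LINT z:chart_image c|lborel. ?h c z) = J None - (\<Sum>p\<in>D. - J (Some p))" .
  show ?thesis
  proof (rule that[of "\<lambda>p. - J (Some p)"])
    show "\<forall>p\<in>D. ((\<lambda>\<epsilon>. circle_integral (a, b) (e p) \<epsilon>) \<longlongrightarrow> - J (Some p)) (at_right 0)"
      using pole(2) by blast
  qed (use val J0 in simp)
qed

text \<open>By \<open>stokes_cut_off\<close> every partition of unity yields the surface integral of one and the same
  form, the derivative of the form cut off near \<open>D\<close>.\<close>

lemma boundary_integral_eq:
  assumes comp: "compact_space X" and P: "partition_of_unity X A C \<rho>"
    and D: "finite D" and e: "\<forall>p\<in>D. centred_chart A p (e p)"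
    and a: "smooth_form_off 1 0 A D a" and b: "smooth_form_off 0 1 A D b"
  shows "\<And>c. c \<in> C \<Longrightarrow> set_integrable lborel (boundary_trace A c)
      (\<lambda>x. of_real (\<rho> c (chart_inv c (of_real x))) * (a c (of_real x) + b c (of_real x)))"
    and "boundary_integral X A (a, b) = (boundary_sum C \<rho> a b)"
proof -
  obtain r N where "\<forall>p\<in>D. 0 < r p \<and> ball 0 (r p) \<subseteq> chart_image (e p) \<and> (\<forall>z\<in>ball 0 (r p) - {0}. chart_inv (e p) z \<notin> D)"
    and "\<forall>p\<in>D. smooth_off {} (chart_cutoff (e p) (r p / 2))"
    and s: "smooth_off {} (\<lambda>x. 1 - (\<Sum>p\<in>D. chart_cutoff (e p) (r p / 2) x))"
    and N: "openin X N" "D \<subseteq> N" "\<forall>x\<in>N. 1 - (\<Sum>p\<in>D. chart_cutoff (e p) (r p / 2) x) = 0"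
    using cutoff_family[OF D e] .
  let ?B = "\<lambda>C \<rho>. (boundary_sum C \<rho> a b)"
  note cut = stokes_cut_off[OF comp P _ D e a b s N]
  show int: "set_integrable lborel (boundary_trace A c)
      (\<lambda>x. of_real (\<rho> c (chart_inv c (of_real x))) * (a c (of_real x) + b c (of_real x)))" if "c \<in> C" for c
    by (rule cut(2)[OF P that])
  have uniq: "?B C' \<rho>' = ?B C \<rho>" if P': "partition_of_unity X A C' \<rho>'" for C' \<rho>'
    by (rule trans[OF cut(3)[OF P', symmetric] cut(3)[OF P]])
  show "boundary_integral X A (a, b) = ?B C \<rho>"
    unfolding boundary_integral_def
  proof (rule the_equality)
    show "has_boundary_integral X A (a, b) (?B C \<rho>)"
      unfolding has_boundary_integral_def fst_conv snd_conv using P int by blast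
    fix I assume "has_boundary_integral X A (a, b) I"
    then obtain C' \<rho>' where "partition_of_unity X A C' \<rho>'" "I = ?B C' \<rho>'"
      unfolding has_boundary_integral_def fst_conv snd_conv by blast
    then show "I = ?B C \<rho>" using uniq by simp
  qed
qed

text \<open>The right-hand side is the same for all partitions of unity that may be used to evaluate the
  left-hand side, so the definite description of the surface integral is justified.\<close>

lemma surface_integral_exact:
  assumes comp: "compact_space X"
    and D: "finite D" and e: "\<forall>p\<in>D. centred_chart A p (e p)"
    and a: "smooth_form_off 1 0 A D a" and b: "smooth_form_off 0 1 A D b"
    and \<eta>: "\<eta> \<in> log_2forms A D"
    and d: "\<And>c x. c \<in> A \<Longrightarrow> x \<in> fst c \<Longrightarrow> x \<notin> D \<Longrightarrow> ext_d (a, b) c (snd c x) = \<eta> c (snd c x)"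
  obtains L where "\<forall>p\<in>D. ((\<lambda>\<epsilon>. circle_integral (a, b) (e p) \<epsilon>) \<longlongrightarrow> L p) (at_right 0)"
    "surface_integral X A \<eta> = boundary_integral X A (a, b) - (\<Sum>p\<in>D. L p)"
proof -
  obtain C \<rho> where P: "partition_of_unity X A C \<rho>" using partition_exists[OF comp] .
  let ?S = "\<lambda>C \<rho>. (surface_sum C \<rho> \<eta>)"
  have val: "\<exists>L. (\<forall>p\<in>D. ((\<lambda>\<epsilon>. circle_integral (a, b) (e p) \<epsilon>) \<longlongrightarrow> L p) (at_right 0))
      \<and> ?S C' \<rho>' = boundary_integral X A (a, b) - (\<Sum>p\<in>D. L p)" if P': "partition_of_unity X A C' \<rho>'" for C' \<rho>'
  proof (rule stokes_log[OF comp P' P D e a b \<eta>])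
    show "ext_d (a, b) c (snd c x) = \<eta> c (snd c x)" if "c \<in> A" "x \<in> fst c" "x \<notin> D" for c x
      using that by (rule d)
    fix L assume "\<forall>p\<in>D. ((\<lambda>\<epsilon>. circle_integral (a, b) (e p) \<epsilon>) \<longlongrightarrow> L p) (at_right 0)"
      "?S C' \<rho>' = (boundary_sum C \<rho> a b) - (\<Sum>p\<in>D. L p)"
    then show ?thesis unfolding boundary_integral_eq(2)[OF comp P D e a b] by (intro exI conjI)
  qed
  from val[OF P] obtain L where L: "\<forall>p\<in>D. ((\<lambda>\<epsilon>. circle_integral (a, b) (e p) \<epsilon>) \<longlongrightarrow> L p) (at_right 0)"
    "?S C \<rho> = boundary_integral X A (a, b) - (\<Sum>p\<in>D. L p)" by blast
  have all: "?S C' \<rho>' = boundary_integral X A (a, b) - (\<Sum>p\<in>D. L p)" if P': "partition_of_unity X A C' \<rho>'" for C' \<rho>'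
  proof -
    from val[OF P'] obtain L' where L': "\<forall>p\<in>D. ((\<lambda>\<epsilon>. circle_integral (a, b) (e p) \<epsilon>) \<longlongrightarrow> L' p) (at_right 0)"
      "?S C' \<rho>' = boundary_integral X A (a, b) - (\<Sum>p\<in>D. L' p)" by blast
    have "(\<Sum>p\<in>D. L' p) = (\<Sum>p\<in>D. L p)"
      using L(1) L'(1) by (intro sum.cong[OF refl]) (auto intro: tendsto_unique[OF trivial_limit_at_right_real])
    with L'(2) show ?thesis by simp
  qed
  have "surface_integral X A \<eta> = boundary_integral X A (a, b) - (\<Sum>p\<in>D. L p)"
    unfolding surface_integral_def
  proof (rule the_equality)
    show "has_surface_integral X A \<eta> (boundary_integral X A (a, b) - (\<Sum>p\<in>D. L p))"
      unfolding has_surface_integral_def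
    proof (intro exI conjI ballI)
      show "partition_of_unity X A C \<rho>" by (rule P)
      show "set_integrable lborel (chart_image c) (\<lambda>z. of_real (\<rho> c (chart_inv c z)) * \<eta> c z * (- 2 * \<i>))" if "c \<in> C" for c
        by (rule partition_log_integrable[OF comp P that \<eta> D])
      show "boundary_integral X A (a, b) - (\<Sum>p\<in>D. L p) = ?S C \<rho>" by (rule all[OF P, symmetric])
    qed
    fix I assume "has_surface_integral X A \<eta> I"
    then obtain C' \<rho>' where "partition_of_unity X A C' \<rho>'" "I = ?S C' \<rho>'"
      unfolding has_surface_integral_def by blast
    then show "I = boundary_integral X A (a, b) - (\<Sum>p\<in>D. L p)" using all by simp
  qed
  with L(1) show ?thesis by (rule that)
qed

end

section \<open>Decomposition into a logarithmic form and a derivative\<close>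

text \<open>Since $(-\frac{1}{N}\,h\,z^{-N})_z = h\,z^{-N-1} - \frac{1}{N}\,h_z\,z^{-N}$, the order of a
  pole can be lowered step by step by subtracting derivatives, until a simple pole remains.\<close>

lemma polar_primitive:
  assumes "smooth_on h (ball 0 r)"
  shows "\<exists>B u. smooth_on B (ball 0 r) \<and> smooth_on u (ball 0 r) \<and>
    (\<forall>z\<in>ball 0 r - {0}. wirtinger_z (ball 0 r) (\<lambda>z. B z / z ^ N) z = h z / z ^ N - u z / z)"
  using assms
proof (induction N arbitrary: h)
  case 0
  let ?S = "ball 0 r :: complex set"
  have m: "model_set ?S" by (simp add: model_set_def)
  have z0: "wirtinger_z ?S (\<lambda>z. 0) z = 0" if "z \<in> ?S" for z
    by (rule has_wirtinger_imp_eq(1)[OF m that has_wirtinger_const])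
  have "smooth_on (\<lambda>z. z * h z) ?S"
    by (intro smooth_on_mult 0 smooth_on_holomorphic) (auto intro: holomorphic_intros)
  then show ?case using z0
    by (intro exI[of _ "\<lambda>z. 0"] exI[of _ "\<lambda>z. z * h z"]) (auto intro: smooth_on_const)
next
  case (Suc N)
  let ?S = "ball 0 r :: complex set"
  have m: "model_set ?S" by (simp add: model_set_def)
  show ?case
  proof (cases "N = 0")
    case True
    have z0: "wirtinger_z ?S (\<lambda>z. 0) z = 0" if "z \<in> ?S" for z
      by (rule has_wirtinger_imp_eq(1)[OF m that has_wirtinger_const])
    then show ?thesis using Suc.prems True
      by (intro exI[of _ "\<lambda>z. 0"] exI[of _ h]) (auto intro: smooth_on_const)
  next
    case False
    let ?hz = "wirtinger_z ?S h" and ?hb = "wirtinger_zbar ?S h" and ?c = "1 / of_nat N :: complex"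
    have h: "smooth_on h (?S \<inter> UNIV)" using Suc.prems by simp
    have hz: "smooth_on ?hz ?S" using smooth_on_wirtinger_z[OF h open_UNIV m] by simp
    have "smooth_on (\<lambda>z. ?c * ?hz z) ?S" by (intro smooth_on_mult smooth_on_const hz)
    from Suc.IH[OF this] obtain B u where B: "smooth_on B ?S" and u: "smooth_on u ?S"
      and eq: "\<forall>z\<in>?S - {0}. wirtinger_z ?S (\<lambda>z. B z / z ^ N) z = ?c * ?hz z / z ^ N - u z / z"
      by (elim exE conjE)
    let ?B = "\<lambda>z. z * (B z - ?c * h z)"
    have id: "smooth_on (\<lambda>z. z) ?S" by (intro smooth_on_holomorphic) (auto intro: holomorphic_intros)
    have sB: "smooth_on ?B ?S" by (intro smooth_on_mult smooth_on_diff smooth_on_const id B Suc.prems)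
    have o0: "open (- {0::complex})" by (simp add: open_Compl)
    have main: "wirtinger_z ?S (\<lambda>z. ?B z / z ^ Suc N) z = h z / z ^ Suc N - u z / z" if z: "z \<in> ?S - {0}" for z
    proof -
      have zS: "z \<in> ?S" "z \<noteq> 0" "z \<in> ?S \<inter> - {0}" using z by auto
      have id': "smooth_on (\<lambda>z. z ^ N) (?S \<inter> - {0})" by (rule smooth_on_power[OF smooth_on_subset[OF id]]) simp
      have "smooth_on (\<lambda>z. B z / z ^ N) (?S \<inter> - {0})"
        by (rule smooth_on_divide[OF smooth_on_subset[OF B] id']) auto
      from has_wirtinger_smooth_on[OF this o0 m zS(3)]
      have 1: "has_wirtinger (\<lambda>z. B z / z ^ N) (?c * ?hz z / z ^ N - u z / z) (wirtinger_zbar ?S (\<lambda>z. B z / z ^ N) z) (at z within ?S)"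
        using eq z by simp
      have "has_wirtinger h (?hz z) (?hb z) (at z within ?S)"
        using has_wirtinger_smooth_on[OF h open_UNIV m, of z] zS by simp
      from has_wirtinger_mult[OF has_wirtinger_const[of ?c] this]
      have 2: "has_wirtinger (\<lambda>z. ?c * h z) (?c * ?hz z) (?c * ?hb z) (at z within ?S)" by simp
      have "((\<lambda>z. inverse (z ^ N)) has_field_derivative - (of_nat N * z ^ (N - 1)) * inverse (z ^ N) ^ 2) (at z within ?S)"
        using zS(2) by (auto intro!: derivative_eq_intros simp: power2_eq_square)
      from has_wirtinger_diff[OF 1 has_wirtinger_mult[OF 2 has_wirtinger_field_derivative[OF this]]]
      have 3: "has_wirtinger (\<lambda>z. B z / z ^ N - ?c * h z * inverse (z ^ N))
        (?c * ?hz z / z ^ N - u z / z - (?c * ?hz z * inverse (z ^ N) + ?c * h z * (- (of_nat N * z ^ (N - 1)) * inverse (z ^ N) ^ 2)))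
        (wirtinger_zbar ?S (\<lambda>z. B z / z ^ N) z - (?c * ?hb z * inverse (z ^ N) + ?c * h z * 0)) (at z within ?S)" .
      have 4: "?c * h z * (- (of_nat N * z ^ (N - 1)) * inverse (z ^ N) ^ 2) = - (h z / z ^ Suc N)"
      proof -
        obtain M where M: "N = Suc M" using False by (cases N) auto
        have "z ^ (N - 1) * inverse (z ^ N) ^ 2 = inverse (z ^ Suc N)"
          using zS(2) by (simp add: M power2_eq_square field_simps)
        then have "h z * (z ^ (N - 1) * inverse (z ^ N) ^ 2) = h z / z ^ Suc N" by (simp only: divide_inverse)
        moreover have "?c * of_nat N = 1" using False by simp
        ultimately show ?thesis
          by (metis (no_types, opaque_lifting) mult.assoc mult.commute mult_minus_left mult_minus_right mult_1)
      qed
      have "wirtinger_z ?S (\<lambda>z. ?B z / z ^ Suc N) z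
        = ?c * ?hz z / z ^ N - u z / z - (?c * ?hz z * inverse (z ^ N) + ?c * h z * (- (of_nat N * z ^ (N - 1)) * inverse (z ^ N) ^ 2))"
        by (rule has_wirtinger_imp_eq(1)[OF m zS(1) has_wirtinger_transform[OF 3 o0]])
          (use zS in \<open>auto simp: field_simps\<close>)
      also have "\<dots> = h z / z ^ Suc N - u z / z" unfolding 4 by (simp add: divide_inverse)
      finally show ?thesis .
    qed
    show ?thesis by (intro exI[of _ ?B] exI[of _ u] conjI ballI sB u main)
  qed
qed

context riemann
begin

lemma polar_formsD:
  assumes "\<omega> \<in> polar_forms p q A D"
  shows "smooth_form_off p q A D \<omega>" "is_form p q A D \<omega>" "\<And>x. x \<in> D \<Longrightarrow> \<exists>N. pole_at A x N \<omega>"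
  using assms by (auto simp: polar_forms_def smooth_form_off_def)

lemma pole_at_zero_near:
  assumes e: "centred_chart A x e" and D: "finite D" and N: "openin X N" "x \<in> N"
    and zero: "\<And>y. y \<in> fst e \<Longrightarrow> y \<in> N \<Longrightarrow> y \<notin> D \<Longrightarrow> \<omega> e (snd e y) = 0"
  shows "pole_at A x k \<omega>"
proof -
  note ed = centred_chartD[OF e]
  obtain r where r: "r > 0" "ball 0 r \<subseteq> chart_image e" "\<forall>z\<in>ball 0 r - {0}. chart_inv e z \<notin> D"
    using centred_chart_ball[OF e D] .
  obtain T where T: "open T" "\<forall>y\<in>fst e. snd e y \<in> T \<longleftrightarrow> y \<in> N" using chart_open_image[OF ed(1) N(1)] .
  have "0 \<in> T \<inter> ball 0 r" using T(2) N(2) ed(2,3) r(1) by (metis IntI centre_in_ball)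
  moreover have "open (T \<inter> ball 0 r)" using T(1) by (intro open_Int open_ball)
  ultimately obtain t where t: "t > 0" "ball 0 t \<subseteq> T \<inter> ball 0 r" by (metis openE)
  have "\<omega> e z = 0 / z ^ k" if z: "z \<in> ball 0 t - {0}" for z
  proof -
    have zz: "z \<in> T" "z \<in> ball 0 r - {0}" using t(2) z by auto
    have zi: "z \<in> chart_image e" using r(2) zz(2) by blast
    have y: "chart_inv e z \<in> fst e" "snd e (chart_inv e z) = z" "chart_inv e z \<notin> D"
      using chart_inv_in[OF zi] zi r(3) zz(2) by auto
    have "chart_inv e z \<in> N" using bspec[OF T(2) y(1)] zz(1) unfolding y(2) by (rule iffD1)
    from zero[OF y(1) this y(3)] show ?thesis by (simp add: y(2))
  qed
  moreover have "ball 0 t \<subseteq> chart_image e" using t(2) r(2) by blast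
  ultimately show ?thesis unfolding pole_at_def
    using e t(1) smooth_on_const[of 0 "ball 0 t"] by (intro exI[of _ e] exI[of _ "\<lambda>z. 0"] exI[of _ t]) simp
qed

lemma pole_at_add:
  assumes f: "is_form p q A D f" and g: "is_form p q A D g" and D: "finite D"
    and pf: "pole_at A x N f" and pg: "pole_at A x M g"
  shows "pole_at A x (N + M) (\<lambda>c z. f c z + g c z)" and "N = M \<Longrightarrow> pole_at A x N (\<lambda>c z. f c z + g c z)"
proof -
  obtain e where e: "centred_chart A x e" using pf unfolding pole_at_def by blast
  obtain u r where u: "0 < r" "ball 0 r \<subseteq> chart_image e" "smooth_on u (ball 0 r)" "\<forall>z\<in>ball 0 r - {0}. f e z = u z / z ^ N"
    using pole_transfer[OF f D pf e] .
  obtain v s where v: "0 < s" "ball 0 s \<subseteq> chart_image e" "smooth_on v (ball 0 s)" "\<forall>z\<in>ball 0 s - {0}. g e z = v z / z ^ M"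
    using pole_transfer[OF g D pg e] .
  let ?t = "min r s"
  have t: "0 < ?t" "ball 0 ?t \<subseteq> chart_image e" using u v by auto
  have uv: "smooth_on u (ball 0 ?t)" "smooth_on v (ball 0 ?t)"
    by (rule smooth_on_subset[OF u(3) subset_ball], simp) (rule smooth_on_subset[OF v(3) subset_ball], simp)
  have id: "smooth_on (\<lambda>z. z) (ball 0 ?t)" by (intro smooth_on_holomorphic) (auto intro: holomorphic_intros)
  have "smooth_on (\<lambda>z. u z * z ^ M + v z * z ^ N) (ball 0 ?t)"
    by (intro smooth_on_add smooth_on_mult smooth_on_power uv id)
  moreover have "\<forall>z\<in>ball 0 ?t - {0}. f e z + g e z = (u z * z ^ M + v z * z ^ N) / z ^ (N + M)"
  proof
    fix z :: complex assume z: "z \<in> ball 0 ?t - {0}"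
    then have "f e z = u z / z ^ N" "g e z = v z / z ^ M" using u(4) v(4) by auto
    then show "f e z + g e z = (u z * z ^ M + v z * z ^ N) / z ^ (N + M)"
      using z by (simp add: power_add add_divide_distrib)
  qed
  ultimately show "pole_at A x (N + M) (\<lambda>c z. f c z + g c z)"
    unfolding pole_at_def using e t
    by (intro exI[of _ e] exI[of _ "\<lambda>z. u z * z ^ M + v z * z ^ N"] exI[of _ ?t]) simp
  assume NM: "N = M"
  have "smooth_on (\<lambda>z. u z + v z) (ball 0 ?t)" by (intro smooth_on_add uv)
  moreover have "\<forall>z\<in>ball 0 ?t - {0}. f e z + g e z = (u z + v z) / z ^ N"
    using u(4) v(4) NM by (simp add: add_divide_distrib)
  ultimately show "pole_at A x N (\<lambda>c z. f c z + g c z)"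
    unfolding pole_at_def using e t
    by (intro exI[of _ e] exI[of _ "\<lambda>z. u z + v z"] exI[of _ ?t]) simp
qed

lemma polar_forms_add:
  assumes f: "f \<in> polar_forms p q A D" and g: "g \<in> polar_forms p q A D" and D: "finite D"
  shows "(\<lambda>c z. f c z + g c z) \<in> polar_forms p q A D"
proof -
  note fd = polar_formsD[OF f] and gd = polar_formsD[OF g]
  have "\<exists>N. pole_at A x N (\<lambda>c z. f c z + g c z)" if x: "x \<in> D" for x
  proof -
    obtain N where N: "pole_at A x N f" using fd(3)[OF x] ..
    obtain M where M: "pole_at A x M g" using gd(3)[OF x] ..
    show ?thesis by (rule exI, rule pole_at_add(1)[OF fd(2) gd(2) D N M])
  qed
  then show ?thesis using smooth_form_off_add[OF fd(1) gd(1)] by (simp add: polar_forms_def)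
qed

lemma polar_forms_add_sum:
  assumes D: "finite D" and f: "f \<in> polar_forms p q A D" and I: "finite I"
    and g: "\<And>i. i \<in> I \<Longrightarrow> g i \<in> polar_forms p q A D"
  shows "(\<lambda>c z. f c z + (\<Sum>i\<in>I. g i c z)) \<in> polar_forms p q A D"
  using I g
proof (induction I rule: finite_induct)
  case empty
  then show ?case using f by simp
next
  case (insert i I)
  have "(\<lambda>c z. (f c z + (\<Sum>i\<in>I. g i c z)) + g i c z) \<in> polar_forms p q A D"
    by (rule polar_forms_add[OF insert(3) insert(4) D]) (use insert(4) in auto)
  then show ?case using insert(1,2) by (simp add: algebra_simps)
qed

lemma circle_integral_01_tendsto_0:
  assumes \<beta>: "\<beta> \<in> polar_forms 0 1 A D" and D: "finite D" and p: "p \<in> D" and e: "centred_chart A p e"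
  shows "((\<lambda>\<epsilon>. circle_integral (\<lambda>c z. 0, \<beta>) e \<epsilon>) \<longlongrightarrow> 0) (at_right 0)"
proof -
  obtain N where N: "pole_at A p N \<beta>" using polar_formsD(3)[OF \<beta> p] ..
  obtain g r where g: "0 < r" "ball 0 r \<subseteq> chart_image e" "smooth_on g (ball 0 r)"
    "\<forall>z\<in>ball 0 r - {0}. \<beta> e z = g z / z ^ N" "\<forall>z\<in>ball 0 r - {0}. chart_inv e z \<notin> D"
    using pole_transfer[OF polar_formsD(2)[OF \<beta>] D N e] .
  have "((\<lambda>\<epsilon>. integral {0..2 * pi} (\<lambda>t. \<beta> e (of_real \<epsilon> * cis t) * cnj (\<i> * (of_real \<epsilon> * cis t)))) \<longlongrightarrow> 0) (at_right 0)"
    by (rule circle_integral_dzbar_tendsto_0[OF g(3,1)]) (use g(4) in blast)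
  then show ?thesis by (simp only: circle_integral_def Let_def fst_conv snd_conv mult_zero_left add_0)
qed

lemma circle_integral_split:
  assumes D: "finite D" and e: "centred_chart A p e"
    and a: "smooth_form_off 1 0 A D a" and b: "smooth_form_off 0 1 A D b" and \<beta>: "smooth_form_off 0 1 A D \<beta>"
  shows "\<forall>\<^sub>F \<epsilon> in at_right 0. circle_integral (a, \<lambda>c z. b c z + - \<beta> c z) e \<epsilon> + circle_integral (\<lambda>c z. 0, \<beta>) e \<epsilon>
     = circle_integral (a, b) e \<epsilon>"
proof -
  note ed = centred_chartD[OF e]
  obtain r where r: "r > 0" "ball 0 r \<subseteq> chart_image e" "\<forall>z\<in>ball 0 r - {0}. chart_inv e z \<notin> D"
    using centred_chart_ball[OF e D] .
  show ?thesis
  proof (rule eventually_mono[OF eventually_at_right_real[OF r(1)]])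
    fix \<epsilon> assume eps: "\<epsilon> \<in> {0<..<r}"
    let ?z = "\<lambda>t. of_real \<epsilon> * cis t"
    have mem: "?z t \<in> snd e ` (fst e - D)" for t
    proof -
      have "?z t \<in> ball 0 r - {0}" using eps by (simp add: norm_mult)
      then show ?thesis unfolding mem_chart_image_minus[OF ed(1)] using r(2,3) by blast
    qed
    note c = continuous_circle[OF smooth_on_continuous[OF smooth_form_offD[OF _ ed(1)]] mem]
    have z: "continuous_on {0..2 * pi} (\<lambda>t. \<i> * ?z t)" "continuous_on {0..2 * pi} (\<lambda>t. cnj (\<i> * ?z t))"
      by (intro continuous_intros continuous_on_cis)+
    have i: "(\<lambda>t. a e (?z t) * (\<i> * ?z t)) integrable_on {0..2 * pi}"
      "(\<lambda>t. b e (?z t) * cnj (\<i> * ?z t)) integrable_on {0..2 * pi}"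
      "(\<lambda>t. \<beta> e (?z t) * cnj (\<i> * ?z t)) integrable_on {0..2 * pi}"
      by (rule integrable_continuous_real, rule continuous_on_mult, rule c[OF a], rule z(1))
        (rule integrable_continuous_real, rule continuous_on_mult, rule c[OF b] c[OF \<beta>], rule z(2))+
    have "circle_integral (a, \<lambda>c z. b c z + - \<beta> c z) e \<epsilon>
       = integral {0..2 * pi} (\<lambda>t. (a e (?z t) * (\<i> * ?z t) + b e (?z t) * cnj (\<i> * ?z t)) - \<beta> e (?z t) * cnj (\<i> * ?z t))"
      unfolding circle_integral_def Let_def fst_conv snd_conv by (rule integral_cong) (simp only: distrib_right mult_minus_left diff_conv_add_uminus add.assoc)
    also have "\<dots> = circle_integral (a, b) e \<epsilon> - circle_integral (\<lambda>c z. 0, \<beta>) e \<epsilon>"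
      unfolding circle_integral_def Let_def fst_conv snd_conv mult_zero_left add_0
      by (rule integral_diff[OF integrable_add[OF i(1,2)] i(3)])
    finally show "circle_integral (a, \<lambda>c z. b c z + - \<beta> c z) e \<epsilon> + circle_integral (\<lambda>c z. 0, \<beta>) e \<epsilon>
     = circle_integral (a, b) e \<epsilon>" by simp
  qed
qed

lemma smooth_form_off_zero: "smooth_form_off p q A D (\<lambda>c z. 0)"
  by (rule smooth_form_offI) (auto intro: smooth_on_const)

lemma del_01_add_sum:
  assumes D: "finite D" and b: "smooth_form_off 0 1 A D b" and I: "finite I"
    and f: "\<And>i. i \<in> I \<Longrightarrow> smooth_form_off 0 1 A D (f i)" and c: "c \<in> A" and x: "x \<in> fst c - D"
  shows "del_01 (\<lambda>c z. b c z + (\<Sum>i\<in>I. f i c z)) c (snd c x) = del_01 b c (snd c x) + (\<Sum>i\<in>I. del_01 (f i) c (snd c x))"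
  unfolding del_01_def
proof (rule has_wirtinger_imp_eq(1)[OF chart_model[OF c]])
  show "snd c x \<in> chart_image c" using x by (intro chart_in_image) simp
  show "has_wirtinger (\<lambda>z. b c z + (\<Sum>i\<in>I. f i c z))
     (wirtinger_z (chart_image c) (b c) (snd c x) + (\<Sum>i\<in>I. wirtinger_z (chart_image c) (f i c) (snd c x)))
     (wirtinger_zbar (chart_image c) (b c) (snd c x) + (\<Sum>i\<in>I. wirtinger_zbar (chart_image c) (f i c) (snd c x)))
     (at (snd c x) within chart_image c)"
    by (intro has_wirtinger_add has_wirtinger_sum coefficient_wirtinger(1)[OF smooth_form_offD[OF b c] D c x]
        coefficient_wirtinger(1)[OF smooth_form_offD[OF f c] D c x])
qed

text \<open>Off \<open>D\<close> the form $\alpha'$ is $d(\alpha - \beta')$, so Stokes' formula computes its integral; and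
  $\beta'$, being of type $(0,1)$, contributes nothing to the circle integrals in the limit.\<close>

lemma decomposition_value:
  assumes comp: "compact_space X" and D: "finite D" and e: "\<forall>p\<in>D. centred_chart A p (e p)"
    and a: "smooth_form_off 1 0 A D a" and b: "smooth_form_off 0 1 A D b"
    and \<alpha>': "\<alpha>' \<in> log_2forms A D" and \<beta>': "\<beta>' \<in> polar_forms 0 1 A D"
    and dec: "\<forall>c\<in>A. \<forall>x\<in>fst c - D. ext_d (a, b) c (snd c x) = \<alpha>' c (snd c x) + del_01 \<beta>' c (snd c x)"
  obtains L where "\<forall>p\<in>D. ((\<lambda>\<epsilon>. circle_integral (a, b) (e p) \<epsilon>) \<longlongrightarrow> L p) (at_right 0)"
    "surface_integral X A \<alpha>' + boundary_integral X A (\<lambda>c z. 0, \<beta>') = boundary_integral X A (a, b) - (\<Sum>p\<in>D. L p)"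
proof -
  note bs = polar_formsD(1)[OF \<beta>']
  let ?b = "\<lambda>c z. b c z + - \<beta>' c z"
  have sb: "smooth_form_off 0 1 A D ?b" by (rule smooth_form_off_add[OF b smooth_form_off_minus[OF bs]])
  have d: "ext_d (a, ?b) c (snd c x) = \<alpha>' c (snd c x)" if c: "c \<in> A" and x: "x \<in> fst c" "x \<notin> D" for c x
  proof -
    have x': "x \<in> fst c - D" using x by simp
    have "has_wirtinger (\<lambda>z. b c z - \<beta>' c z)
      (wirtinger_z (chart_image c) (b c) (snd c x) - wirtinger_z (chart_image c) (\<beta>' c) (snd c x))
      (wirtinger_zbar (chart_image c) (b c) (snd c x) - wirtinger_zbar (chart_image c) (\<beta>' c) (snd c x))
      (at (snd c x) within chart_image c)"
      by (intro has_wirtinger_diff coefficient_wirtinger(1)[OF smooth_form_offD[OF b c] D c x']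
        coefficient_wirtinger(1)[OF smooth_form_offD[OF bs c] D c x'])
    from has_wirtinger_imp_eq(1)[OF chart_model[OF c] chart_in_image[OF x(1)] this]
    have "ext_d (a, ?b) c (snd c x) = ext_d (a, b) c (snd c x) - del_01 \<beta>' c (snd c x)"
      by (simp add: ext_d_eq del_01_def)
    also have "\<dots> = \<alpha>' c (snd c x)" using dec c x' by simp
    finally show ?thesis .
  qed
  show ?thesis
  proof (rule surface_integral_exact[OF comp D e a sb \<alpha>'])
    show "ext_d (a, ?b) c (snd c x) = \<alpha>' c (snd c x)" if "c \<in> A" "x \<in> fst c" "x \<notin> D" for c x
      using that by (rule d)
    fix L assume L: "\<forall>p\<in>D. ((\<lambda>\<epsilon>. circle_integral (a, ?b) (e p) \<epsilon>) \<longlongrightarrow> L p) (at_right 0)"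
      "surface_integral X A \<alpha>' = boundary_integral X A (a, ?b) - (\<Sum>p\<in>D. L p)"
    have 1: "((\<lambda>\<epsilon>. circle_integral (a, b) (e p) \<epsilon>) \<longlongrightarrow> L p) (at_right 0)" if p: "p \<in> D" for p
    proof -
      have ep: "centred_chart A p (e p)" using e p by blast
      have "((\<lambda>\<epsilon>. circle_integral (a, ?b) (e p) \<epsilon> + circle_integral (\<lambda>c z. 0, \<beta>') (e p) \<epsilon>) \<longlongrightarrow> L p + 0) (at_right 0)"
        using L(1) p circle_integral_01_tendsto_0[OF \<beta>' D p ep] by (intro tendsto_add) blast+
      from Lim_transform_eventually[OF this circle_integral_split[OF D ep a b bs]] show ?thesis by simp
    qed
    obtain C \<rho> where P: "partition_of_unity X A C \<rho>" using partition_exists[OF comp] .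
    note b1 = boundary_integral_eq[OF comp P D e a b]
    note b2 = boundary_integral_eq[OF comp P D e smooth_form_off_zero bs]
    note b3 = boundary_integral_eq[OF comp P D e a sb]
    have "boundary_integral X A (a, ?b) = boundary_integral X A (a, b) - boundary_integral X A (\<lambda>c z. 0, \<beta>')"
      unfolding b1(2) b2(2) b3(2) sum_subtractf[symmetric]
    proof (rule sum.cong[OF refl])
      fix c assume c: "c \<in> C"
      let ?\<rho> = "\<lambda>x. complex_of_real (\<rho> c (chart_inv c (of_real x)))"
      have "(LINT x:boundary_trace A c|lborel. ?\<rho> x * (a c (of_real x) + (b c (of_real x) + - \<beta>' c (of_real x))))
        = (LINT x:boundary_trace A c|lborel. ?\<rho> x * (a c (of_real x) + b c (of_real x)) - ?\<rho> x * (0 + \<beta>' c (of_real x)))"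
        by (rule arg_cong[where f = "set_lebesgue_integral lborel (boundary_trace A c)"]) (simp add: fun_eq_iff algebra_simps)
      also have "\<dots> = (LINT x:boundary_trace A c|lborel. ?\<rho> x * (a c (of_real x) + b c (of_real x)))
         - (LINT x:boundary_trace A c|lborel. ?\<rho> x * (0 + \<beta>' c (of_real x)))"
        by (rule set_integral_diff(2)[OF b1(1)[OF c] b2(1)[OF c]])
      finally show "(LINT x:boundary_trace A c|lborel. ?\<rho> x * (a c (of_real x) + (b c (of_real x) + - \<beta>' c (of_real x))))
        = (LINT x:boundary_trace A c|lborel. ?\<rho> x * (a c (of_real x) + b c (of_real x)))
         - (LINT x:boundary_trace A c|lborel. ?\<rho> x * (0 + \<beta>' c (of_real x)))" .
    qed
    then have 2: "surface_integral X A \<alpha>' + boundary_integral X A (\<lambda>c z. 0, \<beta>') = boundary_integral X A (a, b) - (\<Sum>p\<in>D. L p)"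
      unfolding L(2) by simp
    show thesis by (rule that[of L]) (use 1 2 in blast)+
  qed
qed

text \<open>With \<open>a = g/z\<^sup>N\<close> in a coordinate around \<open>p\<close>, the coefficient of $\bar\partial(a\,dz)$ is
  $-g_{\bar z}/z^N$, and lowering its pole order gives a primitive \<open>B/z\<^sup>N\<close>. To obtain a form on the
  whole surface that is $(B/z^N)\,d\bar z$ near \<open>p\<close>, the function \<open>B/z\<^sup>N\<close> is cut off and multiplied by
  $\bar\partial\zeta$, where \<open>\<zeta>\<close> is a cut-off extension of $\bar z$.\<close>

lemma pole_correction:
  assumes a: "a \<in> polar_forms 1 0 A D" and D: "finite D" and p: "p \<in> D"
    and ch: "\<forall>q\<in>D. \<exists>e. centred_chart A q e"
  obtains \<theta> where "\<theta> \<in> polar_forms 0 1 A D" "pole_at A p 1 (\<lambda>c z. delbar_10 a c z + - del_01 \<theta> c z)"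
    "\<forall>q\<in>D - {p}. pole_at A q 1 (\<lambda>c z. - del_01 \<theta> c z)"
proof -
  note as = polar_formsD(1)[OF a]
  obtain N where N: "pole_at A p N a" using polar_formsD(3)[OF a p] ..
  then obtain e where e: "centred_chart A p e" unfolding pole_at_def by blast
  obtain g r where g: "0 < r" "ball 0 r \<subseteq> chart_image e" "smooth_on g (ball 0 r)"
    "\<forall>z\<in>ball 0 r - {0}. a e z = g z / z ^ N" "\<forall>z\<in>ball 0 r - {0}. chart_inv e z \<notin> D"
    using pole_transfer[OF polar_formsD(2)[OF a] D N e] .
  note ed = centred_chartD[OF e]
  let ?S = "chart_image e" and ?B = "ball 0 r :: complex set"
  have mB: "model_set ?B" by (simp add: model_set_def)
  have mS: "model_set ?S" by (rule chart_model[OF ed(1)])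
  have gU: "smooth_on g (?B \<inter> UNIV)" using g(3) by simp
  have "smooth_on (\<lambda>z. - wirtinger_zbar ?B g z) ?B"
    using smooth_on_minus[OF smooth_on_wirtinger_zbar[OF gU open_UNIV mB]] by simp
  from polar_primitive[OF this, of N] obtain B u where B: "smooth_on B ?B" "smooth_on u ?B"
    "\<forall>z\<in>?B - {0}. wirtinger_z ?B (\<lambda>z. B z / z ^ N) z = - wirtinger_zbar ?B g z / z ^ N - u z / z"
    by (elim exE conjE)
  let ?K = "cball 0 (r / 4) :: complex set"
  have KB: "?K \<subseteq> ?B" "cball 0 (r / 2) \<subseteq> ?B" using g(1) by auto
  have KS: "?K \<subseteq> ?S" "cball 0 (r / 2) \<subseteq> ?S" using KB g(2) by (blast intro: subset_trans)+
  let ?G = "\<lambda>z. of_real (cutoff (r / 4) z) * (B z / z ^ N)"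
  let ?Z = "\<lambda>z. of_real (cutoff (r / 2) z) * cnj z"
  define G where "G = chart_ext e ?G"
  define \<zeta> where "\<zeta> = chart_ext e ?Z"
  have o0: "open (- {0::complex})" by (simp add: open_Compl)
  have idU: "smooth_on (\<lambda>z. z) (S :: complex set)" for S
    by (rule smooth_on_subset[OF smooth_on_holomorphic[OF open_UNIV]]) auto
  have Bq: "smooth_on (\<lambda>z. B z / z ^ N) (?B \<inter> - {0})"
    by (rule smooth_on_divide[OF smooth_on_subset[OF B(1)] smooth_on_power[OF idU]]) auto
  have G0: "?G z = 0" if "z \<in> ?S - ?K" for z using that g(1) by (simp add: cutoff_eq_0)
  have Z0: "?Z z = 0" if "z \<in> ?S - cball 0 (r / 2)" for z using that g(1) by (simp add: cutoff_eq_0)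
  have r4: "0 < r / 4" "0 < r / 2" using g(1) by auto
  have smG: "smooth_on ?G (snd e ` (fst e - D))"
  proof (rule smooth_on_local)
    fix z assume "z \<in> snd e ` (fst e - D)"
    then have z: "z \<in> ?S" "chart_inv e z \<notin> D" unfolding mem_chart_image_minus[OF ed(1)] by auto
    have z0: "z \<noteq> 0" using z(2) ed(5) p by auto
    show "\<exists>T. open T \<and> z \<in> T \<and> smooth_on ?G (snd e ` (fst e - D) \<inter> T)"
    proof (cases "z \<in> ?B")
      case True
      have "smooth_on ?G (?B \<inter> - {0})" by (rule smooth_on_mult[OF smooth_on_cutoff[OF r4(1)] Bq])
      then have "smooth_on ?G (snd e ` (fst e - D) \<inter> (?B \<inter> - {0}))" by (rule smooth_on_subset) blast
      moreover have "open (?B \<inter> - {0})" using o0 by (intro open_Int open_ball)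
      ultimately show ?thesis using True z0 by (intro exI[of _ "?B \<inter> - {0}"]) simp
    next
      case False
      have "smooth_on ?G (snd e ` (fst e - D) \<inter> - ?K)"
        by (rule smooth_on_cong[OF smooth_on_const[of 0]])
          (use G0 in \<open>simp add: mem_chart_image_minus[OF ed(1)]\<close>)
      moreover have "open (- ?K)" by (simp add: open_Compl)
      moreover have "z \<in> - ?K" using False KB(1) by blast
      ultimately show ?thesis by (intro exI[of _ "- ?K"]) simp
    qed
  qed
  have sG: "smooth_off D G" unfolding G_def
    by (rule smooth_off_chart_ext[OF ed(1) compact_cball KS(1) _ smG]) (rule G0)
  have s\<zeta>: "smooth_off {} \<zeta>" unfolding \<zeta>_def
    by (rule smooth_off_chart_ext[OF ed(1) compact_cball KS(2)])
      (rule Z0, assumption, intro smooth_on_mult smooth_on_cutoff[OF r4(2)] smooth_on_cnj idU)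
  \<comment> \<open>The cutoff in \<open>\<zeta>\<close> has twice the radius of the one in \<open>G\<close>, and both are one close to \<open>p\<close>.\<close>
  define \<theta> where "\<theta> = (\<lambda>c z. scalar G c z * wirtinger_zbar (chart_image c) (scalar \<zeta> c) z)"
  have s\<theta>: "smooth_form_off 0 1 A D \<theta>" unfolding \<theta>_def
    by (rule smooth_form_off_scale[OF sG smooth_form_off_delbar_00[OF smooth_off_form[OF smooth_off_subset[OF s\<zeta>]] D]]) simp
  let ?F = "chart_inv e ` ?K"
  have F: "closedin X ?F" by (rule closedin_chart_compact[OF ed(1) compact_cball KS(1)])
  have \<theta>F: "\<theta> c (snd c x) = 0" if "c \<in> A" "x \<in> fst c" "x \<notin> ?F" for c x
  proof -
    have "G x = 0" unfolding G_def by (rule chart_ext_zero[OF ed(1) _ that(3)]) (rule G0)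
    then show ?thesis using that by (simp add: \<theta>_def)
  qed
  have qF: "openin X (topspace X - ?F) \<and> q \<in> topspace X - ?F" if q: "q \<in> D - {p}" for q
  proof -
    have "q \<notin> ?F"
    proof
      assume "q \<in> ?F"
      then obtain z where z: "z \<in> ?K" "q = chart_inv e z" by blast
      then have "z \<noteq> 0" using ed(5) q by auto
      then show False using g(5) z KB(1) q by blast
    qed
    moreover have "q \<in> topspace X"
    proof -
      obtain e' where "centred_chart A q e'" using ch q by blast
      from centred_chartD(1,2)[OF this] show ?thesis using chart_subset by blast
    qed
    ultimately show ?thesis using F by (simp add: openin_diff)
  qed
  have d\<theta>F: "del_01 \<theta> c (snd c x) = 0" if c: "c \<in> A" and x: "x \<in> fst c" "x \<notin> ?F" "x \<notin> D" for c x
  proof -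
    have "ext_d (\<lambda>c z. 0, \<theta>) c (snd c x) = 0"
      by (rule ext_d_zero_off_support[OF D smooth_form_off_zero s\<theta> F _ c x]) (use \<theta>F in blast)
    moreover have "wirtinger_zbar (chart_image c) (\<lambda>z. 0) (snd c x) = 0"
      by (rule has_wirtinger_imp_eq(2)[OF chart_model[OF c] chart_in_image[OF x(1)] has_wirtinger_const])
    ultimately show ?thesis by (simp add: ext_d_eq del_01_def)
  qed
  let ?b = "ball 0 (r / 8) :: complex set"
  have bB1: "?b \<subseteq> ?B" using g(1) by auto
  note bB = bB1 subset_trans[OF bB1 g(2)]
  have \<theta>e: "\<theta> e z = B z / z ^ N" if z: "z \<in> ?b - {0}" for z
  proof -
    have zS: "z \<in> ?S" using z bB by blast
    have ce: "scalar (chart_ext e f) e w = f w" if w: "w \<in> ?S" for f w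
      using w chart_inv_in[OF w] by (simp add: scalar_def chart_ext_def)
    have "cutoff (r / 4) z = 1" using z g(1) by (intro cutoff_eq_1) auto
    then have 1: "scalar G e z = B z / z ^ N" unfolding G_def ce[OF zS] by simp
    have i: "has_wirtinger (\<lambda>z. z) 1 0 (at z within ?S)"
      by (rule has_wirtinger_field_derivative) (rule DERIV_ident)
    have "has_wirtinger (scalar \<zeta> e) 0 1 (at z within ?S)"
    proof (rule has_wirtinger_transform[OF _ open_ball _ zS])
      show "has_wirtinger (\<lambda>z. cnj z) 0 1 (at z within ?S)" using has_wirtinger_cnj[OF i] by simp
      show "z \<in> ?b" using z by simp
      fix w assume w: "w \<in> ?b \<inter> ?S"
      then have "cutoff (r / 2) w = 1" using g(1) by (intro cutoff_eq_1) auto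
      then show "cnj w = scalar \<zeta> e w" unfolding \<zeta>_def using w by (subst ce) auto
    qed
    from has_wirtinger_imp_eq(2)[OF mS zS this] show ?thesis by (simp add: \<theta>_def 1)
  qed
  have pole\<theta>: "pole_at A p N \<theta>" unfolding pole_at_def
    using e r4 bB(2) smooth_on_subset[OF B(1) bB(1)] \<theta>e
    by (intro exI[of _ e] exI[of _ B] exI[of _ "r / 8"]) auto
  show ?thesis
  proof (rule that[of \<theta>])
    have "\<exists>M. pole_at A x M \<theta>" if x: "x \<in> D" for x
    proof (cases "x = p")
      case True
      then show ?thesis using pole\<theta> by blast
    next
      case False
      then have x': "x \<in> D - {p}" using x by simp
      obtain e' where e': "centred_chart A x e'" using ch x by blast
      have "pole_at A x 0 \<theta>"
        by (rule pole_at_zero_near[OF e' D conjunct1[OF qF[OF x']] conjunct2[OF qF[OF x']]])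
          (rule \<theta>F[OF centred_chartD(1)[OF e']], assumption, simp)
      then show ?thesis ..
    qed
    then show "\<theta> \<in> polar_forms 0 1 A D" using s\<theta> by (simp add: polar_forms_def)
    show "\<forall>q\<in>D - {p}. pole_at A q 1 (\<lambda>c z. - del_01 \<theta> c z)"
    proof
      fix q assume q: "q \<in> D - {p}"
      obtain e' where e': "centred_chart A q e'" using ch q by blast
      show "pole_at A q 1 (\<lambda>c z. - del_01 \<theta> c z)"
        by (rule pole_at_zero_near[OF e' D conjunct1[OF qF[OF q]] conjunct2[OF qF[OF q]]])
          (use d\<theta>F[OF centred_chartD(1)[OF e']] in simp)
    qed
    have val: "delbar_10 a e z + - del_01 \<theta> e z = u z / z ^ 1" if z: "z \<in> ?b - {0}" for z
    proof -
      have zS: "z \<in> ?S" "z \<in> ?B" "z \<in> ?B - {0}" "z \<noteq> 0" "z \<in> ?b \<inter> - {0}" "z \<in> ?B \<inter> - {0}" using z bB by auto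
      have o: "open (?b \<inter> - {0})" "open (?B \<inter> - {0})" using o0 by (auto intro: open_Int)
      have at_eq: "at z within ?S = at z" "at z within ?B = at z"
        using ed(4) zS by (auto intro: at_within_open)
      have "has_wirtinger g (wirtinger_z ?B g z) (wirtinger_zbar ?B g z) (at z within ?S)"
        using has_wirtinger_smooth_on[OF gU open_UNIV mB, of z] zS(2) unfolding at_eq by simp
      moreover have "((\<lambda>z. inverse (z ^ N)) has_field_derivative - (of_nat N * z ^ (N - 1)) * inverse (z ^ N) ^ 2) (at z within ?S)"
        using zS(4) by (auto intro!: derivative_eq_intros simp: power2_eq_square)
      ultimately have "has_wirtinger (\<lambda>z. g z * inverse (z ^ N))
         (wirtinger_z ?B g z * inverse (z ^ N) + g z * (- (of_nat N * z ^ (N - 1)) * inverse (z ^ N) ^ 2))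
         (wirtinger_zbar ?B g z * inverse (z ^ N) + g z * 0) (at z within ?S)"
        by (intro has_wirtinger_mult has_wirtinger_field_derivative)
      then have "has_wirtinger (a e)
         (wirtinger_z ?B g z * inverse (z ^ N) + g z * (- (of_nat N * z ^ (N - 1)) * inverse (z ^ N) ^ 2))
         (wirtinger_zbar ?B g z * inverse (z ^ N) + g z * 0) (at z within ?S)"
        by (rule has_wirtinger_transform[OF _ o(2) zS(6) zS(1)]) (use g(4) in \<open>simp add: divide_inverse\<close>)
      from has_wirtinger_imp_eq(2)[OF mS zS(1) this]
      have 1: "delbar_10 a e z = - wirtinger_zbar ?B g z / z ^ N" by (simp add: delbar_10_def divide_inverse)
      have "has_wirtinger (\<lambda>z. B z / z ^ N) (wirtinger_z ?B (\<lambda>z. B z / z ^ N) z) (wirtinger_zbar ?B (\<lambda>z. B z / z ^ N) z) (at z within ?S)"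
        using has_wirtinger_smooth_on[OF Bq o0 mB zS(6)] unfolding at_eq .
      then have "has_wirtinger (\<theta> e) (wirtinger_z ?B (\<lambda>z. B z / z ^ N) z) (wirtinger_zbar ?B (\<lambda>z. B z / z ^ N) z) (at z within ?S)"
        by (rule has_wirtinger_transform[OF _ o(1) zS(5) zS(1)]) (use \<theta>e in simp)
      from has_wirtinger_imp_eq(1)[OF mS zS(1) this]
      have 2: "del_01 \<theta> e z = - wirtinger_zbar ?B g z / z ^ N - u z / z"
        unfolding del_01_def using B(3) zS(3) by simp
      show ?thesis unfolding 1 2 by simp
    qed
    show "pole_at A p 1 (\<lambda>c z. delbar_10 a c z + - del_01 \<theta> c z)" unfolding pole_at_def
      using e r4 bB(2) smooth_on_subset[OF B(2) bB(1)] val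
      by (intro exI[of _ e] exI[of _ u] exI[of _ "r / 8"]) auto
  qed
qed

text \<open>Take $\beta' = b + \sum_p \theta_p$ with the corrections $\theta_p$ of the single poles. Then
  $d\alpha - \partial\beta' = \bar\partial a - \sum_p \partial\theta_p$ has at most simple poles.\<close>

lemma log_decomposition_exists:
  assumes a: "a \<in> polar_forms 1 0 A D" and b: "b \<in> polar_forms 0 1 A D" and D: "finite D"
  obtains \<alpha>' \<beta>' where "\<alpha>' \<in> log_2forms A D" "\<beta>' \<in> polar_forms 0 1 A D"
    "\<forall>c\<in>A. \<forall>x\<in>fst c - D. ext_d (a, b) c (snd c x) = \<alpha>' c (snd c x) + del_01 \<beta>' c (snd c x)"
proof -
  have ch: "\<forall>q\<in>D. \<exists>e. centred_chart A q e"
    using polar_formsD(3)[OF a] unfolding pole_at_def by blast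
  have "\<forall>p\<in>D. \<exists>\<theta>. \<theta> \<in> polar_forms 0 1 A D \<and> pole_at A p 1 (\<lambda>c z. delbar_10 a c z + - del_01 \<theta> c z)
    \<and> (\<forall>q\<in>D - {p}. pole_at A q 1 (\<lambda>c z. - del_01 \<theta> c z))"
  proof
    fix p assume "p \<in> D"
    then obtain \<theta> where t: "\<theta> \<in> polar_forms 0 1 A D" "pole_at A p 1 (\<lambda>c z. delbar_10 a c z + - del_01 \<theta> c z)"
      "\<forall>q\<in>D - {p}. pole_at A q 1 (\<lambda>c z. - del_01 \<theta> c z)" by (rule pole_correction[OF a D _ ch])
    show "\<exists>\<theta>. \<theta> \<in> polar_forms 0 1 A D \<and> pole_at A p 1 (\<lambda>c z. delbar_10 a c z + - del_01 \<theta> c z)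
      \<and> (\<forall>q\<in>D - {p}. pole_at A q 1 (\<lambda>c z. - del_01 \<theta> c z))" by (intro exI[of _ \<theta>] conjI t)
  qed
  from bchoice[OF this] obtain \<theta> where
    \<theta>: "\<forall>p\<in>D. \<theta> p \<in> polar_forms 0 1 A D \<and> pole_at A p 1 (\<lambda>c z. delbar_10 a c z + - del_01 (\<theta> p) c z)
    \<and> (\<forall>q\<in>D - {p}. pole_at A q 1 (\<lambda>c z. - del_01 (\<theta> p) c z))" ..
  define \<beta>' where "\<beta>' = (\<lambda>c z. b c z + (\<Sum>p\<in>D. \<theta> p c z))"
  define \<alpha>' where "\<alpha>' = (\<lambda>c z. delbar_10 a c z + (\<Sum>p\<in>D. - del_01 (\<theta> p) c z))"
  have \<beta>': "\<beta>' \<in> polar_forms 0 1 A D" unfolding \<beta>'_def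
    by (rule polar_forms_add_sum[OF D b D]) (use \<theta> in blast)
  have sa: "smooth_form_off 1 1 A D (delbar_10 a)" by (rule smooth_form_off_delbar_10[OF polar_formsD(1)[OF a] D])
  have s\<theta>: "smooth_form_off 1 1 A D (\<lambda>c z. - del_01 (\<theta> p) c z)" if "p \<in> D" for p
    by (rule smooth_form_off_minus[OF smooth_form_off_del_01[OF polar_formsD(1) D]]) (use \<theta> that in blast)
  have sum_form: "smooth_form_off 1 1 A D (\<lambda>c z. f c z + (\<Sum>p\<in>I. - del_01 (\<theta> p) c z))
     \<and> (pole_at A x 1 f \<longrightarrow> x \<in> D \<longrightarrow> x \<notin> I \<longrightarrow> pole_at A x 1 (\<lambda>c z. f c z + (\<Sum>p\<in>I. - del_01 (\<theta> p) c z)))"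
    if "finite I" "I \<subseteq> D" "smooth_form_off 1 1 A D f" for I f x
    using that
  proof (induction I rule: finite_induct)
    case empty
    then show ?case by simp
  next
    case (insert i I)
    let ?h = "\<lambda>c z. f c z + (\<Sum>p\<in>I. - del_01 (\<theta> p) c z)"
    have h: "smooth_form_off 1 1 A D ?h" and hp: "pole_at A x 1 f \<longrightarrow> x \<in> D \<longrightarrow> x \<notin> I \<longrightarrow> pole_at A x 1 ?h"
      using insert by auto
    have i: "i \<in> D" using insert by auto
    have eq: "(\<lambda>c z. f c z + (\<Sum>p\<in>insert i I. - del_01 (\<theta> p) c z)) = (\<lambda>c z. ?h c z + - del_01 (\<theta> i) c z)"
      using insert(1,2) by (simp add: fun_eq_iff algebra_simps)
    show ?case unfolding eq
    proof (intro conjI impI)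
      show "smooth_form_off 1 1 A D (\<lambda>c z. ?h c z + - del_01 (\<theta> i) c z)"
        by (rule smooth_form_off_add[OF h s\<theta>[OF i]])
      assume x: "pole_at A x 1 f" "x \<in> D" "x \<notin> insert i I"
      have 1: "pole_at A x 1 (\<lambda>c z. - del_01 (\<theta> i) c z)" using \<theta> i x by blast
      have 2: "pole_at A x 1 ?h" using hp x by simp
      have 3: "is_form 1 1 A D ?h" "is_form 1 1 A D (\<lambda>c z. - del_01 (\<theta> i) c z)"
        using h s\<theta>[OF i] by (simp_all only: smooth_form_off_def)
      show "pole_at A x 1 (\<lambda>c z. ?h c z + - del_01 (\<theta> i) c z)"
        by (rule pole_at_add(2)[OF 3 D 2 1 refl])
    qed
  qed
  have "pole_at A x 1 \<alpha>'" if x: "x \<in> D" for x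
  proof -
    let ?f = "\<lambda>c z. delbar_10 a c z + - del_01 (\<theta> x) c z"
    have f: "smooth_form_off 1 1 A D ?f" by (rule smooth_form_off_add[OF sa s\<theta>[OF x]])
    have "pole_at A x 1 ?f" using \<theta> x by blast
    then have "pole_at A x 1 (\<lambda>c z. ?f c z + (\<Sum>p\<in>D - {x}. - del_01 (\<theta> p) c z))"
      using sum_form[of "D - {x}" ?f x] D x f by auto
    moreover have "(\<lambda>c z. ?f c z + (\<Sum>p\<in>D - {x}. - del_01 (\<theta> p) c z)) = \<alpha>'"
      unfolding \<alpha>'_def by (simp add: fun_eq_iff sum.remove[OF D x])
    ultimately show ?thesis by simp
  qed
  moreover have "smooth_form_off 1 1 A D \<alpha>'"
    unfolding \<alpha>'_def using sum_form[OF D subset_refl sa] by blast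
  ultimately have \<alpha>': "\<alpha>' \<in> log_2forms A D" by (simp add: log_2forms_def)
  show ?thesis
  proof (rule that[OF \<alpha>' \<beta>'], intro ballI)
    fix c x assume c: "c \<in> A" and x: "x \<in> fst c - D"
    have "del_01 \<beta>' c (snd c x) = del_01 b c (snd c x) + (\<Sum>p\<in>D. del_01 (\<theta> p) c (snd c x))"
      unfolding \<beta>'_def
      by (rule del_01_add_sum[OF D polar_formsD(1)[OF b] D _ c x]) (use \<theta> polar_formsD(1) in blast)
    then show "ext_d (a, b) c (snd c x) = \<alpha>' c (snd c x) + del_01 \<beta>' c (snd c x)"
      by (simp add: \<alpha>'_def ext_d_def sum_negf)
  qed
qed

section \<open>The residue formula\<close>

text \<open>The limits of the circle integrals exist for every choice of coordinates, and only their sum is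
  known not to depend on it. Changing the coordinate at a single point leaves the other limits
  unchanged, hence also the limit at this point.\<close>

lemma residue_at_eqI:
  assumes e: "\<forall>p\<in>D. centred_chart A p (e p)" and p: "p \<in> D"
    and L: "\<And>e'. \<forall>p\<in>D. centred_chart A p (e' p) \<Longrightarrow>
      \<exists>L'. (\<forall>p\<in>D. ((\<lambda>\<epsilon>. circle_integral \<alpha> (e' p) \<epsilon>) \<longlongrightarrow> L' p) (at_right 0)) \<and> (\<Sum>p\<in>D. L' p) = s"
    and lim: "((\<lambda>\<epsilon>. circle_integral \<alpha> (e p) \<epsilon>) \<longlongrightarrow> l) (at_right 0)" and D: "finite D"
  shows "residue_at A \<alpha> p = 1 / (2 * of_real pi * \<i>) * l"
  unfolding residue_at_def
proof (rule the_equality)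
  let ?k = "1 / (2 * of_real pi * \<i>)"
  have k: "?k \<noteq> 0" by simp
  show "has_residue A \<alpha> p (?k * l)" unfolding has_residue_def
    using e p tendsto_mult[OF tendsto_const lim] by (intro exI[of _ "e p"]) blast
  fix R assume "has_residue A \<alpha> p R"
  then obtain c where c: "centred_chart A p c" and R: "((\<lambda>\<epsilon>. ?k * circle_integral \<alpha> c \<epsilon>) \<longlongrightarrow> R) (at_right 0)"
    unfolding has_residue_def by (elim exE conjE)
  \<comment> \<open>Only the coordinate at \<open>p\<close> is exchanged.\<close>
  let ?e = "e(p := c)"
  have "\<forall>q\<in>D. centred_chart A q (?e q)" using e c by simp
  from L[OF this] obtain M where M: "\<forall>q\<in>D. ((\<lambda>\<epsilon>. circle_integral \<alpha> (?e q) \<epsilon>) \<longlongrightarrow> M q) (at_right 0)" "(\<Sum>q\<in>D. M q) = s"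
    by (elim exE conjE)
  from L[OF e] obtain N where N: "\<forall>q\<in>D. ((\<lambda>\<epsilon>. circle_integral \<alpha> (e q) \<epsilon>) \<longlongrightarrow> N q) (at_right 0)" "(\<Sum>q\<in>D. N q) = s"
    by (elim exE conjE)
  have "M q = N q" if q: "q \<in> D - {p}" for q
  proof (rule tendsto_unique[OF trivial_limit_at_right_real])
    show "((\<lambda>\<epsilon>. circle_integral \<alpha> (e q) \<epsilon>) \<longlongrightarrow> M q) (at_right 0)" using bspec[OF M(1), of q] q by simp
    show "((\<lambda>\<epsilon>. circle_integral \<alpha> (e q) \<epsilon>) \<longlongrightarrow> N q) (at_right 0)" using bspec[OF N(1), of q] q by simp
  qed
  then have "(\<Sum>q\<in>D - {p}. M q) = (\<Sum>q\<in>D - {p}. N q)" by (rule sum.cong[OF refl])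
  moreover have "M p + (\<Sum>q\<in>D - {p}. M q) = N p + (\<Sum>q\<in>D - {p}. N q)"
    unfolding sum.remove[OF D p, symmetric] M(2) N(2) ..
  ultimately have "M p = N p" by (metis add_right_cancel)
  moreover have "N p = l" by (rule tendsto_unique[OF trivial_limit_at_right_real bspec[OF N(1) p] lim])
  ultimately have "M p = l" by simp
  then have "((\<lambda>\<epsilon>. circle_integral \<alpha> c \<epsilon>) \<longlongrightarrow> l) (at_right 0)" using bspec[OF M(1) p] by simp
  from tendsto_unique[OF trivial_limit_at_right_real R tendsto_mult[OF tendsto_const this]]
  show "R = ?k * l" .
qed

theorem reg_integral_ext_d:
  assumes comp: "compact_space X" and D: "finite D"
    and a: "a \<in> polar_forms 1 0 A D" and b: "b \<in> polar_forms 0 1 A D"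
  shows "reg_integral X A D (ext_d (a, b))
    = - 2 * of_real pi * \<i> * total_residue A D (a, b) + boundary_integral X A (a, b)"
proof -
  obtain \<alpha>' \<beta>' where dec: "\<alpha>' \<in> log_2forms A D" "\<beta>' \<in> polar_forms 0 1 A D"
    "\<forall>c\<in>A. \<forall>x\<in>fst c - D. ext_d (a, b) c (snd c x) = \<alpha>' c (snd c x) + del_01 \<beta>' c (snd c x)"
    using log_decomposition_exists[OF a b D] .
  have "\<forall>p\<in>D. \<exists>e. centred_chart A p e"
    using polar_formsD(3)[OF a] unfolding pole_at_def by blast
  from bchoice[OF this] obtain e where e: "\<forall>p\<in>D. centred_chart A p (e p)" ..
  note as = polar_formsD(1)[OF a] and bs = polar_formsD(1)[OF b]
  let ?I = "surface_integral X A \<alpha>' + boundary_integral X A (\<lambda>c z. 0, \<beta>')"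
  let ?s = "boundary_integral X A (a, b) - ?I"
  obtain L where L: "\<forall>p\<in>D. ((\<lambda>\<epsilon>. circle_integral (a, b) (e p) \<epsilon>) \<longlongrightarrow> L p) (at_right 0)"
    "?I = boundary_integral X A (a, b) - (\<Sum>p\<in>D. L p)"
    using decomposition_value[OF comp D e as bs dec] .
  have ex: "\<exists>L'. (\<forall>p\<in>D. ((\<lambda>\<epsilon>. circle_integral (a, b) (e' p) \<epsilon>) \<longlongrightarrow> L' p) (at_right 0)) \<and> (\<Sum>p\<in>D. L' p) = ?s"
    if e': "\<forall>p\<in>D. centred_chart A p (e' p)" for e'
  proof -
    obtain L' where L': "\<forall>p\<in>D. ((\<lambda>\<epsilon>. circle_integral (a, b) (e' p) \<epsilon>) \<longlongrightarrow> L' p) (at_right 0)"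
      "?I = boundary_integral X A (a, b) - (\<Sum>p\<in>D. L' p)"
      using decomposition_value[OF comp D e' as bs dec] .
    have "(\<Sum>p\<in>D. L' p) = ?s" unfolding L'(2) by simp
    with L'(1) show ?thesis by (intro exI[of _ L'] conjI)
  qed
  have res: "residue_at A (a, b) p = 1 / (2 * of_real pi * \<i>) * L p" if p: "p \<in> D" for p
    by (rule residue_at_eqI[OF e p ex bspec[OF L(1) p] D])
  have tot: "- 2 * of_real pi * \<i> * total_residue A D (a, b) = - (\<Sum>p\<in>D. L p)"
  proof -
    have "total_residue A D (a, b) = 1 / (2 * of_real pi * \<i>) * (\<Sum>p\<in>D. L p)"
      unfolding total_residue_def sum_distrib_left by (rule sum.cong[OF refl]) (rule res)
    then show ?thesis by simp
  qed
  have "reg_integral X A D (ext_d (a, b)) = ?I" unfolding reg_integral_def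
  proof (rule the_equality)
    show "has_reg_integral X A D (ext_d (a, b)) ?I" unfolding has_reg_integral_def
      by (rule exI, rule exI, intro conjI, rule dec(1), rule dec(2), rule dec(3), rule refl)
    fix J assume "has_reg_integral X A D (ext_d (a, b)) J"
    then obtain \<alpha>'' \<beta>'' where dec': "\<alpha>'' \<in> log_2forms A D" "\<beta>'' \<in> polar_forms 0 1 A D"
      "\<forall>c\<in>A. \<forall>x\<in>fst c - D. ext_d (a, b) c (snd c x) = \<alpha>'' c (snd c x) + del_01 \<beta>'' c (snd c x)"
      and J: "J = surface_integral X A \<alpha>'' + boundary_integral X A (\<lambda>c z. 0, \<beta>'')"
      unfolding has_reg_integral_def by (elim exE conjE)
    obtain M where M: "\<forall>p\<in>D. ((\<lambda>\<epsilon>. circle_integral (a, b) (e p) \<epsilon>) \<longlongrightarrow> M p) (at_right 0)"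
      "surface_integral X A \<alpha>'' + boundary_integral X A (\<lambda>c z. 0, \<beta>'') = boundary_integral X A (a, b) - (\<Sum>p\<in>D. M p)"
      using decomposition_value[OF comp D e as bs dec'] .
    have "(\<Sum>p\<in>D. M p) = (\<Sum>p\<in>D. L p)"
    proof (rule sum.cong[OF refl])
      fix p assume p: "p \<in> D"
      show "M p = L p"
        by (rule tendsto_unique[OF trivial_limit_at_right_real bspec[OF M(1) p] bspec[OF L(1) p]])
    qed
    then show "J = ?I" unfolding J M(2) L(2) by simp
  qed
  then show ?thesis unfolding L(2) tot by simp
qed

end

theorem theorem2p14:
  fixes X :: "'a topology" and A :: "'a chart set" and D :: "'a set" and \<alpha> :: "'a form1"
  assumes "riemann_surface X A" and "compact_space X"
    and "finite D" and "D \<subseteq> topspace X" and "D \<inter> surface_boundary A = {}"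
    and "\<alpha> \<in> polar_1forms A D"
  shows "reg_integral X A D (ext_d \<alpha>)
       = - 2 * of_real pi * \<i> * total_residue A D \<alpha> + boundary_integral X A \<alpha>"
proof -
  interpret riemann X A by unfold_locales fact
  obtain a b where "\<alpha> = (a, b)" by (cases \<alpha>)
  with assms(6) have ab: "\<alpha> = (a, b)" "a \<in> polar_forms 1 0 A D" "b \<in> polar_forms 0 1 A D"
    by (simp_all add: polar_1forms_def)
  show ?thesis unfolding ab(1) by (rule reg_integral_ext_d[OF assms(2,3) ab(2,3)])
qed

end
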